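(* Let $a>0$ and $V_0\in F^2_{a/2}$. The Cauchy problem for the heat equation associated to the complex harmonic oscillator $H^a_z=\frac{\partial^2}{\partial z^2}-\frac{a^2z^2}{4}-\frac a2$, $$\begin{cases} H^a_z V(t,z)=\frac{\partial}{\partial t}V(t,z), & (t,z)\in(0,\infty)\times\mathbb{C},\\ V(0,z)=V_0(z), & V_0\in F^2_{a/2},\end{cases}$$ has the unique solution given by $$V(t,z)=\int_{\mathbb{C}}J_a(z,w',t)\,V_0(w')\,d\lambda_{\frac a2}(w'),$$ where $$J_a(z,w',t)=\frac{2i}{\sqrt{\cosh(at)}}\exp\left\{\frac a4\left(\overline{w'}^{\,2}-z^2\right)\tanh(at)+\frac{az\overline{w'}}{2\cosh(at)}\right\}.$$
   Context: For $\alpha>0$, $d\lambda_\alpha(z)=\frac{\alpha}{\pi}e^{-\alpha|z|^2}dz$ denotes the Gaussian measure on $\mathbb{C}$ ($dz$ being Lebesgue area measure), and the Fock space $F^2_\alpha$ is the space of all entire functions belonging to $L^2(\mathbb{C},d\lambda_\alpha)$. Thus $F^2_{a/2}$ is the Fock space with parameter $\alpha=a/2$. Here $\frac{\partial}{\partial z}$ is the complex derivative in $z$.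
   Formalization: The printed integral gives 2i·V_0 at t=0 and solves the equation without the term -a/2; the theorem multiplies it by exp(-at/2)/(2i). A solution is taken to have V(t,·) in F^2_{a/2} for all t≥0 and to be jointly continuous up to t=0. *)

theory Defs
  imports "HOL-Complex_Analysis.Complex_Analysis"
begin

definition gaussian_measure :: "real \<Rightarrow> complex measure" where
  "gaussian_measure \<alpha> =
     density lborel (\<lambda>z. ennreal (\<alpha> / pi * exp (- \<alpha> * (cmod z)\<^sup>2)))"

definition fock_space :: "real \<Rightarrow> (complex \<Rightarrow> complex) set" where
  "fock_space \<alpha> =
     {f. f holomorphic_on UNIV \<and> integrable (gaussian_measure \<alpha>) (\<lambda>z. (cmod (f z))\<^sup>2)}"

definition harmonic_op :: "real \<Rightarrow> (complex \<Rightarrow> complex) \<Rightarrow> complex \<Rightarrow> complex" where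
  "harmonic_op a f z =
     deriv (deriv f) z - (of_real a)\<^sup>2 * z\<^sup>2 / 4 * f z - of_real a / 2 * f z"

text \<open>
  \<open>V\<close> is total on \<open>real\<close> but constrained only at times \<open>t \<ge> 0\<close>.
  Membership of every slice in the Fock space makes the complex derivative meaningful and
  fixes the class in which uniqueness is claimed: entire solutions without a growth
  restriction are not unique (Tychonoff).  Continuity up to \<open>t = 0\<close> ties the equation on
  \<open>t > 0\<close> to the initial value.
\<close>

definition heat_solution ::
    "real \<Rightarrow> (complex \<Rightarrow> complex) \<Rightarrow> (real \<Rightarrow> complex \<Rightarrow> complex) \<Rightarrow> bool" where
  "heat_solution a V\<^sub>0 V \<longleftrightarrow>
     (\<forall>t\<ge>0. V t \<in> fock_space (a / 2)) \<and>
     continuous_on ({0..} \<times> UNIV) (\<lambda>(t, z). V t z) \<and>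
     (\<forall>t>0. \<forall>z. ((\<lambda>s. V s z) has_vector_derivative harmonic_op a (V t) z) (at t)) \<and>
     (\<forall>z. V 0 z = V\<^sub>0 z)"

text \<open>
  The kernel in its published form.  At \<open>t = 0\<close> it is \<open>2 \<i>\<close> times the reproducing kernel of \<open>fock_space (a / 2)\<close>, and in
  \<open>(t, z)\<close> it solves the equation with \<open>harmonic_op a + a / 2\<close> in place of
  \<open>harmonic_op a\<close>.  The solution of the Cauchy problem therefore carries the normalising
  factor \<open>exp (- a t / 2) / (2 \<i>)\<close> in front of the integral against this kernel.
\<close>

definition heat_kernel :: "real \<Rightarrow> complex \<Rightarrow> complex \<Rightarrow> real \<Rightarrow> complex" where
  "heat_kernel a z w t =
     2 * \<i> / of_real (sqrt (cosh (a * t))) *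
     exp (of_real (a / 4) * ((cnj w)\<^sup>2 - z\<^sup>2) * of_real (tanh (a * t))
          + of_real a * z * cnj w / (2 * of_real (cosh (a * t))))"

end

theory Submission
  imports Defs "HOL-Probability.Distributions"
begin

text \<open>
  Write \<open>\<alpha> = a / 2\<close>. In the Fock space with parameter \<open>\<alpha>\<close> the operators \<open>d/dz\<close> and multiplication by
  \<open>\<alpha> z\<close> are adjoint to each other, so \<open>d\<^sup>2/dz\<^sup>2 - \<alpha>\<^sup>2 z\<^sup>2\<close> is formally skew-adjoint and
  \<open>exp (\<alpha> t)\<close> times a solution should have constant norm. Existence is a computation with
  Gaussian kernels; uniqueness is this conservation law made rigorous.

  Existence. The normalised kernel \<open>propagator\<close> solves the equation pointwise
  (\<open>propagator_equation\<close>, \<open>has_vector_derivative_propagator\<close>). On bounded sets of \<open>t\<close> and \<open>z\<close> it is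
  dominated by \<open>C exp (c |w|\<^sup>2 + B |w|)\<close> with \<open>2 c < \<alpha>\<close>, because \<open>tanh < 1\<close>; against a function
  of the Fock space such a bound is integrable (\<open>fock_space_dominated\<close>), so one may differentiate and
  pass to the limit under the integral. At \<open>t = 0\<close> the kernel is the reproducing kernel
  (\<open>fock_space_reproducing\<close>). That the integral stays in the Fock space follows from Schur's test: with
  half of the Gaussian weight attributed to each variable, the kernel is bounded by a Gaussian in
  \<open>(A x - B u, B y - A v)\<close> where \<open>z = x + \<i> y\<close>, \<open>w = u + \<i> v\<close>, \<open>A\<^sup>2 = 1 + tanh (a t)\<close> and
  \<open>B\<^sup>2 = 1 - tanh (a t)\<close> (\<open>norm_propagator_le_schur_kernel\<close>, \<open>flow_fock_space\<close>).

  Uniqueness. Let \<open>W\<close> be \<open>exp (\<alpha> t)\<close> times the difference of two solutions. The energy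
  \<open>\<integral> |W|\<^sup>2 exp (- \<alpha> |z|\<^sup>2)\<close> is finite at each time, but nothing bounds it locally uniformly in
  time, and \<open>W\<close> need not lie in the domain of the operator. Replacing \<open>\<alpha>\<close> by \<open>\<beta> > \<alpha>\<close> in the weight
  makes all integrals converge, and the adjointness relation for the weight \<open>\<beta>\<close> gives
  \<open>2 (\<beta>\<^sup>2 - \<alpha>\<^sup>2) \<integral> Re (z\<^sup>2) |W|\<^sup>2 exp (- \<beta> |z|\<^sup>2)\<close> as the time derivative (\<open>damped_energy_deriv\<close>).
  As \<open>\<beta> \<rightarrow> \<alpha>\<close> this tends to \<open>0\<close> boundedly, so the energy is constant on each interval on which it is
  bounded (\<open>energy_constant_if_bounded\<close>). By Fatou's lemma the energy is lower semicontinuous, and a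
  Baire category argument shows that a finite lower semicontinuous function with that property is
  constant (\<open>constant_if_constant_where_bounded\<close>). As it vanishes at \<open>t = 0\<close>, so does \<open>W\<close> everywhere.
\<close>

section \<open>Lebesgue measure and Gaussian integrals on the complex plane\<close>

lemma measurable_Complex_pair [measurable]:
  "(\<lambda>(x, y). Complex x y) \<in> borel_measurable (lborel \<Otimes>\<^sub>M lborel)"
  unfolding borel_measurable_complex_iff by (simp add: case_prod_beta)

lemma lborel_complex_eq_pair:
  "(lborel :: complex measure) = distr (lborel \<Otimes>\<^sub>M lborel) borel (\<lambda>(x, y). Complex x y)"
proof (rule lborel_eqI)
  fix l u :: complex
  assume le: "\<And>b. b \<in> Basis \<Longrightarrow> l \<bullet> b \<le> u \<bullet> b"
  have le': "Re l \<le> Re u" "Im l \<le> Im u"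
    using le[of 1] le[of \<i>] by (auto simp: Basis_complex_def inner_complex_def)
  have "(\<lambda>(x, y). Complex x y) -` box l u \<inter> space (lborel \<Otimes>\<^sub>M lborel)
      = {Re l<..<Re u} \<times> {Im l<..<Im u}"
    by (auto simp: box_def Basis_complex_def inner_complex_def space_pair_measure)
  then show "emeasure (distr (lborel \<Otimes>\<^sub>M lborel) borel (\<lambda>(x, y). Complex x y)) (box l u)
      = ennreal (\<Prod>b\<in>Basis. (u - l) \<bullet> b)"
    using le'
    by (subst emeasure_distr)
       (simp_all add: lborel.emeasure_pair_measure_Times Basis_complex_def inner_complex_def
          ennreal_mult)
qed simp

lemma nn_integral_lborel_complex:
  assumes [measurable]: "f \<in> borel_measurable borel"
  shows "(\<integral>\<^sup>+z. f z \<partial>lborel) = (\<integral>\<^sup>+x. \<integral>\<^sup>+y. f (Complex x y) \<partial>lborel \<partial>lborel)"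
    and "(\<integral>\<^sup>+z. f z \<partial>lborel) = (\<integral>\<^sup>+y. \<integral>\<^sup>+x. f (Complex x y) \<partial>lborel \<partial>lborel)"
proof -
  have [measurable]: "(\<lambda>p. f (Complex (fst p) (snd p))) \<in> borel_measurable (lborel \<Otimes>\<^sub>M lborel)"
    using measurable_compose[OF measurable_Complex_pair assms] by (simp add: case_prod_beta)
  have "(\<integral>\<^sup>+z. f z \<partial>lborel) = (\<integral>\<^sup>+p. f (Complex (fst p) (snd p)) \<partial>(lborel \<Otimes>\<^sub>M lborel))"
    by (subst lborel_complex_eq_pair, subst nn_integral_distr) (simp_all add: case_prod_beta)
  then show "(\<integral>\<^sup>+z. f z \<partial>lborel) = (\<integral>\<^sup>+x. \<integral>\<^sup>+y. f (Complex x y) \<partial>lborel \<partial>lborel)"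
    and "(\<integral>\<^sup>+z. f z \<partial>lborel) = (\<integral>\<^sup>+y. \<integral>\<^sup>+x. f (Complex x y) \<partial>lborel \<partial>lborel)"
    using lborel.nn_integral_fst[of "\<lambda>p. f (Complex (fst p) (snd p))" lborel]
      lborel_pair.nn_integral_snd[of "\<lambda>p. f (Complex (fst p) (snd p))"]
    by simp_all
qed

lemma nn_integral_lborel_complex_prod:
  assumes [measurable]: "g \<in> borel_measurable borel" "h \<in> borel_measurable borel"
  shows "(\<integral>\<^sup>+z. g (Re z) * h (Im z) \<partial>lborel) = (\<integral>\<^sup>+x. g x \<partial>lborel) * (\<integral>\<^sup>+y. h y \<partial>lborel)"
  by (subst nn_integral_lborel_complex) (simp_all add: nn_integral_cmult nn_integral_multc)

lemma nn_integral_translate: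
  fixes f :: "'a::euclidean_space \<Rightarrow> ennreal"
  assumes [measurable]: "f \<in> borel_measurable borel"
  shows "(\<integral>\<^sup>+x. f (c + x) \<partial>lborel) = (\<integral>\<^sup>+x. f x \<partial>lborel)"
  by (subst (2) lborel_distr_plus[of c, symmetric]) (simp add: nn_integral_distr)

lemma nn_integral_shear:
  assumes [measurable]: "f \<in> borel_measurable borel"
  shows "(\<integral>\<^sup>+z. f (Complex (Re z + c * Im z) (Im z)) \<partial>lborel) = (\<integral>\<^sup>+z. f z \<partial>lborel)"
    and "(\<integral>\<^sup>+z. f (Complex (Re z) (Im z + c * Re z)) \<partial>lborel) = (\<integral>\<^sup>+z. f z \<partial>lborel)"
proof -
  have [measurable]: "(\<lambda>z. f (Complex (Re z + c * Im z) (Im z))) \<in> borel_measurable borel"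
    "(\<lambda>z. f (Complex (Re z) (Im z + c * Re z))) \<in> borel_measurable borel"
    by (rule measurable_compose[OF _ assms], simp add: borel_measurable_complex_iff)+
  have [measurable]: "(\<lambda>x. f (Complex x y)) \<in> borel_measurable borel"
    "(\<lambda>x. f (Complex y x)) \<in> borel_measurable borel" for y
    by (rule measurable_compose[OF _ assms], simp add: borel_measurable_complex_iff)+
  show "(\<integral>\<^sup>+z. f (Complex (Re z + c * Im z) (Im z)) \<partial>lborel) = (\<integral>\<^sup>+z. f z \<partial>lborel)"
    using nn_integral_translate[of "\<lambda>x. f (Complex x y)" "c * y" for y]
    by (simp add: nn_integral_lborel_complex(2) add.commute)
  show "(\<integral>\<^sup>+z. f (Complex (Re z) (Im z + c * Re z)) \<partial>lborel) = (\<integral>\<^sup>+z. f z \<partial>lborel)"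
    using nn_integral_translate[of "\<lambda>x. f (Complex y x)" "c * y" for y]
    by (simp add: nn_integral_lborel_complex(1) add.commute)
qed

text \<open>
  A rotation is a product of three shears, each of which preserves Lebesgue measure by Fubini's theorem
  and translation invariance on the line. The factorisation uses \<open>tan (\<theta> / 2)\<close> and hence excludes
  the half turn; the general case applies it twice to a square root of \<open>v\<close>.
\<close>

lemma nn_integral_rotate_aux:
  assumes [measurable]: "f \<in> borel_measurable borel" and v: "cmod v = 1" "Re v \<noteq> -1"
  shows "(\<integral>\<^sup>+z. f (v * z) \<partial>lborel) = (\<integral>\<^sup>+z. f z \<partial>lborel)"
proof -
  define t where "t = - Im v / (1 + Re v)"
  have r: "(Re v)\<^sup>2 + (Im v)\<^sup>2 = 1"
    using v(1) by (simp add: cmod_power2[symmetric])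
  have ne: "1 + Re v \<noteq> 0" using v by auto
  have t1: "1 + t * Im v = Re v"
    using r ne unfolding t_def by (simp add: field_simps power2_eq_square)
  have t2: "t * (1 + Re v) = - Im v"
    using ne unfolding t_def by simp
  have t3: "t * (2 + t * Im v) = - Im v"
    using t2 unfolding t1[symmetric] by (simp add: algebra_simps)
  define g where "g = (\<lambda>z. f (Complex (Re z + t * Im z) (Im z)))"
  define h where "h = (\<lambda>z. g (Complex (Re z) (Im z + Im v * Re z)))"
  have [measurable]: "g \<in> borel_measurable borel"
    unfolding g_def by (rule measurable_compose[OF _ assms(1)]) (simp add: borel_measurable_complex_iff)
  have [measurable]: "h \<in> borel_measurable borel"
    unfolding h_def by (rule measurable_compose[of _ _ borel]) (simp_all add: borel_measurable_complex_iff)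
  have eq: "f (v * z) = h (Complex (Re z + t * Im z) (Im z))" for z
  proof -
    have "Re (v * z) = Re z + t * Im z + t * (Im z + Im v * (Re z + t * Im z))"
      "Im (v * z) = Im z + Im v * (Re z + t * Im z)"
      using arg_cong[OF t1, of "\<lambda>u. u * Re z"] arg_cong[OF t1, of "\<lambda>u. u * Im z"]
        arg_cong[OF t3, of "\<lambda>u. u * Im z"]
      by (simp_all add: algebra_simps)
    then have "v * z = Complex (Re z + t * Im z + t * (Im z + Im v * (Re z + t * Im z)))
        (Im z + Im v * (Re z + t * Im z))"
      by (simp add: complex_eq_iff)
    then show ?thesis by (simp add: h_def g_def)
  qed
  have "(\<integral>\<^sup>+z. f (v * z) \<partial>lborel) = (\<integral>\<^sup>+z. h z \<partial>lborel)"
    unfolding eq by (rule nn_integral_shear) simp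
  also have "\<dots> = (\<integral>\<^sup>+z. g z \<partial>lborel)"
    unfolding h_def by (rule nn_integral_shear) simp
  also have "\<dots> = (\<integral>\<^sup>+z. f z \<partial>lborel)"
    unfolding g_def by (rule nn_integral_shear) simp
  finally show ?thesis .
qed

lemma nn_integral_rotate:
  assumes f[measurable]: "f \<in> borel_measurable borel" and v: "cmod v = 1"
  shows "(\<integral>\<^sup>+z. f (v * z) \<partial>lborel) = (\<integral>\<^sup>+z. f z \<partial>lborel)"
proof -
  define u where "u = csqrt v"
  have u: "u\<^sup>2 = v" "cmod u = 1" "Re u \<noteq> -1"
    using v Re_csqrt[of v] by (simp_all add: u_def del: csqrt.sel)
  have "(\<integral>\<^sup>+z. f (v * z) \<partial>lborel) = (\<integral>\<^sup>+z. f (u * (u * z)) \<partial>lborel)"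
    by (simp add: u(1)[symmetric] power2_eq_square mult.assoc)
  also have "\<dots> = (\<integral>\<^sup>+z. f (u * z) \<partial>lborel)"
    by (rule nn_integral_rotate_aux) (use u in simp_all)
  also have "\<dots> = (\<integral>\<^sup>+z. f z \<partial>lborel)"
    by (rule nn_integral_rotate_aux) (use u in simp_all)
  finally show ?thesis .
qed

lemma distr_lborel_rotate:
  assumes "cmod v = 1"
  shows "distr lborel borel (\<lambda>z. v * z) = lborel"
proof (rule measure_eqI)
  fix A assume "A \<in> sets (distr lborel borel (\<lambda>z. v * z))"
  then have A[measurable]: "A \<in> sets borel" by simp
  have "emeasure (distr lborel borel (\<lambda>z. v * z)) A = (\<integral>\<^sup>+z. indicator A (v * z) \<partial>lborel)"
    by (subst nn_integral_indicator[symmetric], simp, subst nn_integral_distr) simp_all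
  then show "emeasure (distr lborel borel (\<lambda>z. v * z)) A = emeasure lborel A"
    using nn_integral_rotate[of "indicator A" v] assms by simp
qed simp

lemma nn_integral_gaussian_real:
  fixes c p q :: real
  assumes "c > 0" "p > 0"
  shows "(\<integral>\<^sup>+x. ennreal (exp (- c * (p * x - q)\<^sup>2)) \<partial>lborel) = ennreal (sqrt (pi / c) / p)"
proof -
  define \<sigma> where "\<sigma> = 1 / (p * sqrt (2 * c))"
  have s: "\<sigma> > 0" "2 * \<sigma>\<^sup>2 = 1 / (c * p\<^sup>2)" using assms by (simp_all add: \<sigma>_def field_simps power2_eq_square)
  have sq: "sqrt (2 * pi * \<sigma>\<^sup>2) = sqrt (pi / c) / p"
  proof -
    have "2 * pi * \<sigma>\<^sup>2 = (sqrt (pi / c) / p)\<^sup>2"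
      using s(2) assms by (simp add: field_simps power2_eq_square)
    then show ?thesis using assms by simp
  qed
  have eq: "exp (- c * (p * x - q)\<^sup>2) = sqrt (pi / c) / p * normal_density (q / p) \<sigma> x" for x
  proof -
    have "- c * (p * x - q)\<^sup>2 = - (x - q / p)\<^sup>2 / (2 * \<sigma>\<^sup>2)"
      using assms unfolding s(2) by (simp add: field_simps power2_eq_square)
    then show ?thesis unfolding normal_density_def sq using assms by simp
  qed
  have "(\<integral>\<^sup>+x. ennreal (normal_density (q / p) \<sigma> x) \<partial>lborel) = 1"
    using prob_space.emeasure_space_1[OF prob_space_normal_density[OF s(1), of "q / p"]]
    by (simp add: emeasure_density)
  moreover have "(\<integral>\<^sup>+x. ennreal (exp (- c * (p * x - q)\<^sup>2)) \<partial>lborel)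
    = ennreal (sqrt (pi / c) / p) * (\<integral>\<^sup>+x. ennreal (normal_density (q / p) \<sigma> x) \<partial>lborel)"
    unfolding eq using assms
    by (subst nn_integral_cmult[symmetric]) (simp_all add: ennreal_mult[symmetric])
  ultimately show ?thesis by simp
qed

lemma nn_integral_gaussian_complex:
  fixes c p q r s :: real
  assumes "c > 0" "p > 0" "r > 0"
  shows "(\<integral>\<^sup>+z. ennreal (exp (- c * ((p * Re z - q)\<^sup>2 + (r * Im z - s)\<^sup>2))) \<partial>lborel)
    = ennreal (pi / (c * p * r))"
proof -
  have "(\<integral>\<^sup>+z. ennreal (exp (- c * ((p * Re z - q)\<^sup>2 + (r * Im z - s)\<^sup>2))) \<partial>lborel)
     = (\<integral>\<^sup>+z. ennreal (exp (- c * (p * Re z - q)\<^sup>2)) * ennreal (exp (- c * (r * Im z - s)\<^sup>2)) \<partial>lborel)"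
    by (simp add: ennreal_mult[symmetric] exp_add[symmetric] distrib_left)
  also have "\<dots> = ennreal (sqrt (pi / c) / p) * ennreal (sqrt (pi / c) / r)"
    by (subst nn_integral_lborel_complex_prod)
       (simp_all only: nn_integral_gaussian_real assms, simp_all)
  also have "\<dots> = ennreal (pi / (c * p * r))"
    using assms by (subst ennreal_mult[symmetric]) (simp_all add: field_simps)
  finally show ?thesis .
qed

lemma nn_integral_gaussian_norm:
  assumes "c > 0"
  shows "(\<integral>\<^sup>+z. ennreal (exp (- c * (cmod z)\<^sup>2)) \<partial>lborel) = ennreal (pi / c)"
  using nn_integral_gaussian_complex[of c 1 1 0 0] assms by (simp add: cmod_power2)

lemma integrable_exp_quadratic:
  fixes c d :: real
  assumes "c > 0"
  shows "integrable lborel (\<lambda>z::complex. exp (- c * (cmod z)\<^sup>2 + d * cmod z))"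
proof (rule Bochner_Integration.integrable_bound)
  show "integrable lborel (\<lambda>z::complex. exp (d\<^sup>2 / (2 * c)) * exp (- (c / 2) * (cmod z)\<^sup>2))"
    using nn_integral_gaussian_norm[of "c / 2"] assms
    by (intro integrable_mult_right integrableI_nonneg) simp_all
  have "- c * r\<^sup>2 + d * r \<le> d\<^sup>2 / (2 * c) - (c / 2) * r\<^sup>2" for r :: real
  proof -
    have "d\<^sup>2 / (2 * c) - (c / 2) * r\<^sup>2 - (- c * r\<^sup>2 + d * r) = (c * r - d)\<^sup>2 / (2 * c)"
      using assms by (simp add: field_simps power2_eq_square)
    also have "\<dots> \<ge> 0" using assms by simp
    finally show ?thesis by simp
  qed
  then show "AE z::complex in lborel. norm (exp (- c * (cmod z)\<^sup>2 + d * cmod z))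
      \<le> norm (exp (d\<^sup>2 / (2 * c)) * exp (- (c / 2) * (cmod z)\<^sup>2))"
    by (simp add: exp_add[symmetric])
qed simp

section \<open>Integrals depending on a parameter\<close>

lemma has_derivative_integral:
  fixes f :: "'a::real_normed_vector \<Rightarrow> 'b \<Rightarrow> 'c::{banach, second_countable_topology}"
  assumes S: "open S" "convex S" "x\<^sub>0 \<in> S"
    and int: "\<And>x. x \<in> S \<Longrightarrow> integrable M (f x)"
    and der: "\<And>x w. x \<in> S \<Longrightarrow> w \<in> space M \<Longrightarrow> ((\<lambda>x. f x w) has_derivative f' x w) (at x)"
    and bound: "\<And>x w h. x \<in> S \<Longrightarrow> w \<in> space M \<Longrightarrow> norm (f' x w h) \<le> g w * norm h"
    and g: "integrable M g" "\<And>w. w \<in> space M \<Longrightarrow> 0 \<le> g w"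
    and meas: "\<And>h. (\<lambda>w. f' x\<^sub>0 w h) \<in> borel_measurable M"
  shows "((\<lambda>x. \<integral>w. f x w \<partial>M) has_derivative (\<lambda>h. \<integral>w. f' x\<^sub>0 w h \<partial>M)) (at x\<^sub>0)"
proof -
  have int': "integrable M (\<lambda>w. f' x\<^sub>0 w h)" for h
  proof (rule Bochner_Integration.integrable_bound)
    show "integrable M (\<lambda>w. g w * norm h)" using g by simp
    show "AE w in M. norm (f' x\<^sub>0 w h) \<le> norm (g w * norm h)"
      using bound[OF S(3)] g by (intro AE_I2) (simp add: abs_mult)
  qed (rule meas)
  have at_S: "at x\<^sub>0 within S = at x\<^sub>0"
    by (rule at_within_open[OF S(3,1)])
  have lin: "linear (f' x\<^sub>0 w)" if "w \<in> space M" for w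
    using der[OF S(3) that] has_derivative_linear by blast
  have norm_int: "norm (\<integral>w. f' x\<^sub>0 w h \<partial>M) \<le> norm h * (\<integral>w. g w \<partial>M)" for h
  proof -
    have "norm (\<integral>w. f' x\<^sub>0 w h \<partial>M) \<le> (\<integral>w. g w * norm h \<partial>M)"
      using integral_norm_bound[of M "\<lambda>w. f' x\<^sub>0 w h"] bound[OF S(3)] g int'
      by (intro order_trans[OF integral_norm_bound] integral_mono) simp_all
    then show ?thesis by (simp add: mult.commute)
  qed
  have bl: "bounded_linear (\<lambda>h. \<integral>w. f' x\<^sub>0 w h \<partial>M)"
  proof (rule bounded_linear_intro)
    fix h k r
    show "(\<integral>w. f' x\<^sub>0 w (h + k) \<partial>M) = (\<integral>w. f' x\<^sub>0 w h \<partial>M) + (\<integral>w. f' x\<^sub>0 w k \<partial>M)"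
      by (subst Bochner_Integration.integral_add[symmetric])
         (auto intro!: int' Bochner_Integration.integral_cong simp: linear_add[OF lin])
    show "(\<integral>w. f' x\<^sub>0 w (r *\<^sub>R h) \<partial>M) = r *\<^sub>R (\<integral>w. f' x\<^sub>0 w h \<partial>M)"
    proof -
      have "(\<integral>w. f' x\<^sub>0 w (r *\<^sub>R h) \<partial>M) = (\<integral>w. r *\<^sub>R f' x\<^sub>0 w h \<partial>M)"
        by (intro Bochner_Integration.integral_cong) (simp_all add: linear_scale[OF lin])
      then show ?thesis by simp
    qed
    show "norm (\<integral>w. f' x\<^sub>0 w h \<partial>M) \<le> norm h * (\<integral>w. g w \<partial>M)" by (rule norm_int)
  qed
  define q where "q = (\<lambda>x w. norm (f x w - f x\<^sub>0 w - f' x\<^sub>0 w (x - x\<^sub>0)) / norm (x - x\<^sub>0))"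
  have q_int: "(\<lambda>i. \<integral>w. q (X i) w \<partial>M) \<longlonglongrightarrow> (\<integral>w. 0 \<partial>M)"
    if X: "\<And>i. X i \<in> S - {x\<^sub>0}" "X \<longlonglongrightarrow> x\<^sub>0" for X
  proof (rule integral_dominated_convergence[where w = "\<lambda>w. 2 * g w"])
    show "q (X i) \<in> borel_measurable M" for i
    proof -
      have "f (X i) \<in> borel_measurable M" "f x\<^sub>0 \<in> borel_measurable M"
        using int[of "X i"] int[OF S(3)] X(1)[of i] by auto
      then show ?thesis
        using meas[of "X i - x\<^sub>0"] unfolding q_def by simp
    qed
    show "integrable M (\<lambda>w. 2 * g w)" using g by simp
    show "AE w in M. (\<lambda>i. q (X i) w) \<longlonglongrightarrow> 0"
    proof (rule AE_I2)
      fix w assume w: "w \<in> space M"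
      have "((\<lambda>x. q x w) \<longlongrightarrow> 0) (at x\<^sub>0 within S)"
        using der[OF S(3) w] unfolding q_def has_derivative_iff_norm at_S by (rule conjunct2)
      from this[unfolded tendsto_at_iff_sequentially o_def, rule_format, OF X]
      show "(\<lambda>i. q (X i) w) \<longlonglongrightarrow> 0" .
    qed
    show "AE w in M. norm (q (X i) w) \<le> 2 * g w" for i
    proof (rule AE_I2)
      fix w assume w: "w \<in> space M"
      let ?x = "X i"
      have x: "?x \<in> S" "?x \<noteq> x\<^sub>0" using X by auto
      have "norm (f ?x w - f x\<^sub>0 w) \<le> g w * norm (?x - x\<^sub>0)"
      proof (rule differentiable_bound[OF S(2)])
        show "((\<lambda>x. f x w) has_derivative f' x w) (at x within S)" if "x \<in> S" for x
          using der[OF that w] has_derivative_at_withinI by blast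
        show "onorm (f' x w) \<le> g w" if "x \<in> S" for x
          using bound[OF that w] g w by (intro onorm_bound) simp_all
      qed (use x S in simp_all)
      moreover have "norm (f' x\<^sub>0 w (?x - x\<^sub>0)) \<le> g w * norm (?x - x\<^sub>0)"
        using bound[OF S(3) w] .
      ultimately have "norm (f ?x w - f x\<^sub>0 w - f' x\<^sub>0 w (?x - x\<^sub>0)) \<le> 2 * g w * norm (?x - x\<^sub>0)"
        using norm_triangle_ineq4[of "f ?x w - f x\<^sub>0 w" "f' x\<^sub>0 w (?x - x\<^sub>0)"] by linarith
      then show "norm (q ?x w) \<le> 2 * g w"
        using x by (simp add: q_def divide_simps)
    qed
  qed simp
  show ?thesis unfolding has_derivative_iff_norm
  proof (intro conjI bl)
    have "((\<lambda>y. norm ((\<integral>w. f y w \<partial>M) - (\<integral>w. f x\<^sub>0 w \<partial>M) - (\<integral>w. f' x\<^sub>0 w (y - x\<^sub>0) \<partial>M)) / norm (y - x\<^sub>0))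
        \<longlongrightarrow> 0) (at x\<^sub>0 within S)"
      unfolding tendsto_at_iff_sequentially o_def
    proof (intro allI impI)
      fix X :: "nat \<Rightarrow> 'a" assume X: "\<forall>i. X i \<in> S - {x\<^sub>0}" "X \<longlonglongrightarrow> x\<^sub>0"
      show "(\<lambda>i. norm ((\<integral>w. f (X i) w \<partial>M) - (\<integral>w. f x\<^sub>0 w \<partial>M) - (\<integral>w. f' x\<^sub>0 w (X i - x\<^sub>0) \<partial>M))
          / norm (X i - x\<^sub>0)) \<longlonglongrightarrow> 0"
      proof (rule Lim_null_comparison[OF always_eventually[OF allI]])
        show "(\<lambda>i. \<integral>w. q (X i) w \<partial>M) \<longlonglongrightarrow> 0" using q_int X by simp
        fix i
        have i: "integrable M (f (X i))" "integrable M (f x\<^sub>0)" using int X(1) S(3) by auto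
        have "norm ((\<integral>w. f (X i) w \<partial>M) - (\<integral>w. f x\<^sub>0 w \<partial>M) - (\<integral>w. f' x\<^sub>0 w (X i - x\<^sub>0) \<partial>M))
            = norm (\<integral>w. f (X i) w - f x\<^sub>0 w - f' x\<^sub>0 w (X i - x\<^sub>0) \<partial>M)"
          using i int' by simp
        also have "\<dots> \<le> (\<integral>w. norm (f (X i) w - f x\<^sub>0 w - f' x\<^sub>0 w (X i - x\<^sub>0)) \<partial>M)"
          by (rule integral_norm_bound)
        finally have "norm ((\<integral>w. f (X i) w \<partial>M) - (\<integral>w. f x\<^sub>0 w \<partial>M) - (\<integral>w. f' x\<^sub>0 w (X i - x\<^sub>0) \<partial>M))
            / norm (X i - x\<^sub>0) \<le> (\<integral>w. norm (f (X i) w - f x\<^sub>0 w - f' x\<^sub>0 w (X i - x\<^sub>0)) \<partial>M) / norm (X i - x\<^sub>0)"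
          by (rule divide_right_mono) simp
        also have "\<dots> = (\<integral>w. q (X i) w \<partial>M)"
          by (simp add: q_def)
        finally show "norm (norm ((\<integral>w. f (X i) w \<partial>M) - (\<integral>w. f x\<^sub>0 w \<partial>M) - (\<integral>w. f' x\<^sub>0 w (X i - x\<^sub>0) \<partial>M))
          / norm (X i - x\<^sub>0)) \<le> (\<integral>w. q (X i) w \<partial>M)" by simp
      qed
    qed
    then show "((\<lambda>y. norm ((\<integral>w. f y w \<partial>M) - (\<integral>w. f x\<^sub>0 w \<partial>M) - (\<integral>w. f' x\<^sub>0 w (y - x\<^sub>0) \<partial>M)) / norm (y - x\<^sub>0))
        \<longlongrightarrow> 0) (at x\<^sub>0)"
      unfolding at_S .
  qed
qed

lemma has_field_derivative_integral:
  fixes f f' :: "complex \<Rightarrow> 'b \<Rightarrow> complex"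
  assumes S: "open S" "convex S" "x\<^sub>0 \<in> S"
    and int: "\<And>x. x \<in> S \<Longrightarrow> integrable M (f x)"
    and der: "\<And>x w. x \<in> S \<Longrightarrow> ((\<lambda>x. f x w) has_field_derivative f' x w) (at x)"
    and bound: "\<And>x w. x \<in> S \<Longrightarrow> norm (f' x w) \<le> g w"
    and g: "integrable M g"
    and meas: "(\<lambda>w. f' x\<^sub>0 w) \<in> borel_measurable M"
  shows "((\<lambda>x. \<integral>w. f x w \<partial>M) has_field_derivative (\<integral>w. f' x\<^sub>0 w \<partial>M)) (at x\<^sub>0)"
proof -
  have "0 \<le> g w" for w using bound[OF S(3), of w] norm_ge_zero order_trans by blast
  then have "((\<lambda>x. \<integral>w. f x w \<partial>M) has_derivative (\<lambda>h. \<integral>w. f' x\<^sub>0 w * h \<partial>M)) (at x\<^sub>0)"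
    using meas bound der
    by (intro has_derivative_integral[OF S int _ _ g, where f' = "\<lambda>x w h. f' x w * h"])
       (simp_all add: norm_mult has_field_derivative_def mult_right_mono)
  then show ?thesis by (simp add: has_field_derivative_def)
qed

lemma has_vector_derivative_integral:
  fixes f f' :: "real \<Rightarrow> 'b \<Rightarrow> 'c::{banach, second_countable_topology}"
  assumes S: "open S" "convex S" "x\<^sub>0 \<in> S"
    and int: "\<And>x. x \<in> S \<Longrightarrow> integrable M (f x)"
    and der: "\<And>x w. x \<in> S \<Longrightarrow> ((\<lambda>x. f x w) has_vector_derivative f' x w) (at x)"
    and bound: "\<And>x w. x \<in> S \<Longrightarrow> norm (f' x w) \<le> g w"
    and g: "integrable M g"
    and meas: "(\<lambda>w. f' x\<^sub>0 w) \<in> borel_measurable M"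
  shows "((\<lambda>x. \<integral>w. f x w \<partial>M) has_vector_derivative (\<integral>w. f' x\<^sub>0 w \<partial>M)) (at x\<^sub>0)"
proof -
  have "0 \<le> g w" for w using bound[OF S(3), of w] norm_ge_zero order_trans by blast
  then have "((\<lambda>x. \<integral>w. f x w \<partial>M) has_derivative (\<lambda>h. \<integral>w. h *\<^sub>R f' x\<^sub>0 w \<partial>M)) (at x\<^sub>0)"
    using meas bound der
    by (intro has_derivative_integral[OF S int _ _ g, where f' = "\<lambda>x w h. h *\<^sub>R f' x w"])
       (simp_all add: has_vector_derivative_def mult.commute mult_left_mono)
  then show ?thesis by (simp add: has_vector_derivative_def)
qed

lemma integral_translate:
  fixes f :: "'a::euclidean_space \<Rightarrow> 'b::{banach, second_countable_topology}"
  assumes [measurable]: "f \<in> borel_measurable borel"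
  shows "(\<integral>x. f (x + c) \<partial>lborel) = (\<integral>x. f x \<partial>lborel)"
  by (subst (2) lborel_distr_plus[of c, symmetric]) (simp add: integral_distr add.commute)

lemma integrable_translate:
  fixes f :: "'a::euclidean_space \<Rightarrow> 'b::{banach, second_countable_topology}"
  assumes "integrable lborel f"
  shows "integrable lborel (\<lambda>x. f (x + c))"
proof -
  have [measurable]: "f \<in> borel_measurable borel" using assms by auto
  have "integrable (distr lborel borel ((+) c)) f" using assms by (simp add: lborel_distr_plus)
  then show ?thesis by (simp add: integrable_distr_eq add.commute)
qed

text \<open>
  Integration by parts without boundary terms: by translation invariance the integral of
  \<open>F (z + s v)\<close> does not depend on \<open>s\<close>.
\<close>

lemma integral_directional_derivative_eq_0:
  fixes F F' :: "complex \<Rightarrow> complex"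
  assumes int: "integrable lborel F"
    and der: "\<And>z. ((\<lambda>s. F (z + of_real s * v)) has_vector_derivative F' z) (at 0)"
    and bound: "\<And>z s. \<bar>s\<bar> < 1 \<Longrightarrow> norm (F' (z + of_real s * v)) \<le> g z"
    and g: "integrable lborel g"
    and meas[measurable]: "F' \<in> borel_measurable borel"
  shows "(\<integral>z. F' z \<partial>lborel) = 0"
proof -
  have der': "((\<lambda>s. F (z + of_real s * v)) has_vector_derivative F' (z + of_real s * v)) (at s)" for z s
  proof -
    have "((\<lambda>r. F ((z + of_real s * v) + of_real (r - s) * v)) has_vector_derivative
        (1::real) *\<^sub>R F' (z + of_real s * v)) (at s)"
      using der[of "z + of_real s * v"]
      by (intro vector_diff_chain_at[of "\<lambda>r. r - s" 1 s, unfolded o_def])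
         (auto intro!: derivative_eq_intros)
    moreover have "(z + of_real s * v) + of_real (r - s) * v = z + of_real r * v" for r
      by (simp add: algebra_simps)
    ultimately show ?thesis by (simp only: scaleR_one)
  qed
  have "((\<lambda>s. \<integral>z. F (z + of_real s * v) \<partial>lborel) has_vector_derivative
      (\<integral>z. F' (z + of_real 0 * v) \<partial>lborel)) (at 0)"
    by (rule has_vector_derivative_integral[where S = "{-1<..<1}" and g = g])
       (auto intro!: integrable_translate int der' bound g)
  moreover have "(\<integral>z. F (z + of_real s * v) \<partial>lborel) = (\<integral>z. F z \<partial>lborel)" for s
    using int by (intro integral_translate) auto
  ultimately have "((\<lambda>s::real. \<integral>z. F z \<partial>lborel) has_vector_derivative (\<integral>z. F' z \<partial>lborel)) (at 0)"
    by simp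
  moreover have "((\<lambda>s::real. \<integral>z. F z \<partial>lborel) has_vector_derivative 0) (at 0)"
    by (rule has_vector_derivative_const)
  ultimately show ?thesis by (rule vector_derivative_unique_at)
qed

section \<open>Entire functions of Gaussian growth\<close>

text \<open>
  Functions bounded by \<open>C exp (c |z|\<^sup>2 + B |z|)\<close> for some \<open>C\<close> and \<open>B\<close>. The linear term makes the class
  closed under multiplication by \<open>z\<close> and, for entire functions and \<open>c \<ge> 0\<close>, under
  differentiation, with the same \<open>c\<close>.
\<close>

definition growth :: "real \<Rightarrow> (complex \<Rightarrow> complex) \<Rightarrow> bool" where
  "growth c p \<longleftrightarrow> (\<exists>C B. \<forall>z. cmod (p z) \<le> C * exp (c * (cmod z)\<^sup>2 + B * cmod z))"

lemma growthI: "(\<And>z. cmod (p z) \<le> C * exp (c * (cmod z)\<^sup>2 + B * cmod z)) \<Longrightarrow> growth c p"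
  unfolding growth_def by blast

lemma growthD:
  assumes "growth c p"
  shows "\<exists>C\<ge>0. \<exists>B\<ge>0. \<forall>z. cmod (p z) \<le> C * exp (c * (cmod z)\<^sup>2 + B * cmod z)"
proof -
  from assms obtain C B where *: "\<And>z. cmod (p z) \<le> C * exp (c * (cmod z)\<^sup>2 + B * cmod z)"
    unfolding growth_def by blast
  have "cmod (p z) \<le> \<bar>C\<bar> * exp (c * (cmod z)\<^sup>2 + \<bar>B\<bar> * cmod z)" for z
    by (rule order_trans[OF *]) (intro mult_mono, auto intro: mult_right_mono)
  then show ?thesis by (intro exI[of _ "\<bar>C\<bar>"] exI[of _ "\<bar>B\<bar>"] conjI) auto
qed

lemma growth_mult_ident:
  assumes "growth c p"
  shows "growth c (\<lambda>z. z * p z)"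
proof -
  obtain C B where C: "C \<ge> 0" "B \<ge> 0" "\<And>z. cmod (p z) \<le> C * exp (c * (cmod z)\<^sup>2 + B * cmod z)"
    using growthD[OF assms] by blast
  have "cmod (z * p z) \<le> C * exp (c * (cmod z)\<^sup>2 + (B + 1) * cmod z)" for z
  proof -
    have "cmod (z * p z) \<le> exp (cmod z) * (C * exp (c * (cmod z)\<^sup>2 + B * cmod z))"
      unfolding norm_mult using less_imp_le[OF exp_gt_self[of "cmod z"]]
      by (intro mult_mono C) (simp_all del: exp_ge_add_one_self)
    then show ?thesis by (simp add: exp_add algebra_simps)
  qed
  then show ?thesis by (rule growthI)
qed

text \<open>
  Cauchy's estimate on circles of radius \<open>1\<close>.
\<close>

lemma norm_deriv_le:
  assumes "p holomorphic_on UNIV" "\<And>w. cmod w \<le> cmod z + 1 \<Longrightarrow> cmod (p w) \<le> C"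
  shows "cmod (deriv p z) \<le> C"
proof -
  have "cmod ((deriv ^^ 1) p z) \<le> fact 1 * C / 1 ^ 1"
  proof (rule Cauchy_inequality)
    show "p holomorphic_on ball z 1" using assms(1) holomorphic_on_subset by blast
    show "continuous_on (cball z 1) p"
      using assms(1) holomorphic_on_imp_continuous_on holomorphic_on_subset by blast
    fix x assume "cmod (z - x) = 1"
    then show "cmod (p x) \<le> C"
      using norm_triangle_ineq4[of z "z - x"] by (intro assms(2)) simp
  qed simp
  then show ?thesis by simp
qed

lemma growth_deriv:
  assumes "growth c p" "p holomorphic_on UNIV" "c \<ge> 0"
  shows "growth c (deriv p)"
proof -
  obtain C B where C: "C \<ge> 0" "B \<ge> 0" "\<And>z. cmod (p z) \<le> C * exp (c * (cmod z)\<^sup>2 + B * cmod z)"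
    using growthD[OF assms(1)] by blast
  have "cmod (deriv p z) \<le> C * exp (c + B) * exp (c * (cmod z)\<^sup>2 + (B + 2 * c) * cmod z)" for z
  proof -
    have "cmod (deriv p z) \<le> C * exp (c * (cmod z + 1)\<^sup>2 + B * (cmod z + 1))"
    proof (rule norm_deriv_le[OF assms(2)])
      fix w assume "cmod w \<le> cmod z + 1"
      then have "c * (cmod w)\<^sup>2 + B * cmod w \<le> c * (cmod z + 1)\<^sup>2 + B * (cmod z + 1)"
        using C assms(3) by (intro add_mono mult_left_mono power_mono) auto
      then show "cmod (p w) \<le> C * exp (c * (cmod z + 1)\<^sup>2 + B * (cmod z + 1))"
        using C by (intro order_trans[OF C(3)] mult_left_mono) auto
    qed
    also have "\<dots> = C * exp (c + B) * exp (c * (cmod z)\<^sup>2 + (B + 2 * c) * cmod z)"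
      by (simp add: exp_add[symmetric] algebra_simps power2_eq_square)
    finally show ?thesis .
  qed
  then show ?thesis by (rule growthI)
qed

lemma integrable_growth:
  assumes "growth c p" "growth d q" "c + d < \<beta>" "p \<in> borel_measurable borel" "q \<in> borel_measurable borel"
  shows "integrable lborel (\<lambda>z. p z * cnj (q z) * of_real (exp (- \<beta> * (cmod z)\<^sup>2)))"
proof -
  obtain C B where C: "C \<ge> 0" "\<And>z. cmod (p z) \<le> C * exp (c * (cmod z)\<^sup>2 + B * cmod z)"
    using growthD[OF assms(1)] by blast
  obtain C' B' where C': "C' \<ge> 0" "\<And>z. cmod (q z) \<le> C' * exp (d * (cmod z)\<^sup>2 + B' * cmod z)"
    using growthD[OF assms(2)] by blast
  show ?thesis
  proof (rule Bochner_Integration.integrable_bound)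
    show "integrable lborel (\<lambda>z::complex. C * C' * exp (- (\<beta> - (c + d)) * (cmod z)\<^sup>2 + (B + B') * cmod z))"
      by (intro integrable_mult_right integrable_exp_quadratic) (use assms in simp)
    have [measurable]: "cnj \<in> borel_measurable borel"
      by (intro borel_measurable_continuous_onI continuous_intros)
    show "(\<lambda>z. p z * cnj (q z) * of_real (exp (- \<beta> * (cmod z)\<^sup>2))) \<in> borel_measurable lborel"
      using assms(4,5) by measurable
    show "AE z in lborel. norm (p z * cnj (q z) * of_real (exp (- \<beta> * (cmod z)\<^sup>2)))
      \<le> norm (C * C' * exp (- (\<beta> - (c + d)) * (cmod z)\<^sup>2 + (B + B') * cmod z))"
    proof (rule AE_I2)
      fix z
      have "norm (p z * cnj (q z) * of_real (exp (- \<beta> * (cmod z)\<^sup>2)))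
        \<le> (C * exp (c * (cmod z)\<^sup>2 + B * cmod z)) * (C' * exp (d * (cmod z)\<^sup>2 + B' * cmod z))
          * exp (- \<beta> * (cmod z)\<^sup>2)"
        unfolding norm_mult norm_of_real complex_mod_cnj abs_exp_cancel using C C'
        by (intro mult_mono) auto
      also have "\<dots> = C * C' * exp (- (\<beta> - (c + d)) * (cmod z)\<^sup>2 + (B + B') * cmod z)"
        by (simp add: algebra_simps exp_add[symmetric])
      finally show "norm (p z * cnj (q z) * of_real (exp (- \<beta> * (cmod z)\<^sup>2)))
        \<le> norm (C * C' * exp (- (\<beta> - (c + d)) * (cmod z)\<^sup>2 + (B + B') * cmod z))"
        using C C' by (simp add: abs_mult)
    qed
  qed
qed

text \<open>
  The derivative of \<open>p \<cdot> cnj q \<cdot> exp (- \<beta> |z|\<^sup>2)\<close> in the real direction \<open>v\<close>.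
\<close>

lemma has_vector_derivative_gaussian_product:
  fixes p q :: "complex \<Rightarrow> complex"
  assumes "p holomorphic_on UNIV" "q holomorphic_on UNIV"
  shows "((\<lambda>s. p (z + of_real s * v) * cnj (q (z + of_real s * v)) *
            of_real (exp (- \<beta> * (cmod (z + of_real s * v))\<^sup>2))) has_vector_derivative
          (deriv p z * v * cnj (q z) + p z * cnj (deriv q z * v)
            - of_real \<beta> * (z * cnj v + cnj z * v) * (p z * cnj (q z))) * of_real (exp (- \<beta> * (cmod z)\<^sup>2))) (at 0)"
proof -
  have line: "((\<lambda>s::real. z + of_real s * v) has_vector_derivative v) (at 0)"
    by (auto intro!: derivative_eq_intros)
  have hol: "((\<lambda>s. f (z + of_real s * v)) has_vector_derivative v * deriv f z) (at 0)"
    if "f holomorphic_on UNIV" for f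
    using field_vector_diff_chain_at[OF line, of f "deriv f z"] holomorphic_derivI[OF that, of z]
    by (simp add: o_def)
  have cn: "((\<lambda>s. cnj (f s)) has_vector_derivative cnj f') (at 0)"
    if "(f has_vector_derivative f') (at (0::real))" for f f'
    using that by (rule has_vector_derivative_cnj)
  have sq: "((\<lambda>s. of_real (exp (- \<beta> * (cmod (z + of_real s * v))\<^sup>2))) has_vector_derivative
      (- of_real \<beta> * (z * cnj v + v * cnj z)) * of_real (exp (- \<beta> * (cmod z)\<^sup>2))) (at 0)"
  proof -
    have "((\<lambda>s. - of_real \<beta> * ((z + of_real s * v) * cnj (z + of_real s * v))) has_vector_derivative
      - of_real \<beta> * (z * cnj v + v * cnj z)) (at 0)"
      using has_vector_derivative_mult_right[OF has_vector_derivative_mult[OF line cn[OF line]], of "- of_real \<beta>"]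
      by simp
    moreover have "(exp has_field_derivative exp (- of_real \<beta> * (z * cnj z)))
        (at (- of_real \<beta> * ((z + of_real 0 * v) * cnj (z + of_real 0 * v))))"
      by simp
    ultimately have "((\<lambda>s. exp (- of_real \<beta> * ((z + of_real s * v) * cnj (z + of_real s * v)))) has_vector_derivative
      (- of_real \<beta> * (z * cnj v + v * cnj z)) * exp (- of_real \<beta> * (z * cnj z))) (at 0)"
      by (rule field_vector_diff_chain_at[unfolded o_def])
    moreover have "exp (- of_real \<beta> * (u * cnj u)) = of_real (exp (- \<beta> * (cmod u)\<^sup>2))" for u
    proof -
      have "- of_real \<beta> * (u * cnj u) = of_real (- \<beta> * (cmod u)\<^sup>2)"
        by (simp add: complex_norm_square del: of_real_power)
      then show ?thesis by (simp only: exp_of_real)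
    qed
    ultimately show ?thesis by (simp only:)
  qed
  define P where "P = (\<lambda>s::real. p (z + of_real s * v))"
  define Q where "Q = (\<lambda>s::real. cnj (q (z + of_real s * v)))"
  define G where "G = (\<lambda>s::real. complex_of_real (exp (- \<beta> * (cmod (z + of_real s * v))\<^sup>2)))"
  have at_0: "P 0 = p z" "Q 0 = cnj (q z)" "G 0 = of_real (exp (- \<beta> * (cmod z)\<^sup>2))"
    by (simp_all add: P_def Q_def G_def)
  have dP: "(P has_vector_derivative v * deriv p z) (at 0)"
    unfolding P_def by (rule hol[OF assms(1)])
  have dQ: "(Q has_vector_derivative cnj (v * deriv q z)) (at 0)"
    unfolding Q_def by (rule cn[OF hol[OF assms(2)]])
  have dG: "(G has_vector_derivative (- of_real \<beta> * (z * cnj v + v * cnj z)) * G 0) (at 0)"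
    unfolding at_0(3) unfolding G_def by (rule sq)
  note D = has_vector_derivative_mult[OF has_vector_derivative_mult[OF dP dQ] dG]
  have ring: "a * b * (- B * (z * v' + v * z') * g) + (a * (v' * q') + v * p' * b) * g
    = (p' * v * b + a * (q' * v') - B * (z * v' + z' * v) * (a * b)) * g"
    for a b B v' z' g p' q' :: complex
    by (simp add: algebra_simps)
  have "P 0 * Q 0 * (- of_real \<beta> * (z * cnj v + v * cnj z) * G 0)
      + (P 0 * cnj (v * deriv q z) + v * deriv p z * Q 0) * G 0
    = (deriv p z * v * Q 0 + P 0 * cnj (deriv q z * v)
        - of_real \<beta> * (z * cnj v + cnj z * v) * (P 0 * Q 0)) * G 0"
    unfolding complex_cnj_mult by (rule ring)
  with D have "((\<lambda>s. P s * Q s * G s) has_vector_derivative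
     (deriv p z * v * Q 0 + P 0 * cnj (deriv q z * v)
        - of_real \<beta> * (z * cnj v + cnj z * v) * (P 0 * Q 0)) * G 0) (at 0)"
    by (simp only:)
  then show ?thesis unfolding at_0 unfolding P_def Q_def G_def .
qed

lemma growth_norm_add:
  assumes "growth c p" "growth c q"
  shows "growth c (\<lambda>z. of_real (cmod (p z) + cmod (q z)))"
proof -
  obtain C B where C: "C \<ge> 0" "B \<ge> 0" "\<And>z. cmod (p z) \<le> C * exp (c * (cmod z)\<^sup>2 + B * cmod z)"
    using growthD[OF assms(1)] by blast
  obtain C' B' where C': "C' \<ge> 0" "B' \<ge> 0" "\<And>z. cmod (q z) \<le> C' * exp (c * (cmod z)\<^sup>2 + B' * cmod z)"
    using growthD[OF assms(2)] by blast
  have "cmod (of_real (cmod (p z) + cmod (q z))) \<le> (C + C') * exp (c * (cmod z)\<^sup>2 + (B + B') * cmod z)" for z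
  proof -
    have "cmod (p z) \<le> C * exp (c * (cmod z)\<^sup>2 + (B + B') * cmod z)"
      using C C' by (intro order_trans[OF C(3)] mult_left_mono) (auto simp: algebra_simps)
    moreover have "cmod (q z) \<le> C' * exp (c * (cmod z)\<^sup>2 + (B + B') * cmod z)"
      using C C' by (intro order_trans[OF C'(3)] mult_left_mono) (auto simp: algebra_simps)
    ultimately show ?thesis by (simp add: algebra_simps del: of_real_add)
  qed
  then show ?thesis by (rule growthI)
qed

text \<open>
  With respect to the weight \<open>exp (- \<beta> |z|\<^sup>2)\<close>, differentiation is adjoint to multiplication by
  \<open>\<beta> z\<close>. The integrals of the derivatives of \<open>p \<cdot> cnj q \<cdot> exp (- \<beta> |z|\<^sup>2)\<close> in the directions \<open>1\<close>
  and \<open>\<i>\<close> vanish, and their combination with coefficients \<open>1\<close> and \<open>- \<i>\<close> is twice the derivative in \<open>z\<close>, in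
  which \<open>cnj q\<close> is constant.
\<close>

lemma gaussian_adjoint:
  fixes p q :: "complex \<Rightarrow> complex" and c \<beta> :: real
  assumes hol: "p holomorphic_on UNIV" "q holomorphic_on UNIV"
    and gr: "growth c p" "growth c q" and c: "0 \<le> c" "2 * c < \<beta>"
  shows "(\<integral>z. deriv p z * cnj (q z) * of_real (exp (- \<beta> * (cmod z)\<^sup>2)) \<partial>lborel)
       = of_real \<beta> * (\<integral>z. p z * cnj (z * q z) * of_real (exp (- \<beta> * (cmod z)\<^sup>2)) \<partial>lborel)"
proof -
  define E where "E = (\<lambda>z. complex_of_real (exp (- \<beta> * (cmod z)\<^sup>2)))"
  define F where "F = (\<lambda>z. p z * cnj (q z) * E z)"
  define D where "D = (\<lambda>v z. (deriv p z * v * cnj (q z) + p z * cnj (deriv q z * v)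
            - of_real \<beta> * (z * cnj v + cnj z * v) * (p z * cnj (q z))) * E z)"
  have cont: "continuous_on UNIV p" "continuous_on UNIV q"
    "continuous_on UNIV (deriv p)" "continuous_on UNIV (deriv q)"
    using hol by (auto intro!: holomorphic_on_imp_continuous_on holomorphic_deriv)
  have meas: "p \<in> borel_measurable borel" "q \<in> borel_measurable borel"
    "deriv p \<in> borel_measurable borel" "deriv q \<in> borel_measurable borel"
    using cont by (auto intro: borel_measurable_continuous_onI)
  obtain C B where C: "C \<ge> 0" "B \<ge> 0" and bnd: "\<And>z. cmod (p z) + cmod (deriv p z) + (cmod (q z) + cmod (deriv q z))
      \<le> C * exp (c * (cmod z)\<^sup>2 + B * cmod z)"
    using growthD[OF growth_norm_add[OF growth_norm_add[OF gr(1) growth_deriv[OF gr(1) hol(1) c(1)]]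
        growth_norm_add[OF gr(2) growth_deriv[OF gr(2) hol(2) c(1)]]]]
    by (auto simp: norm_of_real simp del: of_real_add)
  define \<delta> where "\<delta> = \<beta> - 2 * c"
  have \<delta>: "\<delta> > 0" "\<beta> > 0" using c by (auto simp: \<delta>_def)
  have D_bound: "cmod (D v z) \<le> 2 * C\<^sup>2 * (1 + \<beta>) * exp (- \<delta> * (cmod z)\<^sup>2 + (2 * B + 1) * cmod z)"
    if v: "cmod v = 1" for v z
  proof -
    define X where "X = C * exp (c * (cmod z)\<^sup>2 + B * cmod z)"
    have X: "cmod (p z) \<le> X" "cmod (deriv p z) \<le> X" "cmod (q z) \<le> X" "cmod (deriv q z) \<le> X" "X \<ge> 0"
      using bnd[of z] norm_ge_zero[of "p z"] norm_ge_zero[of "deriv p z"] norm_ge_zero[of "q z"]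
        norm_ge_zero[of "deriv q z"] unfolding X_def by linarith+
    have 1: "cmod (deriv p z * v * cnj (q z)) \<le> X\<^sup>2" "cmod (p z * cnj (deriv q z * v)) \<le> X\<^sup>2"
      "cmod (p z * cnj (q z)) \<le> X\<^sup>2"
      using X v by (auto simp: norm_mult power2_eq_square intro!: mult_mono)
    have 2: "cmod (z * cnj v + cnj z * v) \<le> 2 * cmod z"
      using norm_triangle_ineq[of "z * cnj v" "cnj z * v"] v by (simp add: norm_mult)
    have "cmod (of_real \<beta> * (z * cnj v + cnj z * v) * (p z * cnj (q z))) \<le> \<beta> * (2 * cmod z) * X\<^sup>2"
      unfolding norm_mult[of "of_real \<beta> * (z * cnj v + cnj z * v)"] norm_mult[of "of_real \<beta>"]
      using 1 2 \<delta> by (intro mult_mono) auto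
    then have "cmod (deriv p z * v * cnj (q z) + p z * cnj (deriv q z * v)
            - of_real \<beta> * (z * cnj v + cnj z * v) * (p z * cnj (q z))) \<le> X\<^sup>2 + X\<^sup>2 + \<beta> * (2 * cmod z) * X\<^sup>2"
      using 1 norm_triangle_ineq4[of "deriv p z * v * cnj (q z) + p z * cnj (deriv q z * v)"
          "of_real \<beta> * (z * cnj v + cnj z * v) * (p z * cnj (q z))"]
        norm_triangle_ineq[of "deriv p z * v * cnj (q z)" "p z * cnj (deriv q z * v)"] by linarith
    also have "\<dots> = 2 * X\<^sup>2 * (1 + \<beta> * cmod z)" by (simp add: algebra_simps)
    also have "\<dots> \<le> 2 * X\<^sup>2 * ((1 + \<beta>) * exp (cmod z))"
    proof (intro mult_left_mono)
      have "1 + \<beta> * cmod z \<le> exp (cmod z) + \<beta> * exp (cmod z)"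
        using \<delta> less_imp_le[OF exp_gt_self[of "cmod z"]] by (intro add_mono mult_left_mono) simp_all
      then show "1 + \<beta> * cmod z \<le> (1 + \<beta>) * exp (cmod z)" by (simp add: algebra_simps)
    qed simp
    finally have "cmod (D v z) \<le> 2 * X\<^sup>2 * ((1 + \<beta>) * exp (cmod z)) * exp (- \<beta> * (cmod z)\<^sup>2)"
      unfolding D_def E_def norm_mult norm_of_real abs_exp_cancel by (rule mult_right_mono) simp
    also have "\<dots> = 2 * C\<^sup>2 * (1 + \<beta>) * exp (- \<delta> * (cmod z)\<^sup>2 + (2 * B + 1) * cmod z)"
      by (simp add: X_def \<delta>_def power2_eq_square exp_add[symmetric] algebra_simps)
    finally show ?thesis .
  qed
  have D_meas: "D v \<in> borel_measurable borel" for v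
    unfolding D_def E_def using cont by (intro borel_measurable_continuous_onI continuous_intros)
  have D_int: "integrable lborel (D v)" if v: "cmod v = 1" for v
  proof (rule Bochner_Integration.integrable_bound)
    show "integrable lborel (\<lambda>z::complex. 2 * C\<^sup>2 * (1 + \<beta>) * exp (- \<delta> * (cmod z)\<^sup>2 + (2 * B + 1) * cmod z))"
      by (intro integrable_mult_right integrable_exp_quadratic \<delta>)
    show "AE z in lborel. norm (D v z)
        \<le> norm (2 * C\<^sup>2 * (1 + \<beta>) * exp (- \<delta> * (cmod z)\<^sup>2 + (2 * B + 1) * cmod z))"
      using D_bound[OF v] \<delta> by (simp add: abs_mult)
  qed (use D_meas in simp)
  have D0: "(\<integral>z. D v z \<partial>lborel) = 0" if v: "cmod v = 1" for v
  proof (rule integral_directional_derivative_eq_0)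
    show "integrable lborel F"
      unfolding F_def E_def using c by (intro integrable_growth[OF gr] meas) simp
    show "((\<lambda>s. F (z + of_real s * v)) has_vector_derivative D v z) (at 0)" for z
      unfolding F_def E_def D_def by (rule has_vector_derivative_gaussian_product[OF hol])
    show "norm (D v (z + of_real s * v)) \<le> 2 * C\<^sup>2 * (1 + \<beta>) * exp (2 * B + 1) *
        exp (- \<delta> * (cmod z)\<^sup>2 + (2 * \<delta> + 2 * B + 1) * cmod z)" if s: "\<bar>s\<bar> < 1" for z s
    proof -
      let ?\<zeta> = "z + of_real s * v"
      have "cmod (of_real s * v) \<le> 1" using s v by (simp add: norm_mult)
      then have 1: "cmod ?\<zeta> \<le> cmod z + 1" "cmod z \<le> cmod ?\<zeta> + 1"
        using norm_triangle_ineq[of z "of_real s * v"] norm_triangle_ineq4[of ?\<zeta> "of_real s * v"] by simp_all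
      have 2: "(cmod z)\<^sup>2 - 2 * cmod z \<le> (cmod ?\<zeta>)\<^sup>2"
      proof (cases "cmod z \<ge> 1")
        case True
        then have "(cmod z - 1)\<^sup>2 \<le> (cmod ?\<zeta>)\<^sup>2" using 1 by (intro power_mono) auto
        then show ?thesis by (simp add: power2_eq_square algebra_simps)
      next
        case False
        then have "cmod z * cmod z \<le> 2 * cmod z" by (intro mult_right_mono) auto
        then show ?thesis using zero_le_power2[of "cmod ?\<zeta>"] unfolding power2_eq_square by linarith
      qed
      have "norm (D v ?\<zeta>) \<le> 2 * C\<^sup>2 * (1 + \<beta>) * exp (- \<delta> * (cmod ?\<zeta>)\<^sup>2 + (2 * B + 1) * cmod ?\<zeta>)"
        by (rule D_bound[OF v])
      also have "\<dots> \<le> 2 * C\<^sup>2 * (1 + \<beta>) * exp (- \<delta> * ((cmod z)\<^sup>2 - 2 * cmod z) + (2 * B + 1) * (cmod z + 1))"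
      proof (intro mult_left_mono)
        have "\<delta> * ((cmod z)\<^sup>2 - 2 * cmod z) \<le> \<delta> * (cmod ?\<zeta>)\<^sup>2"
          using 2 \<delta> by (intro mult_left_mono) auto
        moreover have "(2 * B + 1) * cmod ?\<zeta> \<le> (2 * B + 1) * (cmod z + 1)"
          using 1 C by (intro mult_left_mono) auto
        ultimately show "exp (- \<delta> * (cmod ?\<zeta>)\<^sup>2 + (2 * B + 1) * cmod ?\<zeta>)
            \<le> exp (- \<delta> * ((cmod z)\<^sup>2 - 2 * cmod z) + (2 * B + 1) * (cmod z + 1))" by simp
      qed (use \<delta> in simp)
      also have "\<dots> = 2 * C\<^sup>2 * (1 + \<beta>) * exp (2 * B + 1) *
          exp (- \<delta> * (cmod z)\<^sup>2 + (2 * \<delta> + 2 * B + 1) * cmod z)"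
        by (simp add: exp_add[symmetric] algebra_simps)
      finally show ?thesis .
    qed
    show "integrable lborel (\<lambda>z::complex. 2 * C\<^sup>2 * (1 + \<beta>) * exp (2 * B + 1) *
        exp (- \<delta> * (cmod z)\<^sup>2 + (2 * \<delta> + 2 * B + 1) * cmod z))"
      by (intro integrable_mult_right integrable_exp_quadratic \<delta>)
  qed (rule D_meas)
  define A where "A = (\<lambda>z. deriv p z * cnj (q z) * E z)"
  define Z where "Z = (\<lambda>z. p z * cnj (z * q z) * E z)"
  have A: "integrable lborel A"
    unfolding A_def E_def using c
    by (intro integrable_growth[OF growth_deriv[OF gr(1) hol(1) c(1)] gr(2)] meas) simp
  have Z: "integrable lborel Z"
    unfolding Z_def E_def using c meas
    by (intro integrable_growth[OF gr(1) growth_mult_ident[OF gr(2)]]) auto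
  \<comment> \<open>The derivatives of \<open>q\<close> cancel here.\<close>
  have "D 1 z - \<i> * D \<i> z = 2 * A z - 2 * of_real \<beta> * Z z" for z
    unfolding D_def A_def Z_def by (simp add: algebra_simps)
  then have "(\<integral>z. D 1 z - \<i> * D \<i> z \<partial>lborel) = (\<integral>z. 2 * A z - 2 * of_real \<beta> * Z z \<partial>lborel)"
    by simp
  moreover have "(\<integral>z. D 1 z - \<i> * D \<i> z \<partial>lborel) = 0"
    using D_int[of 1] D_int[of \<i>] D0[of 1] D0[of \<i>] by simp
  moreover have "(\<integral>z. 2 * A z - 2 * of_real \<beta> * Z z \<partial>lborel)
      = 2 * (\<integral>z. A z \<partial>lborel) - 2 * of_real \<beta> * (\<integral>z. Z z \<partial>lborel)"
    using A Z by simp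
  ultimately show ?thesis
    unfolding A_def Z_def E_def by simp
qed

section \<open>The mean value property and the Fock space\<close>

lemma integral_rotate:
  fixes f :: "complex \<Rightarrow> 'b::{banach, second_countable_topology}"
  assumes [measurable]: "f \<in> borel_measurable borel" and "cmod v = 1"
  shows "(\<integral>z. f (v * z) \<partial>lborel) = (\<integral>z. f z \<partial>lborel)"
  by (subst (2) distr_lborel_rotate[OF assms(2), symmetric]) (simp add: integral_distr)

lemma integrable_rotate:
  fixes f :: "complex \<Rightarrow> 'b::{banach, second_countable_topology}"
  assumes "integrable lborel f" "cmod v = 1"
  shows "integrable lborel (\<lambda>z. f (v * z))"
proof -
  have [measurable]: "f \<in> borel_measurable borel" using assms(1) by auto
  have "integrable (distr lborel borel (\<lambda>z. v * z)) f" using assms by (simp add: distr_lborel_rotate)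
  then show ?thesis by (simp add: integrable_distr_eq)
qed

lemma circle_mean:
  assumes "h holomorphic_on UNIV"
  shows "((\<lambda>x. h (exp (2 * of_real pi * \<i> * of_real x) * z)) has_integral h 0) {0..1::real}"
proof -
  have "(\<lambda>w. h (w * z)) holomorphic_on UNIV"
    by (rule holomorphic_on_compose_gen[OF _ assms, unfolded o_def]) (auto intro!: holomorphic_intros)
  then have "(\<lambda>w. h (w * z)) holomorphic_on cball 0 1"
    using holomorphic_on_subset by blast
  from Cauchy_integral_circlepath_simple[OF this, of 0]
  have "((\<lambda>w. h (w * z) / w) has_contour_integral 2 * of_real pi * \<i> * h 0) (circlepath 0 1)"
    by simp
  then have "((\<lambda>x. h (circlepath 0 1 x * z) / circlepath 0 1 x
       * vector_derivative (circlepath 0 1) (at x within {0..1})) has_integral 2 * of_real pi * \<i> * h 0) {0..1}"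
    unfolding has_contour_integral_def .
  then have "((\<lambda>x. 2 * of_real pi * \<i> * h (exp (2 * of_real pi * \<i> * of_real x) * z)) has_integral
      2 * of_real pi * \<i> * h 0) {0..1}"
    by (rule has_integral_eq[rotated])
       (use vector_derivative_circlepath01[of _ 0 1] in \<open>simp add: circlepath\<close>)
  from has_integral_mult_right[OF this, of "inverse (2 * of_real pi * \<i>)"]
  show ?thesis by (simp add: field_simps)
qed

text \<open>
  The weight is rotation invariant, so the integral does not change when \<open>h\<close> is replaced by its
  average over all rotations about \<open>0\<close>, which is the constant \<open>h 0\<close>.
\<close>

lemma gaussian_mean_value:
  assumes hol: "h holomorphic_on UNIV" and \<alpha>: "\<alpha> > 0"
    and int: "integrable lborel (\<lambda>z. h z * of_real (exp (- \<alpha> * (cmod z)\<^sup>2)))"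
  shows "(\<integral>z. h z * of_real (exp (- \<alpha> * (cmod z)\<^sup>2)) \<partial>lborel) = of_real (pi / \<alpha>) * h 0"
proof -
  define E where "E = (\<lambda>z::complex. exp (- \<alpha> * (cmod z)\<^sup>2))"
  define e where "e = (\<lambda>x::real. exp (2 * of_real pi * \<i> * of_real x))"
  define f where "f = (\<lambda>(x::real) z. indicator {0..1} x *\<^sub>R (h (e x * z) * of_real (E z)))"
  have e: "cmod (e x) = 1" for x by (simp add: e_def norm_exp_eq_Re)
  have E_rot: "E (e x * z) = E z" for x z by (simp add: E_def norm_mult e)
  have E_int: "(\<integral>z. E z \<partial>lborel) = pi / \<alpha>"
    using nn_integral_gaussian_norm[OF \<alpha>] \<alpha> unfolding E_def
    by (intro integral_eq_nn_integral[THEN trans]) auto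
  have int: "integrable lborel (\<lambda>z. h z * of_real (E z))" using int unfolding E_def .
  have cont: "continuous_on UNIV h" using hol by (rule holomorphic_on_imp_continuous_on)
  have [measurable]: "h \<in> borel_measurable borel" "e \<in> borel_measurable borel" "E \<in> borel_measurable borel"
    unfolding e_def E_def using cont
    by (auto intro!: borel_measurable_continuous_onI continuous_intros)
  have rot: "(\<integral>z. h (e x * z) * of_real (E z) \<partial>lborel) = (\<integral>z. h z * of_real (E z) \<partial>lborel)" for x
    using integral_rotate[of "\<lambda>z. h z * of_real (E z)" "e x"] by (simp add: e E_rot)
  have rot_norm: "(\<integral>z. norm (h (e x * z) * of_real (E z)) \<partial>lborel) = (\<integral>z. norm (h z * of_real (E z)) \<partial>lborel)" for x
    using integral_rotate[of "\<lambda>z. norm (h z * of_real (E z))" "e x"] by (simp add: e E_rot)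
  have rot_int: "integrable lborel (\<lambda>z. h (e x * z) * of_real (E z))" for x
    using integrable_rotate[OF int e, of x] by (simp add: E_rot)
  have "integrable (lborel \<Otimes>\<^sub>M lborel) (case_prod f)"
  proof (rule lborel_pair.Fubini_integrable)
    show "case_prod f \<in> borel_measurable (lborel \<Otimes>\<^sub>M lborel)"
      unfolding f_def by measurable
    have "(\<lambda>x. \<integral>z. norm (case_prod f (x, z)) \<partial>lborel)
        = (\<lambda>x. indicator {0..1} x *\<^sub>R (\<integral>z. norm (h z * of_real (E z)) \<partial>lborel))"
      by (simp add: f_def rot_norm)
    then show "integrable lborel (\<lambda>x. \<integral>z. norm (case_prod f (x, z)) \<partial>lborel)"
      by simp
    show "AE x in lborel. integrable lborel (\<lambda>z. case_prod f (x, z))"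
      by (simp add: f_def rot_int)
  qed
  from lborel_pair.Fubini_integral[OF this]
  have "(\<integral>z. (\<integral>x. f x z \<partial>lborel) \<partial>lborel) = (\<integral>x. (\<integral>z. f x z \<partial>lborel) \<partial>lborel)" .
  moreover have "(\<integral>x. (\<integral>z. f x z \<partial>lborel) \<partial>lborel) = (\<integral>z. h z * of_real (E z) \<partial>lborel)"
    by (simp add: f_def rot)
  moreover have "(\<integral>x. f x z \<partial>lborel) = h 0 * of_real (E z)" for z
  proof -
    have "set_integrable lborel {0..1} (\<lambda>x. h (e x * z))"
      unfolding e_def
      by (intro borel_integrable_atLeastAtMost' continuous_on_compose2[OF cont] continuous_intros) auto
    then have "(LINT x:{0..1}|lborel. h (e x * z)) = integral {0..1} (\<lambda>x. h (e x * z))"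
      by (rule set_borel_integral_eq_integral)
    also have "\<dots> = h 0"
      using circle_mean[OF hol, of z] unfolding e_def by (rule integral_unique)
    finally have "(\<integral>x. indicator {0..1} x *\<^sub>R h (e x * z) \<partial>lborel) = h 0"
      by (simp add: set_lebesgue_integral_def)
    moreover have "(\<integral>x. f x z \<partial>lborel) = (\<integral>x. indicator {0..1} x *\<^sub>R h (e x * z) \<partial>lborel) * of_real (E z)"
      unfolding f_def by (simp flip: mult_scaleR_left)
    ultimately show ?thesis by simp
  qed
  moreover have "(\<integral>z. h 0 * of_real (E z) \<partial>lborel) = h 0 * of_real (\<integral>z. E z \<partial>lborel)"
    by simp
  ultimately show ?thesis using E_int by (simp add: E_def mult.commute)
qed

lemma sets_gaussian_measure [measurable_cong]: "sets (gaussian_measure \<alpha>) = sets borel"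
  by (simp add: gaussian_measure_def)

lemma space_gaussian_measure [simp]: "space (gaussian_measure \<alpha>) = UNIV"
  by (simp add: gaussian_measure_def)

lemma integrable_gaussian_measure:
  fixes f :: "complex \<Rightarrow> 'b::{banach, second_countable_topology}"
  assumes "\<alpha> > 0" "f \<in> borel_measurable borel"
  shows "integrable (gaussian_measure \<alpha>) f
    \<longleftrightarrow> integrable lborel (\<lambda>z. (\<alpha> / pi * exp (- \<alpha> * (cmod z)\<^sup>2)) *\<^sub>R f z)"
  using assms unfolding gaussian_measure_def by (subst integrable_density) simp_all

lemma integral_gaussian_measure:
  fixes f :: "complex \<Rightarrow> 'b::{banach, second_countable_topology}"
  assumes "\<alpha> > 0" "f \<in> borel_measurable borel"
  shows "(\<integral>z. f z \<partial>gaussian_measure \<alpha>) = (\<integral>z. (\<alpha> / pi * exp (- \<alpha> * (cmod z)\<^sup>2)) *\<^sub>R f z \<partial>lborel)"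
  using assms unfolding gaussian_measure_def by (subst integral_density) simp_all

lemma entire_measurable:
  "f holomorphic_on UNIV \<Longrightarrow> f \<in> borel_measurable borel"
  by (intro borel_measurable_continuous_onI holomorphic_on_imp_continuous_on)

lemma fock_space_iff:
  assumes "\<alpha> > 0"
  shows "f \<in> fock_space \<alpha> \<longleftrightarrow> f holomorphic_on UNIV
    \<and> integrable lborel (\<lambda>z. (cmod (f z))\<^sup>2 * exp (- \<alpha> * (cmod z)\<^sup>2))"
proof -
  have "integrable (gaussian_measure \<alpha>) (\<lambda>z. (cmod (f z))\<^sup>2)
      \<longleftrightarrow> integrable lborel (\<lambda>z. (cmod (f z))\<^sup>2 * exp (- \<alpha> * (cmod z)\<^sup>2))"
    if "f holomorphic_on UNIV"
  proof -
    have [measurable]: "f \<in> borel_measurable borel" using that by (rule entire_measurable)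
    have "integrable (gaussian_measure \<alpha>) (\<lambda>z. (cmod (f z))\<^sup>2)
        \<longleftrightarrow> integrable lborel (\<lambda>z. (\<alpha> / pi) * ((cmod (f z))\<^sup>2 * exp (- \<alpha> * (cmod z)\<^sup>2)))" (is "_ \<longleftrightarrow> ?R")
      using assms by (subst integrable_gaussian_measure) (simp_all add: mult.commute mult.left_commute)
    also have "?R \<longleftrightarrow> integrable lborel (\<lambda>z. (cmod (f z))\<^sup>2 * exp (- \<alpha> * (cmod z)\<^sup>2))"
      using assms by (simp only: integrable_mult_left_iff) simp
    finally show ?thesis .
  qed
  then show ?thesis unfolding fock_space_def by blast
qed

text \<open>
  The majorants used below: for \<open>2 c < \<alpha>\<close> the exponential is square integrable for the Gaussian measure.
\<close>

lemma fock_space_dominated: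
  assumes f: "f \<in> fock_space \<alpha>" and \<alpha>: "\<alpha> > 0" and c: "2 * c < \<alpha>"
  shows "integrable (gaussian_measure \<alpha>) (\<lambda>w. exp (c * (cmod w)\<^sup>2 + B * cmod w) * cmod (f w))"
proof (rule Bochner_Integration.integrable_bound)
  have hol: "f holomorphic_on UNIV" and int: "integrable (gaussian_measure \<alpha>) (\<lambda>z. (cmod (f z))\<^sup>2)"
    using f by (auto simp: fock_space_def)
  have [measurable]: "f \<in> borel_measurable borel" using hol by (rule entire_measurable)
  have "integrable lborel (\<lambda>w::complex. (\<alpha> / pi) * exp (- (\<alpha> - 2 * c) * (cmod w)\<^sup>2 + (2 * B) * cmod w))"
    using c by (intro integrable_mult_right integrable_exp_quadratic) simp
  then have "integrable (gaussian_measure \<alpha>) (\<lambda>w. exp (2 * c * (cmod w)\<^sup>2 + 2 * B * cmod w))"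
    using \<alpha> by (subst integrable_gaussian_measure) (simp_all add: exp_add[symmetric] algebra_simps)
  then show "integrable (gaussian_measure \<alpha>)
      (\<lambda>w. exp (2 * c * (cmod w)\<^sup>2 + 2 * B * cmod w) + (cmod (f w))\<^sup>2)"
    using int by (rule Bochner_Integration.integrable_add)
  have "norm (exp (c * (cmod w)\<^sup>2 + B * cmod w) * cmod (f w))
      \<le> norm (exp (2 * c * (cmod w)\<^sup>2 + 2 * B * cmod w) + (cmod (f w))\<^sup>2)" for w
  proof -
    let ?x = "exp (c * (cmod w)\<^sup>2 + B * cmod w)" and ?y = "cmod (f w)"
    have "0 \<le> (?x - ?y)\<^sup>2" "0 \<le> ?x * ?y" by simp_all
    then have "?x * ?y \<le> ?x\<^sup>2 + ?y\<^sup>2" unfolding power2_diff by linarith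
    also have "?x\<^sup>2 = exp (2 * c * (cmod w)\<^sup>2 + 2 * B * cmod w)"
      by (simp add: power2_eq_square exp_add[symmetric] algebra_simps)
    finally show ?thesis by simp
  qed
  then show "AE w in gaussian_measure \<alpha>. norm (exp (c * (cmod w)\<^sup>2 + B * cmod w) * cmod (f w))
      \<le> norm (exp (2 * c * (cmod w)\<^sup>2 + 2 * B * cmod w) + (cmod (f w))\<^sup>2)" by simp
  show "(\<lambda>w. exp (c * (cmod w)\<^sup>2 + B * cmod w) * cmod (f w)) \<in> borel_measurable (gaussian_measure \<alpha>)"
    by measurable
qed

text \<open>
  The mean value property for the square of \<open>f (w + z) exp (- \<alpha> w cnj z)\<close>; the exponential factor
  turns the weight centred at \<open>0\<close> into the weight centred at \<open>- z\<close>, up to the constant \<open>exp (\<alpha> |z|\<^sup>2)\<close>.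
\<close>

lemma fock_space_pointwise:
  assumes hol: "f holomorphic_on UNIV" and \<alpha>: "\<alpha> > 0"
    and int: "integrable lborel (\<lambda>w. (cmod (f w))\<^sup>2 * exp (- \<alpha> * (cmod w)\<^sup>2))"
  shows "(cmod (f z))\<^sup>2 \<le> exp (\<alpha> * (cmod z)\<^sup>2) * (\<alpha> / pi)
      * (\<integral>w. (cmod (f w))\<^sup>2 * exp (- \<alpha> * (cmod w)\<^sup>2) \<partial>lborel)"
proof -
  define N where "N = (\<lambda>w. (cmod (f w))\<^sup>2 * exp (- \<alpha> * (cmod w)\<^sup>2))"
  define h where "h = (\<lambda>w. (f (w + z) * exp (- of_real \<alpha> * w * cnj z))\<^sup>2)"
  have [measurable]: "f \<in> borel_measurable borel" using hol by (rule entire_measurable)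
  have "(\<lambda>w. f (w + z)) holomorphic_on UNIV"
    by (rule holomorphic_on_compose_gen[OF _ hol, unfolded o_def]) (auto intro!: holomorphic_intros)
  then have h: "h holomorphic_on UNIV" unfolding h_def by (intro holomorphic_intros)
  have [measurable]: "h \<in> borel_measurable borel" using h by (rule entire_measurable)
  have norm_eq: "norm (h w * of_real (exp (- \<alpha> * (cmod w)\<^sup>2))) = exp (\<alpha> * (cmod z)\<^sup>2) * N (w + z)" for w
  proof -
    have "(cmod (w + z))\<^sup>2 = (cmod w)\<^sup>2 + (cmod z)\<^sup>2 + 2 * Re (w * cnj z)"
      unfolding cmod_power2 by (simp add: power2_eq_square algebra_simps)
    then have "2 * (- \<alpha> * Re (w * cnj z)) - \<alpha> * (cmod w)\<^sup>2 = \<alpha> * (cmod z)\<^sup>2 - \<alpha> * (cmod (w + z))\<^sup>2"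
      by (simp add: algebra_simps)
    then have "exp (- \<alpha> * Re (w * cnj z)) ^ 2 * exp (- \<alpha> * (cmod w)\<^sup>2)
        = exp (\<alpha> * (cmod z)\<^sup>2) * exp (- \<alpha> * (cmod (w + z))\<^sup>2)"
      unfolding power2_eq_square[of "exp _"] exp_add[symmetric] by (simp add: algebra_simps)
    moreover have "cmod (exp (- of_real \<alpha> * w * cnj z)) = exp (- \<alpha> * Re (w * cnj z))"
      unfolding norm_exp_eq_Re by (simp add: algebra_simps)
    ultimately show ?thesis
      unfolding h_def N_def norm_mult norm_power norm_of_real abs_exp_cancel power_mult_distrib
      by (simp only: mult.assoc mult.left_commute)
  qed
  have N: "integrable lborel (\<lambda>w. N (w + z))" "(\<integral>w. N (w + z) \<partial>lborel) = (\<integral>w. N w \<partial>lborel)"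
    using int unfolding N_def[symmetric]
    by (rule integrable_translate, intro integral_translate) (auto simp: N_def)
  have "integrable lborel (\<lambda>w. norm (h w * of_real (exp (- \<alpha> * (cmod w)\<^sup>2))))"
    unfolding norm_eq using N by simp
  then have hint: "integrable lborel (\<lambda>w. h w * of_real (exp (- \<alpha> * (cmod w)\<^sup>2)))"
    by (subst (asm) integrable_norm_iff) simp_all
  have "pi / \<alpha> * (cmod (f z))\<^sup>2 = norm (of_real (pi / \<alpha>) * h 0)"
    using \<alpha> unfolding h_def norm_mult norm_power norm_of_real by simp
  also have "\<dots> = norm (\<integral>w. h w * of_real (exp (- \<alpha> * (cmod w)\<^sup>2)) \<partial>lborel)"
    by (simp only: gaussian_mean_value[OF h \<alpha> hint])
  also have "\<dots> \<le> (\<integral>w. norm (h w * of_real (exp (- \<alpha> * (cmod w)\<^sup>2))) \<partial>lborel)"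
    by (rule integral_norm_bound)
  also have "\<dots> = exp (\<alpha> * (cmod z)\<^sup>2) * (\<integral>w. N w \<partial>lborel)"
    unfolding norm_eq using N by simp
  finally show ?thesis
    using \<alpha> unfolding N_def by (simp add: field_simps)
qed

text \<open>
  The mean value property for \<open>f (w + z) exp (- \<alpha> w cnj z)\<close>, followed by a translation.
\<close>

lemma fock_space_reproducing:
  assumes f: "f \<in> fock_space \<alpha>" and \<alpha>: "\<alpha> > 0"
  shows "(\<integral>w. exp (of_real \<alpha> * z * cnj w) * f w \<partial>gaussian_measure \<alpha>) = f z"
proof -
  have hol: "f holomorphic_on UNIV" using f by (auto simp: fock_space_def)
  have f_meas[measurable]: "f \<in> borel_measurable borel" using hol by (rule entire_measurable)
  have k_meas[measurable]: "(\<lambda>w. exp (of_real \<alpha> * z * cnj w)) \<in> borel_measurable borel"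
    by (intro borel_measurable_continuous_onI continuous_intros)
  define h where "h = (\<lambda>w. f (w + z) * exp (- of_real \<alpha> * w * cnj z))"
  define \<Phi> where "\<Phi> = (\<lambda>w. exp (of_real \<alpha> * z * cnj w) * f w * of_real (exp (- \<alpha> * (cmod w)\<^sup>2)))"
  have [measurable]: "\<Phi> \<in> borel_measurable borel" unfolding \<Phi>_def by measurable
  have "(\<lambda>w. f (w + z)) holomorphic_on UNIV"
    by (rule holomorphic_on_compose_gen[OF _ hol, unfolded o_def]) (auto intro!: holomorphic_intros)
  then have h: "h holomorphic_on UNIV" unfolding h_def by (intro holomorphic_intros)
  have gauss: "of_real (exp (- \<alpha> * (cmod u)\<^sup>2)) = exp (- of_real \<alpha> * (u * cnj u))" for u
  proof -
    have "- of_real \<alpha> * (u * cnj u) = of_real (- \<alpha> * (cmod u)\<^sup>2)"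
      by (simp add: complex_norm_square del: of_real_power)
    then show ?thesis by (simp only: exp_of_real)
  qed
  have eq: "h w * of_real (exp (- \<alpha> * (cmod w)\<^sup>2)) = \<Phi> (w + z)" for w
  proof -
    have "exp (- of_real \<alpha> * w * cnj z) * exp (- of_real \<alpha> * (w * cnj w))
      = exp (of_real \<alpha> * z * cnj (w + z)) * exp (- of_real \<alpha> * ((w + z) * cnj (w + z)))"
      unfolding exp_add[symmetric] by (simp add: algebra_simps)
    then show ?thesis unfolding h_def \<Phi>_def gauss by (simp only: mult.assoc mult.left_commute)
  qed
  have int: "integrable (gaussian_measure \<alpha>) (\<lambda>w. exp (of_real \<alpha> * z * cnj w) * f w)"
  proof (rule Bochner_Integration.integrable_bound)
    show "integrable (gaussian_measure \<alpha>) (\<lambda>w. exp (0 * (cmod w)\<^sup>2 + \<alpha> * cmod z * cmod w) * cmod (f w))"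
      using \<alpha> by (intro fock_space_dominated[OF f \<alpha>]) simp
    have "cmod (exp (of_real \<alpha> * z * cnj w)) \<le> exp (\<alpha> * cmod z * cmod w)" for w
      using complex_Re_le_cmod[of "of_real \<alpha> * z * cnj w"] \<alpha>
      unfolding norm_exp_eq_Re by (simp add: norm_mult)
    then show "AE w in gaussian_measure \<alpha>. norm (exp (of_real \<alpha> * z * cnj w) * f w)
      \<le> norm (exp (0 * (cmod w)\<^sup>2 + \<alpha> * cmod z * cmod w) * cmod (f w))"
      by (simp add: norm_mult mult_right_mono)
    show "(\<lambda>w. exp (of_real \<alpha> * z * cnj w) * f w) \<in> borel_measurable (gaussian_measure \<alpha>)"
      by measurable
  qed
  have eq': "(\<lambda>w. (\<alpha> / pi * exp (- \<alpha> * (cmod w)\<^sup>2)) *\<^sub>R (exp (of_real \<alpha> * z * cnj w) * f w))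
      = (\<lambda>w. of_real (\<alpha> / pi) * \<Phi> w)"
    by (simp add: \<Phi>_def scaleR_conv_of_real mult_ac)
  have "integrable lborel (\<lambda>w. of_real (\<alpha> / pi) * \<Phi> w)"
    using int \<alpha> by (subst (asm) integrable_gaussian_measure) (simp_all only: eq', simp)
  then have "integrable lborel (\<lambda>w. of_real (pi / \<alpha>) * (of_real (\<alpha> / pi) * \<Phi> w))"
    by (rule integrable_mult_right)
  then have \<Phi>: "integrable lborel \<Phi>"
    using \<alpha> by simp
  have "(\<integral>w. exp (of_real \<alpha> * z * cnj w) * f w \<partial>gaussian_measure \<alpha>) = of_real (\<alpha> / pi) * (\<integral>w. \<Phi> w \<partial>lborel)"
    using \<alpha> by (subst integral_gaussian_measure) (simp_all only: eq', simp_all)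
  also have "(\<integral>w. \<Phi> w \<partial>lborel) = (\<integral>w. h w * of_real (exp (- \<alpha> * (cmod w)\<^sup>2)) \<partial>lborel)"
    unfolding eq by (rule integral_translate[symmetric]) simp
  also have "\<dots> = of_real (pi / \<alpha>) * h 0"
    using integrable_translate[OF \<Phi>, of z] by (intro gaussian_mean_value[OF h \<alpha>]) (simp only: eq)
  also have "of_real (\<alpha> / pi) * (of_real (pi / \<alpha>) * h 0) = f z"
    using \<alpha> by (simp add: h_def)
  finally show ?thesis .
qed

section \<open>The propagator\<close>

text \<open>
  The kernel including the normalising factor \<open>exp (- a t / 2) / (2 \<i>)\<close>, so that it satisfies the
  heat equation itself.
\<close>

definition propagator :: "real \<Rightarrow> real \<Rightarrow> complex \<Rightarrow> complex \<Rightarrow> complex" where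
  "propagator a t z w = of_real (exp (- a * t / 2) / sqrt (cosh (a * t))) *
     exp (of_real (a / 4 * tanh (a * t)) * ((cnj w)\<^sup>2 - z\<^sup>2)
          + of_real (a / (2 * cosh (a * t))) * z * cnj w)"

lemma propagator_eq_heat_kernel:
  "propagator a t z w = of_real (exp (- a * t / 2)) / (2 * \<i>) * heat_kernel a z w t"
proof -
  have "of_real (a / 4) * ((cnj w)\<^sup>2 - z\<^sup>2) * of_real (tanh (a * t))
          + of_real a * z * cnj w / (2 * of_real (cosh (a * t)))
      = of_real (a / 4 * tanh (a * t)) * ((cnj w)\<^sup>2 - z\<^sup>2)
          + complex_of_real (a / (2 * cosh (a * t))) * z * cnj w"
    by simp
  moreover have "of_real (A / s) * x = of_real A / (2 * \<i>) * (2 * \<i> / of_real s * x)" for A s :: real and x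
  proof -
    have "of_real A / c * (c / of_real s * x) = of_real (A / s) * x" if "c \<noteq> 0" for c :: complex
      using that by simp
    from this[of "2 * \<i>"] show ?thesis by (rule sym) simp
  qed
  ultimately show ?thesis unfolding propagator_def heat_kernel_def by (simp only:)
qed

lemma propagator_0: "propagator a 0 z w = exp (of_real (a / 2) * z * cnj w)"
  by (simp add: propagator_def)

text \<open>
  The logarithmic derivatives of the propagator in \<open>z\<close> and in \<open>t\<close>.
\<close>

definition propagator_log_z :: "real \<Rightarrow> real \<Rightarrow> complex \<Rightarrow> complex \<Rightarrow> complex" where
  "propagator_log_z a t z w =
     of_real (a / (2 * cosh (a * t))) * cnj w - of_real (a / 2 * tanh (a * t)) * z"

definition propagator_log_t :: "real \<Rightarrow> real \<Rightarrow> complex \<Rightarrow> complex \<Rightarrow> complex" where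
  "propagator_log_t a t z w =
     of_real (a\<^sup>2 / 4 / (cosh (a * t))\<^sup>2) * ((cnj w)\<^sup>2 - z\<^sup>2)
     - of_real (a\<^sup>2 / 2 * tanh (a * t) / cosh (a * t)) * z * cnj w
     - of_real (a / 2 + a / 2 * tanh (a * t))"

lemma has_field_derivative_propagator:
  "((\<lambda>z. propagator a t z w) has_field_derivative propagator_log_z a t z w * propagator a t z w) (at z)"
proof -
  have *: "((\<lambda>z. C * exp (p * (u\<^sup>2 - z\<^sup>2) + q * z * u)) has_field_derivative
      (q * u - 2 * p * z) * (C * exp (p * (u\<^sup>2 - z\<^sup>2) + q * z * u))) (at z)" for C p q u :: complex
    by (auto intro!: derivative_eq_intros simp: algebra_simps)
  have "of_real (a / 2 * tanh (a * t)) = 2 * complex_of_real (a / 4 * tanh (a * t))"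
    by simp
  then show ?thesis unfolding propagator_def propagator_log_z_def by (simp only: *)
qed

lemma has_field_derivative_propagator2:
  "((\<lambda>z. propagator_log_z a t z w * propagator a t z w) has_field_derivative
     ((propagator_log_z a t z w)\<^sup>2 - of_real (a / 2 * tanh (a * t))) * propagator a t z w) (at z)"
proof -
  have "((\<lambda>z. propagator_log_z a t z w) has_field_derivative - of_real (a / 2 * tanh (a * t))) (at z)"
    unfolding propagator_log_z_def by (auto intro!: derivative_eq_intros)
  from DERIV_mult[OF this has_field_derivative_propagator]
  show ?thesis by (simp add: algebra_simps power2_eq_square)
qed

lemma tanh_square_plus_sech_square: "(tanh x)\<^sup>2 + (inverse (cosh x))\<^sup>2 = 1" for x :: real
proof -
  have "(tanh x)\<^sup>2 + (inverse (cosh x))\<^sup>2 = ((sinh x)\<^sup>2 + 1) / (cosh x)\<^sup>2"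
    by (simp add: tanh_def power_divide add_divide_distrib inverse_eq_divide)
  also have "\<dots> = 1" unfolding cosh_square_eq[symmetric] by simp
  finally show ?thesis .
qed

text \<open>
  The heat equation for the propagator, divided by the propagator: the first two terms on the right are
  its second derivative in \<open>z\<close>.
\<close>

lemma propagator_equation:
  "propagator_log_t a t z w = ((propagator_log_z a t z w)\<^sup>2 - of_real (a / 2 * tanh (a * t)))
     - of_real a ^ 2 * z\<^sup>2 / 4 - of_real a / 2"
proof -
  define \<sigma> where "\<sigma> = inverse (cosh (a * t))"
  define \<tau> where "\<tau> = tanh (a * t)"
  have "\<tau>\<^sup>2 + \<sigma>\<^sup>2 = 1"
    unfolding \<sigma>_def \<tau>_def by (rule tanh_square_plus_sech_square)
  then have "\<sigma>\<^sup>2 = 1 - \<tau>\<^sup>2" by simp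
  from arg_cong[OF this, of complex_of_real]
  have *: "complex_of_real \<sigma> ^ 2 = 1 - complex_of_real \<tau> ^ 2" by simp
  have ring: "b\<^sup>2 * s\<^sup>2 * (u\<^sup>2 - z\<^sup>2) - 2 * b\<^sup>2 * r * s * z * u - (b + b * r)
      = (b * s * u - b * r * z)\<^sup>2 - b * r - b\<^sup>2 * z\<^sup>2 - b"
    if "s\<^sup>2 = 1 - r\<^sup>2" for b s u r :: complex
    using that by algebra
  have "propagator_log_z a t z w = of_real (a / 2) * of_real \<sigma> * cnj w - of_real (a / 2) * of_real \<tau> * z"
    by (simp add: propagator_log_z_def \<sigma>_def \<tau>_def field_simps)
  moreover have "propagator_log_t a t z w = of_real (a / 2) ^ 2 * of_real \<sigma> ^ 2 * ((cnj w)\<^sup>2 - z\<^sup>2)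
      - 2 * of_real (a / 2) ^ 2 * of_real \<tau> * of_real \<sigma> * z * cnj w
      - (of_real (a / 2) + of_real (a / 2) * of_real \<tau>)"
    by (simp add: propagator_log_t_def \<sigma>_def \<tau>_def field_simps power2_eq_square)
  moreover have "of_real a ^ 2 * z\<^sup>2 / 4 = of_real (a / 2) ^ 2 * z\<^sup>2" "of_real a / 2 = complex_of_real (a / 2)"
    "complex_of_real (a / 2 * tanh (a * t)) = of_real (a / 2) * of_real \<tau>"
    by (simp_all add: power2_eq_square \<tau>_def)
  ultimately show ?thesis by (simp only: ring[OF *])
qed

lemma has_vector_derivative_propagator:
  "((\<lambda>t. propagator a t z w) has_vector_derivative propagator_log_t a t z w * propagator a t z w) (at t)"
proof -
  have c: "cosh (a * t) > 0" "cosh (a * t) \<noteq> 0" by simp_all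
  have cosh': "((\<lambda>t. cosh (a * t)) has_real_derivative a * sinh (a * t)) (at t)"
    by (auto intro!: derivative_eq_intros)
  have 1: "((\<lambda>t. exp (- a * t / 2) / sqrt (cosh (a * t))) has_real_derivative
      - (a / 2 + a / 2 * tanh (a * t)) * (exp (- a * t / 2) / sqrt (cosh (a * t)))) (at t)"
  proof -
    have "((\<lambda>t. sqrt (cosh (a * t))) has_real_derivative a * sinh (a * t) / (2 * sqrt (cosh (a * t)))) (at t)"
      using DERIV_chain2[OF DERIV_real_sqrt[OF c(1)] cosh'] by (simp add: field_simps)
    moreover have "((\<lambda>t. exp (- a * t / 2)) has_real_derivative - a / 2 * exp (- a * t / 2)) (at t)"
      by (auto intro!: derivative_eq_intros)
    ultimately have "((\<lambda>t. exp (- a * t / 2) / sqrt (cosh (a * t))) has_real_derivative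
      (- a / 2 * exp (- a * t / 2) * sqrt (cosh (a * t))
        - exp (- a * t / 2) * (a * sinh (a * t) / (2 * sqrt (cosh (a * t))))) / (sqrt (cosh (a * t)) * sqrt (cosh (a * t)))) (at t)"
      using c by (intro DERIV_divide) auto
    moreover have "(- a / 2 * e * s - e * (a * S / (2 * s))) / (s * s)
        = - (a / 2 + a / 2 * (S / s\<^sup>2)) * (e / s)" if "s \<noteq> 0" for e s S :: real
      using that by (simp add: field_simps power2_eq_square)
    from this[of "sqrt (cosh (a * t))" "exp (- a * t / 2)" "sinh (a * t)"]
    have "(- a / 2 * exp (- a * t / 2) * sqrt (cosh (a * t))
        - exp (- a * t / 2) * (a * sinh (a * t) / (2 * sqrt (cosh (a * t))))) / (sqrt (cosh (a * t)) * sqrt (cosh (a * t)))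
      = - (a / 2 + a / 2 * tanh (a * t)) * (exp (- a * t / 2) / sqrt (cosh (a * t)))"
      using c by (simp add: tanh_def)
    ultimately show ?thesis by (simp only:)
  qed
  have 2: "((\<lambda>t. a / 4 * tanh (a * t)) has_real_derivative a\<^sup>2 / 4 / (cosh (a * t))\<^sup>2) (at t)"
  proof -
    have "((\<lambda>t. tanh (a * t)) has_real_derivative (1 - (tanh (a * t))\<^sup>2) * a) (at t)"
      by (auto intro!: derivative_eq_intros)
    moreover have "(1 - (tanh (a * t))\<^sup>2) = 1 / (cosh (a * t))\<^sup>2"
      using tanh_square_plus_sech_square[of "a * t"] by (simp add: inverse_eq_divide power_divide)
    ultimately have "((\<lambda>t. tanh (a * t)) has_real_derivative a / (cosh (a * t))\<^sup>2) (at t)" by simp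
    from DERIV_cmult[OF this, of "a / 4"] show ?thesis by (simp add: power2_eq_square)
  qed
  have 3: "((\<lambda>t. a / (2 * cosh (a * t))) has_real_derivative - (a\<^sup>2 / 2 * tanh (a * t) / cosh (a * t))) (at t)"
  proof -
    have "((\<lambda>t. a / 2 * inverse (cosh (a * t))) has_real_derivative
        a / 2 * - (inverse (cosh (a * t)) * (a * sinh (a * t)) * inverse (cosh (a * t)))) (at t)"
      by (intro DERIV_cmult DERIV_inverse' cosh' c)
    then show ?thesis by (simp add: field_simps tanh_def power2_eq_square)
  qed
  have cv: "((\<lambda>t. complex_of_real (f t)) has_vector_derivative of_real f') (at t)"
    if "(f has_real_derivative f') (at t)" for f f'
    using that by (rule has_vector_derivative_of_real)
  define q where "q = (\<lambda>t. of_real (a / 4 * tanh (a * t)) * ((cnj w)\<^sup>2 - z\<^sup>2)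
          + of_real (a / (2 * cosh (a * t))) * (z * cnj w))"
  define q' where "q' = of_real (a\<^sup>2 / 4 / (cosh (a * t))\<^sup>2) * ((cnj w)\<^sup>2 - z\<^sup>2)
          + of_real (- (a\<^sup>2 / 2 * tanh (a * t) / cosh (a * t))) * (z * cnj w)"
  have "(q has_vector_derivative q') (at t)"
    unfolding q_def q'_def
    by (intro has_vector_derivative_add has_vector_derivative_mult_left cv 2 3)
  then have "((\<lambda>t. exp (q t)) has_vector_derivative q' * exp (q t)) (at t)"
    by (rule field_vector_diff_chain_at[unfolded o_def]) (rule DERIV_exp)
  from has_vector_derivative_mult[OF cv[OF 1] this]
  have "((\<lambda>t. of_real (exp (- a * t / 2) / sqrt (cosh (a * t))) * exp (q t)) has_vector_derivative
     of_real (exp (- a * t / 2) / sqrt (cosh (a * t))) * (q' * exp (q t))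
     + of_real (- (a / 2 + a / 2 * tanh (a * t)) * (exp (- a * t / 2) / sqrt (cosh (a * t)))) * exp (q t)) (at t)" .
  moreover have "of_real R * (q' * e) + of_real (- x * R) * e = (q' - of_real x) * (of_real R * e)"
    for R x :: real and e :: complex
    by (simp add: algebra_simps)
  ultimately have "((\<lambda>t. of_real (exp (- a * t / 2) / sqrt (cosh (a * t))) * exp (q t)) has_vector_derivative
     (q' - of_real (a / 2 + a / 2 * tanh (a * t))) * (of_real (exp (- a * t / 2) / sqrt (cosh (a * t))) * exp (q t))) (at t)"
    by (simp only:)
  moreover have "of_real (exp (- a * t / 2) / sqrt (cosh (a * t))) * exp (q t) = propagator a t z w" for t
    by (simp add: propagator_def q_def mult.assoc)
  moreover have "q' - of_real (a / 2 + a / 2 * tanh (a * t)) = propagator_log_t a t z w"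
    by (simp add: propagator_log_t_def q'_def mult.assoc)
  ultimately show ?thesis by (simp only:)
qed

lemma tanh_real_bounds: "- 1 < tanh x" "tanh x < 1" for x :: real
  using tanh_real_gt_neg1 tanh_real_lt_1 by auto

lemma propagator_prefactor_le_1:
  assumes "a > 0" "t \<ge> 0"
  shows "exp (- a * t / 2) / sqrt (cosh (a * t)) \<le> 1"
proof -
  have "exp (- a * t / 2) \<le> 1" using assms by simp
  moreover have "1 \<le> sqrt (cosh (a * t))" using cosh_real_ge_1 by simp
  ultimately have "exp (- a * t / 2) \<le> sqrt (cosh (a * t))" by (rule order_trans)
  moreover have "0 < sqrt (cosh (a * t))" by simp
  ultimately show ?thesis by (simp only: divide_le_eq_1_pos)
qed

lemma norm_propagator:
  "cmod (propagator a t z w) = exp (- a * t / 2) / sqrt (cosh (a * t)) *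
     exp (a / 4 * tanh (a * t) * Re ((cnj w)\<^sup>2 - z\<^sup>2) + a / (2 * cosh (a * t)) * Re (z * cnj w))"
proof -
  have *: "Re (of_real r * u + of_real s * z * v) = r * Re u + s * Re (z * v)" for r s u v
    by (simp add: algebra_simps)
  have "\<bar>exp (- a * t / 2) / sqrt (cosh (a * t))\<bar> = exp (- a * t / 2) / sqrt (cosh (a * t))" by simp
  then show ?thesis unfolding propagator_def norm_mult norm_of_real norm_exp_eq_Re * by (simp only:)
qed

text \<open>
  A bound for the propagator and its derivatives on \<open>0 \<le> t \<le> T\<close>, \<open>|z| \<le> R\<close>. The coefficient of
  \<open>|w|\<^sup>2\<close> stays below \<open>a / 4\<close>; the summand \<open>2\<close> in the coefficient of \<open>|w|\<close> absorbs polynomial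
  factors of degree two.
\<close>

definition propagator_majorant :: "real \<Rightarrow> real \<Rightarrow> real \<Rightarrow> complex \<Rightarrow> real" where
  "propagator_majorant a T R w = (1 + a + a\<^sup>2) * exp (2 + 2 * R + a / 4 * R\<^sup>2) *
     exp (a / 4 * tanh (a * T) * (cmod w)\<^sup>2 + (a / 2 * R + 2) * cmod w)"

text \<open>
  The factor \<open>X\<close> stands for \<open>1\<close> or for the coefficient produced by a derivative.
\<close>

lemma propagator_majorant:
  assumes a: "a > 0" and t: "0 \<le> t" "t \<le> T" and z: "cmod z \<le> R"
    and X: "cmod X \<le> 1 \<or> cmod X \<le> (a + a\<^sup>2) * (1 + R + cmod w)\<^sup>2"
  shows "cmod (X * propagator a t z w) \<le> propagator_majorant a T R w"
proof -
  have R: "0 \<le> R" using z norm_ge_zero[of z] by linarith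
  let ?e = "exp (2 + 2 * R + 2 * cmod w)"
  have "(1 + R + cmod w)\<^sup>2 \<le> (exp (1 + R + cmod w))\<^sup>2"
    using R less_imp_le[OF exp_gt_self[of "1 + R + cmod w"]] by (intro power_mono) auto
  also have "\<dots> = ?e" by (simp add: power2_eq_square exp_add[symmetric])
  finally have e: "(1 + R + cmod w)\<^sup>2 \<le> ?e" .
  have e1: "1 \<le> ?e" using R by simp
  have "cmod X \<le> (1 + a + a\<^sup>2) * ?e"
    using X
  proof
    assume "cmod X \<le> 1"
    moreover have "1 * 1 \<le> (1 + a + a\<^sup>2) * ?e" using a by (intro mult_mono e1) auto
    ultimately show ?thesis by linarith
  next
    assume "cmod X \<le> (a + a\<^sup>2) * (1 + R + cmod w)\<^sup>2"
    also have "\<dots> \<le> (1 + a + a\<^sup>2) * ?e" using a by (intro mult_mono e) auto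
    finally show ?thesis .
  qed
  moreover have "cmod (propagator a t z w)
      \<le> 1 * exp (a / 4 * R\<^sup>2 + (a / 4 * tanh (a * T) * (cmod w)\<^sup>2 + a / 2 * R * cmod w))"
    unfolding norm_propagator
  proof (intro mult_mono propagator_prefactor_le_1 a t)
    have \<tau>: "0 \<le> tanh (a * t)" "tanh (a * t) \<le> tanh (a * T)" "tanh (a * t) \<le> 1" "0 \<le> tanh (a * T)"
      using a t tanh_real_bounds[of "a * t"] by auto
    have z2: "(cmod z)\<^sup>2 \<le> R\<^sup>2" using z by (intro power_mono) auto
    have "Re ((cnj w)\<^sup>2 - z\<^sup>2) \<le> (cmod w)\<^sup>2 + (cmod z)\<^sup>2"
      using complex_Re_le_cmod[of "(cnj w)\<^sup>2 - z\<^sup>2"] norm_triangle_ineq4[of "(cnj w)\<^sup>2" "z\<^sup>2"]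
      by (simp add: norm_power)
    then have "a / 4 * tanh (a * t) * Re ((cnj w)\<^sup>2 - z\<^sup>2) \<le> a / 4 * tanh (a * t) * ((cmod w)\<^sup>2 + (cmod z)\<^sup>2)"
      using a \<tau> by (intro mult_left_mono) auto
    also have "\<dots> = a / 4 * tanh (a * t) * (cmod w)\<^sup>2 + a / 4 * (tanh (a * t) * (cmod z)\<^sup>2)"
      by (simp add: algebra_simps)
    also have "\<dots> \<le> a / 4 * tanh (a * T) * (cmod w)\<^sup>2 + a / 4 * (1 * R\<^sup>2)"
      using a \<tau> z2 by (intro add_mono mult_mono) auto
    finally have 1: "a / 4 * tanh (a * t) * Re ((cnj w)\<^sup>2 - z\<^sup>2) \<le> a / 4 * tanh (a * T) * (cmod w)\<^sup>2 + a / 4 * R\<^sup>2"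
      by simp
    have "Re (z * cnj w) \<le> R * cmod w"
      using complex_Re_le_cmod[of "z * cnj w"] mult_right_mono[OF z norm_ge_zero[of w]] by (simp add: norm_mult)
    then have "a / (2 * cosh (a * t)) * Re (z * cnj w) \<le> a / (2 * cosh (a * t)) * (R * cmod w)"
      using a by (intro mult_left_mono) auto
    also have "\<dots> \<le> a / 2 * (R * cmod w)"
      using a R cosh_real_ge_1[of "a * t"] by (intro mult_right_mono divide_left_mono) auto
    finally show "exp (a / 4 * tanh (a * t) * Re ((cnj w)\<^sup>2 - z\<^sup>2) + a / (2 * cosh (a * t)) * Re (z * cnj w))
      \<le> exp (a / 4 * R\<^sup>2 + (a / 4 * tanh (a * T) * (cmod w)\<^sup>2 + a / 2 * R * cmod w))"
      using 1 by simp
  qed auto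
  ultimately have "cmod (X * propagator a t z w) \<le> (1 + a + a\<^sup>2) * ?e *
      (1 * exp (a / 4 * R\<^sup>2 + (a / 4 * tanh (a * T) * (cmod w)\<^sup>2 + a / 2 * R * cmod w)))"
    unfolding norm_mult using a by (intro mult_mono) auto
  also have "\<dots> = propagator_majorant a T R w"
    unfolding propagator_majorant_def by (simp add: exp_add[symmetric] algebra_simps)
  finally show ?thesis .
qed

lemma propagator_coefficient_bounds:
  fixes a R :: real and w z :: complex
  assumes a: "a > 0" and z: "cmod z \<le> R"
  defines "Q \<equiv> (a + a\<^sup>2) * (1 + R + cmod w)\<^sup>2"
  shows "cmod (propagator_log_z a t z w) \<le> Q"
    and "cmod ((propagator_log_z a t z w)\<^sup>2 - of_real (a / 2 * tanh (a * t))) \<le> Q"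
    and "cmod (propagator_log_t a t z w) \<le> Q"
proof -
  have R: "0 \<le> R" using z norm_ge_zero[of z] by linarith
  define Y where "Y = 1 + R + cmod w"
  have Y: "1 \<le> Y" "cmod w \<le> Y" "cmod z \<le> Y" "cmod z + cmod w \<le> Y"
    using R z norm_ge_zero[of w] by (auto simp: Y_def simp del: norm_ge_zero)
  then have Y2: "Y \<le> Y\<^sup>2" "1 \<le> Y\<^sup>2" by (auto simp: power2_eq_square intro: order_trans)
  define \<sigma> where "\<sigma> = 1 / cosh (a * t)"
  define \<tau> where "\<tau> = tanh (a * t)"
  have \<tau>: "\<bar>\<tau>\<bar> \<le> 1" using tanh_real_bounds[of "a * t"] by (auto simp: \<tau>_def abs_le_iff)
  have \<sigma>: "0 \<le> \<sigma>" "\<sigma> \<le> 1" using cosh_real_ge_1[of "a * t"] by (auto simp: \<sigma>_def divide_le_eq)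
  have Lz: "propagator_log_z a t z w = of_real (a / 2) * (of_real \<sigma> * cnj w - of_real \<tau> * z)"
    by (simp add: propagator_log_z_def \<sigma>_def \<tau>_def algebra_simps)
  have sub: "cmod (of_real \<sigma> * cnj w - of_real \<tau> * z) \<le> Y"
  proof -
    have "cmod (of_real \<sigma> * cnj w - of_real \<tau> * z) \<le> \<bar>\<sigma>\<bar> * cmod w + \<bar>\<tau>\<bar> * cmod z"
      using norm_triangle_ineq4[of "of_real \<sigma> * cnj w" "of_real \<tau> * z"] by (simp add: norm_mult)
    also have "\<dots> \<le> 1 * cmod w + 1 * cmod z"
      using \<sigma> \<tau> by (intro add_mono mult_right_mono) auto
    finally show ?thesis using Y by simp
  qed
  have Lz1: "cmod (propagator_log_z a t z w) \<le> a / 2 * Y"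
    unfolding Lz norm_mult using a sub by simp
  have Q: "Q = (a + a\<^sup>2) * Y\<^sup>2" by (simp add: Q_def Y_def)
  have aY: "a * Y \<le> a * Y\<^sup>2" "a \<le> a * Y\<^sup>2" "0 \<le> a\<^sup>2 * Y\<^sup>2" using a Y2 by auto
  show "cmod (propagator_log_z a t z w) \<le> Q"
  proof -
    have "0 \<le> a * Y" using a Y by simp
    then show ?thesis using Lz1 aY unfolding Q distrib_right by linarith
  qed
  have "(cmod (propagator_log_z a t z w))\<^sup>2 \<le> (a / 2 * Y)\<^sup>2"
    using Lz1 by (intro power_mono) auto
  then have "cmod ((propagator_log_z a t z w)\<^sup>2) \<le> a\<^sup>2 * Y\<^sup>2 / 4"
    by (simp add: norm_power power_mult_distrib power_divide)
  moreover have "cmod (of_real (a / 2 * tanh (a * t))) \<le> a / 2"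
    using a \<tau> unfolding norm_of_real \<tau>_def abs_mult by simp
  ultimately show "cmod ((propagator_log_z a t z w)\<^sup>2 - of_real (a / 2 * tanh (a * t))) \<le> Q"
    using norm_triangle_ineq4[of "(propagator_log_z a t z w)\<^sup>2" "of_real (a / 2 * tanh (a * t))"] aY a
    unfolding Q distrib_right by linarith
  have Lt: "propagator_log_t a t z w = of_real (a\<^sup>2 / 4 * \<sigma>\<^sup>2) * ((cnj w)\<^sup>2 - z\<^sup>2)
     - of_real (a\<^sup>2 / 2 * \<tau> * \<sigma>) * (z * cnj w) - of_real (a / 2 + a / 2 * \<tau>)"
    by (simp add: propagator_log_t_def \<sigma>_def \<tau>_def power_divide)
  have 1: "cmod (of_real (a\<^sup>2 / 4 * \<sigma>\<^sup>2) * ((cnj w)\<^sup>2 - z\<^sup>2)) \<le> a\<^sup>2 / 4 * 1 * (Y\<^sup>2 + Y\<^sup>2)"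
  proof -
    have "cmod ((cnj w)\<^sup>2 - z\<^sup>2) \<le> (cmod w)\<^sup>2 + (cmod z)\<^sup>2"
      using norm_triangle_ineq4[of "(cnj w)\<^sup>2" "z\<^sup>2"] by (simp add: norm_power)
    also have "\<dots> \<le> Y\<^sup>2 + Y\<^sup>2" using Y by (intro add_mono power_mono) auto
    finally have "cmod ((cnj w)\<^sup>2 - z\<^sup>2) \<le> Y\<^sup>2 + Y\<^sup>2" .
    moreover have "\<sigma>\<^sup>2 \<le> 1" using \<sigma> by (simp add: power_le_one)
    ultimately show ?thesis unfolding norm_mult norm_of_real abs_mult by (intro mult_mono) auto
  qed
  have 2: "cmod (of_real (a\<^sup>2 / 2 * \<tau> * \<sigma>) * (z * cnj w)) \<le> a\<^sup>2 / 2 * 1 * 1 * (Y * Y)"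
    unfolding norm_mult norm_of_real abs_mult complex_mod_cnj using \<tau> \<sigma> Y by (intro mult_mono) auto
  have 3: "cmod (of_real (a / 2 + a / 2 * \<tau>)) \<le> a"
  proof -
    have "\<bar>a / 2 * \<tau>\<bar> \<le> a / 2 * 1" unfolding abs_mult using a \<tau> by (intro mult_mono) auto
    then show ?thesis unfolding norm_of_real using a by linarith
  qed
  have "cmod (propagator_log_t a t z w) \<le> a\<^sup>2 / 4 * 1 * (Y\<^sup>2 + Y\<^sup>2) + a\<^sup>2 / 2 * 1 * 1 * (Y * Y) + a"
    unfolding Lt by (intro norm_triangle_le_diff order_trans[OF norm_triangle_ineq4] add_mono 1 2 3)
  also have "\<dots> = a\<^sup>2 * Y\<^sup>2 + a" by (simp add: power2_eq_square algebra_simps)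
  also have "\<dots> \<le> Q" unfolding Q distrib_right using aY by simp
  finally show "cmod (propagator_log_t a t z w) \<le> Q" .
qed

lemma measurable_propagator [measurable]:
  "(\<lambda>w. propagator a t z w) \<in> borel_measurable borel"
  "(\<lambda>w. propagator_log_z a t z w) \<in> borel_measurable borel"
  "(\<lambda>w. propagator_log_t a t z w) \<in> borel_measurable borel"
  unfolding propagator_def propagator_log_z_def propagator_log_t_def
  by (intro borel_measurable_continuous_onI continuous_intros; simp)+

lemma continuous_propagator:
  "continuous_on UNIV (\<lambda>(t, z). propagator a t z w)"
  unfolding propagator_def case_prod_beta
  by (intro continuous_intros) (auto simp: less_imp_neq[THEN not_sym] cosh_real_pos)

section \<open>Existence\<close>

text \<open>
  A fixed initial value in the Fock space, and the function that it generates.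
\<close>

locale heat_flow =
  fixes a :: real and V\<^sub>0 :: "complex \<Rightarrow> complex"
  assumes a: "a > 0" and V0: "V\<^sub>0 \<in> fock_space (a / 2)"
begin

abbreviation G :: "complex measure" where "G \<equiv> gaussian_measure (a / 2)"

text \<open>
  The solution, written with the normalised kernel.
\<close>

definition flow :: "real \<Rightarrow> complex \<Rightarrow> complex" where
  "flow t z = (\<integral>w. propagator a t z w * V\<^sub>0 w \<partial>G)"

lemma measurable_V0 [measurable]: "V\<^sub>0 \<in> borel_measurable borel"
  using V0 by (auto simp: fock_space_def intro: entire_measurable)

lemma integrable_majorant:
  "integrable G (\<lambda>w. propagator_majorant a T R w * cmod (V\<^sub>0 w))"
proof -
  have "a * tanh (a * T) < a * 1"
    using a tanh_real_bounds by (intro mult_strict_left_mono) auto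
  then have "2 * (a / 4 * tanh (a * T)) < a / 2" by simp
  from integrable_mult_right[OF fock_space_dominated[OF V0 _ this, of "a / 2 * R + 2"]] a
  have "integrable G (\<lambda>w. ((1 + a + a\<^sup>2) * exp (2 + 2 * R + a / 4 * R\<^sup>2)) *
     (exp (a / 4 * tanh (a * T) * (cmod w)\<^sup>2 + (a / 2 * R + 2) * cmod w) * cmod (V\<^sub>0 w)))" by simp
  then show ?thesis unfolding propagator_majorant_def by (simp only: mult.assoc)
qed

lemma integrable_propagator_mult:
  assumes "0 \<le> t" "X \<in> borel_measurable borel"
    and "\<And>w. cmod (X w) \<le> 1 \<or> cmod (X w) \<le> (a + a\<^sup>2) * (1 + cmod z + cmod w)\<^sup>2"
  shows "integrable G (\<lambda>w. X w * propagator a t z w * V\<^sub>0 w)"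
proof (rule Bochner_Integration.integrable_bound)
  show "integrable G (\<lambda>w. propagator_majorant a t (cmod z) w * cmod (V\<^sub>0 w))"
    by (rule integrable_majorant)
  have "norm (X w * propagator a t z w * V\<^sub>0 w) \<le> propagator_majorant a t (cmod z) w * cmod (V\<^sub>0 w)" for w
    unfolding norm_mult[of _ "V\<^sub>0 w"]
    using propagator_majorant[OF a assms(1) order_refl order_refl assms(3), of w]
    by (intro mult_right_mono) auto
  then show "AE w in G. norm (X w * propagator a t z w * V\<^sub>0 w)
      \<le> norm (propagator_majorant a t (cmod z) w * cmod (V\<^sub>0 w))"
    by (intro AE_I2) (simp only: real_norm_def order_trans[OF _ abs_ge_self])
  show "(\<lambda>w. X w * propagator a t z w * V\<^sub>0 w) \<in> borel_measurable G"
    using assms(2) by measurable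
qed

lemma integrable_propagator:
  assumes "0 \<le> t"
  shows "integrable G (\<lambda>w. propagator a t z w * V\<^sub>0 w)"
    and "integrable G (\<lambda>w. propagator_log_z a t z w * propagator a t z w * V\<^sub>0 w)"
    and "integrable G (\<lambda>w. ((propagator_log_z a t z w)\<^sup>2 - of_real (a / 2 * tanh (a * t))) * propagator a t z w * V\<^sub>0 w)"
    and "integrable G (\<lambda>w. propagator_log_t a t z w * propagator a t z w * V\<^sub>0 w)"
proof -
  note b = propagator_coefficient_bounds[OF a order_refl]
  show "integrable G (\<lambda>w. propagator a t z w * V\<^sub>0 w)"
    using integrable_propagator_mult[OF assms, of "\<lambda>_. 1" z] by simp
  show "integrable G (\<lambda>w. propagator_log_z a t z w * propagator a t z w * V\<^sub>0 w)"
    using b by (intro integrable_propagator_mult assms) auto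
  show "integrable G (\<lambda>w. ((propagator_log_z a t z w)\<^sup>2 - of_real (a / 2 * tanh (a * t))) * propagator a t z w * V\<^sub>0 w)"
    using b by (intro integrable_propagator_mult assms disjI2) auto
  show "integrable G (\<lambda>w. propagator_log_t a t z w * propagator a t z w * V\<^sub>0 w)"
    using b by (intro integrable_propagator_mult assms) auto
qed

lemma propagator_V0_bound:
  assumes "0 \<le> t" "t \<le> T" "cmod z \<le> R" "cmod X \<le> 1 \<or> cmod X \<le> (a + a\<^sup>2) * (1 + R + cmod w)\<^sup>2"
  shows "cmod (X * propagator a t z w * V\<^sub>0 w) \<le> propagator_majorant a T R w * cmod (V\<^sub>0 w)"
  unfolding norm_mult[of _ "V\<^sub>0 w"] by (intro mult_right_mono propagator_majorant[OF a assms]) simp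

lemma flow_deriv:
  assumes t: "0 \<le> t"
  shows "(flow t has_field_derivative (\<integral>w. propagator_log_z a t z w * propagator a t z w * V\<^sub>0 w \<partial>G)) (at z)"
  unfolding flow_def
proof (rule has_field_derivative_integral[where S = "ball 0 (cmod z + 1)"
      and g = "\<lambda>w. propagator_majorant a t (cmod z + 1) w * cmod (V\<^sub>0 w)"])
  fix x w :: complex assume "x \<in> ball 0 (cmod z + 1)"
  then have x: "cmod x \<le> cmod z + 1" by simp
  show "((\<lambda>x. propagator a t x w * V\<^sub>0 w) has_field_derivative
      propagator_log_z a t x w * propagator a t x w * V\<^sub>0 w) (at x)"
    by (intro DERIV_cmult_right has_field_derivative_propagator)
  show "cmod (propagator_log_z a t x w * propagator a t x w * V\<^sub>0 w)
      \<le> propagator_majorant a t (cmod z + 1) w * cmod (V\<^sub>0 w)"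
    by (intro propagator_V0_bound t order_refl x disjI2 propagator_coefficient_bounds a)
qed (auto intro!: integrable_majorant integrable_propagator t)

lemma flow_deriv2:
  assumes t: "0 \<le> t"
  shows "((\<lambda>z. \<integral>w. propagator_log_z a t z w * propagator a t z w * V\<^sub>0 w \<partial>G) has_field_derivative
    (\<integral>w. ((propagator_log_z a t z w)\<^sup>2 - of_real (a / 2 * tanh (a * t))) * propagator a t z w * V\<^sub>0 w \<partial>G)) (at z)"
proof (rule has_field_derivative_integral[where S = "ball 0 (cmod z + 1)"
      and g = "\<lambda>w. propagator_majorant a t (cmod z + 1) w * cmod (V\<^sub>0 w)"])
  fix x w :: complex assume "x \<in> ball 0 (cmod z + 1)"
  then have x: "cmod x \<le> cmod z + 1" by simp
  show "((\<lambda>x. propagator_log_z a t x w * propagator a t x w * V\<^sub>0 w) has_field_derivative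
      ((propagator_log_z a t x w)\<^sup>2 - of_real (a / 2 * tanh (a * t))) * propagator a t x w * V\<^sub>0 w) (at x)"
    by (intro DERIV_cmult_right has_field_derivative_propagator2)
  show "cmod (((propagator_log_z a t x w)\<^sup>2 - of_real (a / 2 * tanh (a * t))) * propagator a t x w * V\<^sub>0 w)
      \<le> propagator_majorant a t (cmod z + 1) w * cmod (V\<^sub>0 w)"
    by (intro propagator_V0_bound t order_refl x disjI2 propagator_coefficient_bounds a)
qed (auto intro!: integrable_majorant integrable_propagator t)

lemma flow_holomorphic:
  assumes "0 \<le> t"
  shows "flow t holomorphic_on UNIV"
  using flow_deriv[OF assms] by (auto simp: holomorphic_on_open)

lemma flow_time_deriv:
  assumes t: "0 < t"
  shows "((\<lambda>t. flow t z) has_vector_derivative (\<integral>w. propagator_log_t a t z w * propagator a t z w * V\<^sub>0 w \<partial>G)) (at t)"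
  unfolding flow_def
proof (rule has_vector_derivative_integral[where S = "{0<..<t + 1}"
      and g = "\<lambda>w. propagator_majorant a (t + 1) (cmod z) w * cmod (V\<^sub>0 w)"])
  fix s :: real and w :: complex assume "s \<in> {0<..<t + 1}"
  then have s: "0 \<le> s" "s \<le> t + 1" by auto
  show "((\<lambda>s. propagator a s z w * V\<^sub>0 w) has_vector_derivative
      propagator_log_t a s z w * propagator a s z w * V\<^sub>0 w) (at s)"
    by (intro has_vector_derivative_mult_left has_vector_derivative_propagator)
  show "cmod (propagator_log_t a s z w * propagator a s z w * V\<^sub>0 w)
      \<le> propagator_majorant a (t + 1) (cmod z) w * cmod (V\<^sub>0 w)"
    by (intro propagator_V0_bound s order_refl disjI2 propagator_coefficient_bounds a)
qed (use t in \<open>auto intro!: integrable_majorant integrable_propagator\<close>)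

lemma flow_equation:
  assumes t: "0 < t"
  shows "((\<lambda>t. flow t z) has_vector_derivative harmonic_op a (flow t) z) (at t)"
proof -
  have "deriv (flow t) = (\<lambda>z. \<integral>w. propagator_log_z a t z w * propagator a t z w * V\<^sub>0 w \<partial>G)"
    using t by (intro ext DERIV_imp_deriv flow_deriv) simp
  then have "deriv (deriv (flow t)) z =
      (\<integral>w. ((propagator_log_z a t z w)\<^sup>2 - of_real (a / 2 * tanh (a * t))) * propagator a t z w * V\<^sub>0 w \<partial>G)"
    using t by (simp only:) (intro DERIV_imp_deriv flow_deriv2, simp)
  then have "harmonic_op a (flow t) z = (\<integral>w. ((propagator_log_z a t z w)\<^sup>2 - of_real (a / 2 * tanh (a * t))) * propagator a t z w * V\<^sub>0 w
      - of_real a ^ 2 * z\<^sup>2 / 4 * (propagator a t z w * V\<^sub>0 w) - of_real a / 2 * (propagator a t z w * V\<^sub>0 w) \<partial>G)"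
    unfolding harmonic_op_def flow_def
    using integrable_propagator[of t z] t
    by (subst Bochner_Integration.integral_diff, simp, simp, subst Bochner_Integration.integral_diff) simp_all
  also have "\<dots> = (\<integral>w. propagator_log_t a t z w * propagator a t z w * V\<^sub>0 w \<partial>G)"
    unfolding propagator_equation by (intro Bochner_Integration.integral_cong refl) (simp add: algebra_simps)
  finally show ?thesis using flow_time_deriv[OF t] by simp
qed

lemma flow_continuous: "continuous_on ({0..} \<times> UNIV) (\<lambda>(t, z). flow t z)"
  unfolding continuous_on_sequentially
proof (intro allI ballI impI, elim conjE)
  fix x and p :: "real \<times> complex"
  assume p: "p \<in> {0..} \<times> UNIV" and x: "\<forall>n. x n \<in> {0..} \<times> UNIV" and lim: "x \<longlonglongrightarrow> p"
  obtain K where K: "\<And>n. norm (x n) \<le> K"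
    using convergent_imp_Bseq[of x] lim unfolding convergent_def Bseq_def by blast
  have bnd: "0 \<le> fst (x n)" "fst (x n) \<le> K" "cmod (snd (x n)) \<le> K" for n
    using x[rule_format, of n] K[of n] norm_fst_le[of "fst (x n)" "snd (x n)"] norm_snd_le[of "snd (x n)" "fst (x n)"]
    by (auto simp: mem_Times_iff abs_le_iff)
  have "(\<lambda>n. \<integral>w. propagator a (fst (x n)) (snd (x n)) w * V\<^sub>0 w \<partial>G)
      \<longlonglongrightarrow> (\<integral>w. propagator a (fst p) (snd p) w * V\<^sub>0 w \<partial>G)"
  proof (rule integral_dominated_convergence[where w = "\<lambda>w. propagator_majorant a K K w * cmod (V\<^sub>0 w)"])
    show "AE w in G. (\<lambda>n. propagator a (fst (x n)) (snd (x n)) w * V\<^sub>0 w) \<longlonglongrightarrow> propagator a (fst p) (snd p) w * V\<^sub>0 w"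
    proof (intro AE_I2 tendsto_mult_right)
      fix w
      have "isCont (\<lambda>p. propagator a (fst p) (snd p) w) p"
        using continuous_propagator[of a w]
        by (cases p) (simp add: continuous_on_eq_continuous_at case_prod_beta)
      then show "(\<lambda>n. propagator a (fst (x n)) (snd (x n)) w) \<longlonglongrightarrow> propagator a (fst p) (snd p) w"
        using lim by (rule isCont_tendsto_compose)
    qed
    show "AE w in G. norm (propagator a (fst (x n)) (snd (x n)) w * V\<^sub>0 w) \<le> propagator_majorant a K K w * cmod (V\<^sub>0 w)" for n
      using propagator_V0_bound[OF bnd(1) bnd(2) bnd(3), where X = 1] by (intro AE_I2) simp
  qed (auto intro!: integrable_majorant)
  then show "((\<lambda>(t, z). flow t z) \<circ> x) \<longlonglongrightarrow> (case p of (t, z) \<Rightarrow> flow t z)"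
    by (simp add: flow_def case_prod_beta o_def)
qed

lemma flow_0: "flow 0 z = V\<^sub>0 z"
  using fock_space_reproducing[OF V0, of z] a by (simp add: flow_def propagator_0)

end

section \<open>The flow preserves the Fock space\<close>

text \<open>
  Schur's test with constant weights: an integral operator whose kernel has row and column integrals at
  most \<open>C\<close> is bounded by \<open>C\<close> on square integrable functions.
\<close>

lemma schur_test:
  fixes \<kappa> :: "complex \<Rightarrow> complex \<Rightarrow> real" and \<phi> :: "complex \<Rightarrow> ennreal"
  assumes \<kappa>[measurable]: "(\<lambda>(z, w). \<kappa> z w) \<in> borel_measurable (lborel \<Otimes>\<^sub>M lborel)"
    and pos: "\<And>z w. 0 \<le> \<kappa> z w"
    and row: "\<And>z. (\<integral>\<^sup>+w. ennreal (\<kappa> z w) \<partial>lborel) \<le> C"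
    and col: "\<And>w. (\<integral>\<^sup>+z. ennreal (\<kappa> z w) \<partial>lborel) \<le> C"
    and \<phi>[measurable]: "\<phi> \<in> borel_measurable borel"
  shows "(\<integral>\<^sup>+z. (\<integral>\<^sup>+w. ennreal (\<kappa> z w) * \<phi> w \<partial>lborel)\<^sup>2 \<partial>lborel) \<le> C * C * (\<integral>\<^sup>+w. (\<phi> w)\<^sup>2 \<partial>lborel)"
proof -
  have [measurable]: "(\<lambda>w. \<kappa> z w) \<in> borel_measurable borel" "(\<lambda>w. \<kappa> w z) \<in> borel_measurable borel" for z
    using measurable_compose[OF measurable_Pair1'[of z lborel lborel] \<kappa>]
      measurable_compose[OF measurable_Pair2'[of z lborel lborel] \<kappa>] by simp_all
  have sq: "(ennreal (sqrt (\<kappa> z w)))\<^sup>2 = ennreal (\<kappa> z w)" for z w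
    using pos[of z w] by (simp add: ennreal_power)
  have "(\<integral>\<^sup>+w. ennreal (\<kappa> z w) * \<phi> w \<partial>lborel)\<^sup>2 \<le> C * (\<integral>\<^sup>+w. ennreal (\<kappa> z w) * (\<phi> w)\<^sup>2 \<partial>lborel)" for z
  proof -
    \<comment> \<open>Cauchy-Schwarz for the factorisation of \<open>\<kappa>\<close> into two square roots.\<close>
    have "(\<integral>\<^sup>+w. ennreal (sqrt (\<kappa> z w)) * (ennreal (sqrt (\<kappa> z w)) * \<phi> w) \<partial>lborel)\<^sup>2
      \<le> (\<integral>\<^sup>+w. (ennreal (sqrt (\<kappa> z w)))\<^sup>2 \<partial>lborel) * (\<integral>\<^sup>+w. (ennreal (sqrt (\<kappa> z w)) * \<phi> w)\<^sup>2 \<partial>lborel)"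
      by (rule Cauchy_Schwarz_nn_integral) measurable
    also have "(\<lambda>w. ennreal (sqrt (\<kappa> z w)) * (ennreal (sqrt (\<kappa> z w)) * \<phi> w)) = (\<lambda>w. ennreal (\<kappa> z w) * \<phi> w)"
      by (simp add: sq[symmetric] power2_eq_square mult.assoc)
    also have "(\<integral>\<^sup>+w. (ennreal (sqrt (\<kappa> z w)))\<^sup>2 \<partial>lborel) * (\<integral>\<^sup>+w. (ennreal (sqrt (\<kappa> z w)) * \<phi> w)\<^sup>2 \<partial>lborel)
        = (\<integral>\<^sup>+w. ennreal (\<kappa> z w) \<partial>lborel) * (\<integral>\<^sup>+w. ennreal (\<kappa> z w) * (\<phi> w)\<^sup>2 \<partial>lborel)"
      by (simp add: sq power_mult_distrib)
    also have "\<dots> \<le> C * (\<integral>\<^sup>+w. ennreal (\<kappa> z w) * (\<phi> w)\<^sup>2 \<partial>lborel)"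
      by (intro mult_right_mono row) simp
    finally show ?thesis .
  qed
  then have "(\<integral>\<^sup>+z. (\<integral>\<^sup>+w. ennreal (\<kappa> z w) * \<phi> w \<partial>lborel)\<^sup>2 \<partial>lborel)
      \<le> (\<integral>\<^sup>+z. C * (\<integral>\<^sup>+w. ennreal (\<kappa> z w) * (\<phi> w)\<^sup>2 \<partial>lborel) \<partial>lborel)"
    by (intro nn_integral_mono) simp
  also have "\<dots> = C * (\<integral>\<^sup>+z. (\<integral>\<^sup>+w. ennreal (\<kappa> z w) * (\<phi> w)\<^sup>2 \<partial>lborel) \<partial>lborel)"
    by (rule nn_integral_cmult) measurable
  also have "(\<integral>\<^sup>+z. (\<integral>\<^sup>+w. ennreal (\<kappa> z w) * (\<phi> w)\<^sup>2 \<partial>lborel) \<partial>lborel)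
      = (\<integral>\<^sup>+w. (\<integral>\<^sup>+z. ennreal (\<kappa> z w) * (\<phi> w)\<^sup>2 \<partial>lborel) \<partial>lborel)"
    by (rule lborel_pair.Fubini'[symmetric]) measurable
  also have "\<dots> = (\<integral>\<^sup>+w. (\<integral>\<^sup>+z. ennreal (\<kappa> z w) \<partial>lborel) * (\<phi> w)\<^sup>2 \<partial>lborel)"
    by (intro nn_integral_cong nn_integral_multc) measurable
  also have "\<dots> \<le> (\<integral>\<^sup>+w. C * (\<phi> w)\<^sup>2 \<partial>lborel)"
    by (intro nn_integral_mono mult_right_mono col) simp
  also have "\<dots> = C * (\<integral>\<^sup>+w. (\<phi> w)\<^sup>2 \<partial>lborel)"
    by (rule nn_integral_cmult) measurable
  finally show ?thesis by (simp add: mult.assoc mult_left_mono)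
qed

text \<open>
  The modulus of the propagator times \<open>exp (- a |z|\<^sup>2 / 4 - a |w|\<^sup>2 / 4)\<close>, up to the scalar
  prefactor: since \<open>sqrt (1 + tanh) sqrt (1 - tanh) = 1 / cosh\<close>, the exponent is a sum of two
  complete squares.
\<close>

definition schur_kernel :: "real \<Rightarrow> real \<Rightarrow> complex \<Rightarrow> complex \<Rightarrow> real" where
  "schur_kernel a t z w = exp (- (a / 4) *
     ((sqrt (1 + tanh (a * t)) * Re z - sqrt (1 - tanh (a * t)) * Re w)\<^sup>2
      + (sqrt (1 - tanh (a * t)) * Im z - sqrt (1 + tanh (a * t)) * Im w)\<^sup>2))"

lemma sqrt_tanh_prod:
  "sqrt (1 + tanh x) * sqrt (1 - tanh x) = 1 / cosh x" for x :: real
proof -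
  have "(1 + tanh x) * (1 - tanh x) = (1 / cosh x)\<^sup>2"
    using tanh_square_plus_sech_square[of x] by (simp add: algebra_simps power2_eq_square inverse_eq_divide)
  then have "sqrt ((1 + tanh x) * (1 - tanh x)) = 1 / cosh x" by simp
  then show ?thesis by (simp only: real_sqrt_mult)
qed

lemma nn_integral_schur_kernel:
  assumes a: "a > 0"
  shows "(\<integral>\<^sup>+z. ennreal (schur_kernel a t z w) \<partial>lborel) = ennreal (4 * pi * cosh (a * t) / a)"
    and "(\<integral>\<^sup>+w. ennreal (schur_kernel a t z w) \<partial>lborel) = ennreal (4 * pi * cosh (a * t) / a)"
proof -
  define A where "A = sqrt (1 + tanh (a * t))"
  define B where "B = sqrt (1 - tanh (a * t))"
  have AB: "A > 0" "B > 0" using tanh_real_bounds[of "a * t"] by (auto simp: A_def B_def)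
  have "A * B = 1 / cosh (a * t)" unfolding A_def B_def by (rule sqrt_tanh_prod)
  then have *: "pi / (a / 4 * A * B) = 4 * pi * cosh (a * t) / a" "pi / (a / 4 * B * A) = 4 * pi * cosh (a * t) / a"
    using a AB by (simp_all add: mult.assoc mult.commute[of B])
  show "(\<integral>\<^sup>+z. ennreal (schur_kernel a t z w) \<partial>lborel) = ennreal (4 * pi * cosh (a * t) / a)"
    unfolding schur_kernel_def A_def[symmetric] B_def[symmetric]
    using nn_integral_gaussian_complex[of "a / 4" A B "B * Re w" "A * Im w"] a AB * by simp
  have "(\<integral>\<^sup>+w. ennreal (schur_kernel a t z w) \<partial>lborel)
      = (\<integral>\<^sup>+w. ennreal (exp (- (a / 4) * ((B * Re w - A * Re z)\<^sup>2 + (A * Im w - B * Im z)\<^sup>2))) \<partial>lborel)"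
    unfolding schur_kernel_def A_def[symmetric] B_def[symmetric]
    by (simp only: power2_commute[of "A * Re z"] power2_commute[of "B * Im z"])
  also have "\<dots> = ennreal (4 * pi * cosh (a * t) / a)"
    using nn_integral_gaussian_complex[of "a / 4" B A "A * Re z" "B * Im z"] a AB * by simp
  finally show "(\<integral>\<^sup>+w. ennreal (schur_kernel a t z w) \<partial>lborel) = ennreal (4 * pi * cosh (a * t) / a)" .
qed

lemma norm_propagator_le_schur_kernel:
  assumes a: "a > 0" and t: "t \<ge> 0"
  shows "cmod (propagator a t z w) * exp (- (a / 4) * (cmod z)\<^sup>2) * exp (- (a / 4) * (cmod w)\<^sup>2)
    \<le> schur_kernel a t z w"
proof -
  define \<tau> where "\<tau> = tanh (a * t)"
  have \<tau>: "- 1 < \<tau>" "\<tau> < 1" using tanh_real_bounds[of "a * t"] by (auto simp: \<tau>_def)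
  define A where "A = sqrt (1 + \<tau>)"
  define B where "B = sqrt (1 - \<tau>)"
  define P where "P = exp (- a * t / 2) / sqrt (cosh (a * t))"
  have AB: "A\<^sup>2 = 1 + \<tau>" "B\<^sup>2 = 1 - \<tau>" using \<tau> by (auto simp: A_def B_def)
  have s: "a / (2 * cosh (a * t)) = a / 2 * (A * B)"
    using sqrt_tanh_prod[of "a * t"] by (simp add: A_def B_def \<tau>_def)
  obtain x y where z: "z = Complex x y" by (cases z)
  obtain u v where w: "w = Complex u v" by (cases w)
  have "a / 4 * \<tau> * Re ((cnj w)\<^sup>2 - z\<^sup>2) + a / 2 * (A * B) * Re (z * cnj w) - a / 4 * (cmod z)\<^sup>2 - a / 4 * (cmod w)\<^sup>2
    = - (a / 4) * ((1 + \<tau>) * x\<^sup>2 + (1 - \<tau>) * u\<^sup>2 - 2 * (A * B) * x * u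
        + ((1 - \<tau>) * y\<^sup>2 + (1 + \<tau>) * v\<^sup>2 - 2 * (A * B) * y * v))"
    unfolding z w cmod_power2 by (simp add: field_simps power2_eq_square)
  also have "\<dots> = - (a / 4) * ((A * x - B * u)\<^sup>2 + (B * y - A * v)\<^sup>2)"
    unfolding AB[symmetric] by (simp add: algebra_simps power2_eq_square)
  finally have e: "a / 4 * \<tau> * Re ((cnj w)\<^sup>2 - z\<^sup>2) + a / 2 * (A * B) * Re (z * cnj w) - a / 4 * (cmod z)\<^sup>2 - a / 4 * (cmod w)\<^sup>2
    = - (a / 4) * ((A * x - B * u)\<^sup>2 + (B * y - A * v)\<^sup>2)" .
  have "cmod (propagator a t z w) * exp (- (a / 4) * (cmod z)\<^sup>2) * exp (- (a / 4) * (cmod w)\<^sup>2)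
      = P * exp (- (a / 4) * ((A * x - B * u)\<^sup>2 + (B * y - A * v)\<^sup>2))"
    unfolding norm_propagator s P_def[symmetric] e[symmetric] \<tau>_def[symmetric] mult.assoc[of P] exp_add[symmetric]
    by (simp add: algebra_simps)
  also have "\<dots> \<le> 1 * exp (- (a / 4) * ((A * x - B * u)\<^sup>2 + (B * y - A * v)\<^sup>2))"
    unfolding P_def by (intro mult_right_mono propagator_prefactor_le_1 a t) simp
  also have "\<dots> = schur_kernel a t z w"
    by (simp add: schur_kernel_def A_def B_def \<tau>_def z w)
  finally show ?thesis .
qed

context heat_flow
begin

lemma flow_fock_space:
  assumes t: "t \<ge> 0"
  shows "flow t \<in> fock_space (a / 2)"
proof -
  define \<phi> where "\<phi> = (\<lambda>w. ennreal (a / (2 * pi)) * ennreal (cmod (V\<^sub>0 w) * exp (- (a / 4) * (cmod w)\<^sup>2)))"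
  have [measurable]: "\<phi> \<in> borel_measurable borel" unfolding \<phi>_def by measurable
  define C where "C = ennreal (4 * pi * cosh (a * t) / a)"
  have hol: "flow t holomorphic_on UNIV" by (rule flow_holomorphic[OF t])
  have [measurable]: "flow t \<in> borel_measurable borel" using hol by (rule entire_measurable)
  have "ennreal ((cmod (flow t z))\<^sup>2 * exp (- (a / 2) * (cmod z)\<^sup>2))
      \<le> (\<integral>\<^sup>+w. ennreal (schur_kernel a t z w) * \<phi> w \<partial>lborel)\<^sup>2" for z
  proof -
    have "ennreal (cmod (flow t z)) \<le> (\<integral>\<^sup>+w. ennreal (cmod (propagator a t z w * V\<^sub>0 w)) \<partial>G)"
      unfolding flow_def by (intro integral_norm_bound_ennreal integrable_propagator t)
    also have "\<dots> = (\<integral>\<^sup>+w. ennreal (a / 2 / pi * exp (- (a / 2) * (cmod w)\<^sup>2))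
        * ennreal (cmod (propagator a t z w * V\<^sub>0 w)) \<partial>lborel)"
      unfolding gaussian_measure_def by (subst nn_integral_density) simp_all
    finally have 1: "ennreal (cmod (flow t z)) \<le> \<dots>" .
    have "ennreal (cmod (flow t z) * exp (- (a / 4) * (cmod z)\<^sup>2))
      \<le> (\<integral>\<^sup>+w. ennreal (a / 2 / pi * exp (- (a / 2) * (cmod w)\<^sup>2))
        * ennreal (cmod (propagator a t z w * V\<^sub>0 w)) \<partial>lborel) * ennreal (exp (- (a / 4) * (cmod z)\<^sup>2))"
      using mult_right_mono[OF 1, of "ennreal (exp (- (a / 4) * (cmod z)\<^sup>2))"] by (simp add: ennreal_mult)
    also have "\<dots> = (\<integral>\<^sup>+w. ennreal (a / 2 / pi * exp (- (a / 2) * (cmod w)\<^sup>2))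
        * ennreal (cmod (propagator a t z w * V\<^sub>0 w)) * ennreal (exp (- (a / 4) * (cmod z)\<^sup>2)) \<partial>lborel)"
      by (rule nn_integral_multc[symmetric]) measurable
    also have "\<dots> \<le> (\<integral>\<^sup>+w. ennreal (schur_kernel a t z w) * \<phi> w \<partial>lborel)"
    proof (rule nn_integral_mono)
      fix w
      have split: "exp (- (a / 2) * (cmod w)\<^sup>2) = exp (- (a / 4) * (cmod w)\<^sup>2) * exp (- (a / 4) * (cmod w)\<^sup>2)"
        by (simp add: exp_add[symmetric])
      have "a / 2 / pi * exp (- (a / 2) * (cmod w)\<^sup>2) * cmod (propagator a t z w * V\<^sub>0 w) * exp (- (a / 4) * (cmod z)\<^sup>2)
        = (cmod (propagator a t z w) * exp (- (a / 4) * (cmod z)\<^sup>2) * exp (- (a / 4) * (cmod w)\<^sup>2))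
           * (a / (2 * pi) * (cmod (V\<^sub>0 w) * exp (- (a / 4) * (cmod w)\<^sup>2)))"
        unfolding split norm_mult by (simp add: mult_ac)
      also have "\<dots> \<le> schur_kernel a t z w * (a / (2 * pi) * (cmod (V\<^sub>0 w) * exp (- (a / 4) * (cmod w)\<^sup>2)))"
        using a by (intro mult_right_mono norm_propagator_le_schur_kernel t) auto
      finally show "ennreal (a / 2 / pi * exp (- (a / 2) * (cmod w)\<^sup>2))
        * ennreal (cmod (propagator a t z w * V\<^sub>0 w)) * ennreal (exp (- (a / 4) * (cmod z)\<^sup>2))
        \<le> ennreal (schur_kernel a t z w) * \<phi> w"
        using a unfolding \<phi>_def
        by (simp add: ennreal_mult[symmetric] schur_kernel_def ennreal_leI)
    qed
    finally have "(ennreal (cmod (flow t z) * exp (- (a / 4) * (cmod z)\<^sup>2)))\<^sup>2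
        \<le> (\<integral>\<^sup>+w. ennreal (schur_kernel a t z w) * \<phi> w \<partial>lborel)\<^sup>2"
      by (rule power_mono) simp
    moreover have "(ennreal (cmod (flow t z) * exp (- (a / 4) * (cmod z)\<^sup>2)))\<^sup>2
        = ennreal ((cmod (flow t z))\<^sup>2 * exp (- (a / 2) * (cmod z)\<^sup>2))"
      by (simp add: ennreal_power power_mult_distrib power2_eq_square[of "exp _"] exp_add[symmetric])
    ultimately show ?thesis by simp
  qed
  then have "(\<integral>\<^sup>+z. ennreal ((cmod (flow t z))\<^sup>2 * exp (- (a / 2) * (cmod z)\<^sup>2)) \<partial>lborel)
      \<le> (\<integral>\<^sup>+z. (\<integral>\<^sup>+w. ennreal (schur_kernel a t z w) * \<phi> w \<partial>lborel)\<^sup>2 \<partial>lborel)"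
    by (intro nn_integral_mono) simp
  also have "\<dots> \<le> C * C * (\<integral>\<^sup>+w. (\<phi> w)\<^sup>2 \<partial>lborel)"
  proof (rule schur_test)
    show "(\<lambda>(z, w). schur_kernel a t z w) \<in> borel_measurable (lborel \<Otimes>\<^sub>M lborel)"
      unfolding schur_kernel_def by measurable
  qed (simp_all add: schur_kernel_def[symmetric] nn_integral_schur_kernel a C_def, simp add: schur_kernel_def)
  also have "\<dots> < \<infinity>"
  proof -
    have "integrable lborel (\<lambda>w. (cmod (V\<^sub>0 w))\<^sup>2 * exp (- (a / 2) * (cmod w)\<^sup>2))"
      using V0 a by (simp add: fock_space_iff)
    then have "(\<integral>\<^sup>+w. ennreal ((cmod (V\<^sub>0 w))\<^sup>2 * exp (- (a / 2) * (cmod w)\<^sup>2)) \<partial>lborel) < \<infinity>"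
      by (subst (asm) integrable_iff_bounded) simp
    moreover have "(\<phi> w)\<^sup>2 = (ennreal (a / (2 * pi)))\<^sup>2 * ennreal ((cmod (V\<^sub>0 w))\<^sup>2 * exp (- (a / 2) * (cmod w)\<^sup>2))" for w
      unfolding \<phi>_def power_mult_distrib[of "ennreal _"]
      by (simp add: ennreal_power power_mult_distrib power2_eq_square[of "exp _"] exp_add[symmetric])
    ultimately show ?thesis
      using a by (simp add: nn_integral_cmult ennreal_mult_less_top C_def ennreal_power)
  qed
  finally have "integrable lborel (\<lambda>z. (cmod (flow t z))\<^sup>2 * exp (- (a / 2) * (cmod z)\<^sup>2))"
    by (intro integrableI_bounded) simp_all
  then show ?thesis using hol a by (simp add: fock_space_iff)
qed

lemma heat_solution_flow: "heat_solution a V\<^sub>0 flow"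
  unfolding heat_solution_def
  using flow_fock_space flow_continuous flow_equation flow_0 by blast

end

section \<open>Uniqueness\<close>

text \<open>
  Call a time good if \<open>F\<close> is bounded near it. By compactness \<open>F\<close> is constant on intervals of good
  times, and then also up to an endpoint that is not good, as \<open>F\<close> is finite there. If the closed set \<open>E\<close> of bad times
  were nonempty, Baire's theorem on \<open>E\<close> would give a bad \<open>p\<close> near which \<open>F\<close> is bounded on \<open>E\<close>; each good
  time near \<open>p\<close> shares its value with the next bad time in the direction of \<open>p\<close>, so \<open>F\<close> would be bounded near \<open>p\<close>.
\<close>

lemma constant_if_constant_where_bounded:
  fixes F :: "real \<Rightarrow> real"
  assumes T: "0 \<le> T"
    and lsc: "\<And>N. closed {t \<in> {0..T}. F t \<le> N}"
    and const: "\<And>s t B. 0 \<le> s \<Longrightarrow> s \<le> t \<Longrightarrow> t \<le> T \<Longrightarrow> (\<And>r. r \<in> {s..t} \<Longrightarrow> F r \<le> B) \<Longrightarrow> F s = F t"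
  shows "F 0 = F T"
proof -
  define good where "good = (\<lambda>t. \<exists>\<delta>>0. \<exists>B. \<forall>r\<in>{0..T}. \<bar>r - t\<bar> < \<delta> \<longrightarrow> F r \<le> B)"
  define E where "E = {0..T} - {t. good t}"
  have "open {t. good t}"
    unfolding open_dist dist_real_def
  proof (intro ballI)
    fix t assume "t \<in> {t. good t}"
    then obtain \<delta> B where d: "\<delta> > 0" "\<forall>r\<in>{0..T}. \<bar>r - t\<bar> < \<delta> \<longrightarrow> F r \<le> B" by (auto simp: good_def)
    have "good y" if "\<bar>y - t\<bar> < \<delta> / 2" for y
      unfolding good_def
    proof (intro exI conjI ballI impI)
      show "\<delta> / 2 > 0" using d by simp
      fix r assume r: "r \<in> {0..T}" "\<bar>r - y\<bar> < \<delta> / 2"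
      then have "\<bar>r - t\<bar> < \<delta>" using that by arith
      then show "F r \<le> B" using d(2) r(1) by blast
    qed
    moreover have "\<delta> / 2 > 0" using d by simp
    ultimately show "\<exists>e>0. \<forall>y. \<bar>y - t\<bar> < e \<longrightarrow> y \<in> {t. good t}" by blast
  qed
  then have E: "closed E" unfolding E_def by (intro closed_Diff) auto
  have good_const: "F s = F t"
    if st: "0 \<le> s" "s \<le> t" "t \<le> T" and g: "\<And>r. s \<le> r \<Longrightarrow> r \<le> t \<Longrightarrow> good r" for s t
  proof -
    have "\<exists>B. \<forall>r\<in>{s..t} \<inter> {0..T}. F r \<le> B"
    proof (rule Bolzano[OF st(2)])
      fix u v w assume "\<exists>B. \<forall>r\<in>{u..v} \<inter> {0..T}. F r \<le> B" "\<exists>B. \<forall>r\<in>{v..w} \<inter> {0..T}. F r \<le> B"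
      then obtain B B' where B: "\<forall>r\<in>{u..v} \<inter> {0..T}. F r \<le> B" "\<forall>r\<in>{v..w} \<inter> {0..T}. F r \<le> B'" by blast
      have "F r \<le> max B B'" if "r \<in> {u..w} \<inter> {0..T}" for r
        using B that by (cases "r \<le> v") (auto simp: le_max_iff_disj)
      then show "\<exists>B. \<forall>r\<in>{u..w} \<inter> {0..T}. F r \<le> B" by blast
    next
      fix x assume "s \<le> x" "x \<le> t"
      then obtain \<delta> B where d: "\<delta> > 0" "\<forall>r\<in>{0..T}. \<bar>r - x\<bar> < \<delta> \<longrightarrow> F r \<le> B"
        using g[of x] by (auto simp: good_def)
      have "\<exists>B. \<forall>r\<in>{u..v} \<inter> {0..T}. F r \<le> B" if "u \<le> x \<and> x \<le> v \<and> v - u < \<delta>" for u v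
        using d(2) that by (intro exI[of _ B]) auto
      then show "\<exists>d>0. \<forall>u v. u \<le> x \<and> x \<le> v \<and> v - u < d \<longrightarrow> (\<exists>B. \<forall>r\<in>{u..v} \<inter> {0..T}. F r \<le> B)"
        using d(1) by blast
    qed
    then obtain B where B: "\<forall>r\<in>{s..t} \<inter> {0..T}. F r \<le> B" by blast
    show ?thesis by (rule const[OF st, of B]) (use B st in auto)
  qed
  have left: "F t = F c" if "0 \<le> t" "t < c" "c \<le> T" and g: "\<And>r. t \<le> r \<Longrightarrow> r < c \<Longrightarrow> good r" for t c
  proof (rule const[where B = "max (F t) (F c)"])
    fix r assume r: "r \<in> {t..c}"
    show "F r \<le> max (F t) (F c)"
    proof (cases "r = c")
      case False
      then have "F t = F r" using r that by (intro good_const) auto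
      then show ?thesis by simp
    qed simp
  qed (use that in auto)
  have right: "F c = F t" if "0 \<le> c" "c < t" "t \<le> T" and g: "\<And>r. c < r \<Longrightarrow> r \<le> t \<Longrightarrow> good r" for t c
  proof (rule const[where B = "max (F t) (F c)"])
    fix r assume r: "r \<in> {c..t}"
    show "F r \<le> max (F t) (F c)"
    proof (cases "r = c")
      case False
      then have "F r = F t" using r that by (intro good_const) auto
      then show ?thesis by simp
    qed simp
  qed (use that in auto)
  have "E = {}"
  proof (rule ccontr)
    assume ne: "E \<noteq> {}"
    define U where "U = (\<lambda>n::nat. {t \<in> E. \<not> F t \<le> real n})"
    have opn: "openin (top_of_set E) (U n)" for n
    proof -
      have "U n = E \<inter> - {t \<in> {0..T}. F t \<le> real n}" by (auto simp: U_def E_def)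
      then show ?thesis using lsc[of "real n"] by (auto simp: openin_open open_Compl)
    qed
    have empty: "\<Inter> (range U) = {}"
    proof -
      have "\<exists>n. F t \<le> real n" for t by (rule real_arch_simple)
      then show ?thesis unfolding U_def by fastforce
    qed
    have "\<exists>n. \<not> E \<subseteq> closure (U n)"
    proof (rule ccontr)
      assume "\<not> (\<exists>n. \<not> E \<subseteq> closure (U n))"
      then have "E \<subseteq> closure (\<Inter> (range U))"
        using opn by (intro Baire[OF E]) auto
      then show False using ne empty by simp
    qed
    then obtain n p where p: "p \<in> E" "p \<notin> closure (U n)" by blast
    then obtain \<delta> where \<delta>: "\<delta> > 0" "\<forall>r\<in>U n. \<not> \<bar>r - p\<bar> < \<delta>"
      unfolding closure_approachable dist_real_def by blast
    have bnd: "F r \<le> real n" if "r \<in> E" "\<bar>r - p\<bar> < \<delta>" for r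
      using \<delta>(2) that unfolding U_def by blast
    have "F r \<le> real n" if r: "r \<in> {0..T}" "\<bar>r - p\<bar> < \<delta>" for r
    proof (cases "r \<in> E")
      case True
      then show ?thesis using bnd r by blast
    next
      case False
      have pT: "0 \<le> p" "p \<le> T" using p by (auto simp: E_def)
      have "r \<noteq> p" using False p by auto
      then consider "r < p" | "p < r" by linarith
      then show ?thesis
      proof cases
        case 1
        define c where "c = Inf (E \<inter> {r..})"
        have c: "c \<in> E \<inter> {r..}" unfolding c_def
          using p 1 E by (intro closed_contains_Inf closed_Int) auto
        have cp: "c \<le> p" unfolding c_def using p 1 by (intro cInf_lower) auto
        have "r < c" using c False by (cases "r = c") auto
        moreover have "good x" if "r \<le> x" "x < c" for x
        proof (rule ccontr)
          assume "\<not> good x"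
          then have "x \<in> E \<inter> {r..}" using that r cp pT by (auto simp: E_def)
          then have "c \<le> x" unfolding c_def by (intro cInf_lower) auto
          then show False using that by simp
        qed
        ultimately have "F r = F c" using r cp pT by (intro left) auto
        also have "\<dots> \<le> real n" using c cp r by (intro bnd) auto
        finally show ?thesis .
      next
        case 2
        define c where "c = Sup (E \<inter> {..r})"
        have c: "c \<in> E \<inter> {..r}" unfolding c_def
          using p 2 E by (intro closed_contains_Sup closed_Int) auto
        have cp: "p \<le> c" unfolding c_def using p 2 by (intro cSup_upper) auto
        have "c < r" using c False by (cases "r = c") auto
        moreover have "good x" if "c < x" "x \<le> r" for x
        proof (rule ccontr)
          assume "\<not> good x"
          then have "x \<in> E \<inter> {..r}" using that r cp pT by (auto simp: E_def)
          then have "x \<le> c" unfolding c_def by (intro cSup_upper) auto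
          then show False using that by simp
        qed
        ultimately have "F c = F r" using r cp pT by (intro right) auto
        moreover have "F c \<le> real n" using c cp r by (intro bnd) auto
        ultimately show ?thesis by simp
      qed
    qed
    then have "good p" unfolding good_def using \<delta>(1) by blast
    then show False using p by (simp add: E_def)
  qed
  then show ?thesis using T by (intro good_const) (auto simp: E_def)
qed

text \<open>
  A Fock-space-valued solution of the equation without the constant term \<open>- \<alpha>\<close>. There is no
  assumption on the norms of the slices as functions of time.
\<close>

locale energy =
  fixes \<alpha> :: real and W :: "real \<Rightarrow> complex \<Rightarrow> complex"
  assumes \<alpha>: "\<alpha> > 0"
    and fock: "\<And>t. t \<ge> 0 \<Longrightarrow> W t \<in> fock_space \<alpha>"
    and cont: "continuous_on ({0..} \<times> UNIV) (\<lambda>(t, z). W t z)"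
    and eqn: "\<And>t z. t > 0 \<Longrightarrow>
      ((\<lambda>s. W s z) has_vector_derivative deriv (deriv (W t)) z - of_real \<alpha> ^ 2 * z\<^sup>2 * W t z) (at t)"
begin

text \<open>
  The squared norm of \<open>W t\<close> in the Fock space, up to the constant factor \<open>\<alpha> / pi\<close>.
\<close>

definition energy :: "real \<Rightarrow> real" where
  "energy t = (\<integral>z. (cmod (W t z))\<^sup>2 * exp (- \<alpha> * (cmod z)\<^sup>2) \<partial>lborel)"

lemma W_holomorphic: "t \<ge> 0 \<Longrightarrow> W t holomorphic_on UNIV"
  using fock by (auto simp: fock_space_def)

lemma W_measurable: "t \<ge> 0 \<Longrightarrow> W t \<in> borel_measurable borel"
  by (intro entire_measurable W_holomorphic)

lemma W_integrable:
  "t \<ge> 0 \<Longrightarrow> integrable lborel (\<lambda>z. (cmod (W t z))\<^sup>2 * exp (- \<alpha> * (cmod z)\<^sup>2))"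
  using fock \<alpha> by (simp add: fock_space_iff)

lemma energy_nonneg: "energy t \<ge> 0"
  unfolding energy_def by (intro integral_nonneg_AE) simp

lemma W_pointwise:
  assumes "t \<ge> 0" "energy t \<le> B"
  shows "cmod (W t z) \<le> sqrt (\<alpha> / pi * B) * exp (\<alpha> / 2 * (cmod z)\<^sup>2)"
proof -
  have "(cmod (W t z))\<^sup>2 \<le> exp (\<alpha> * (cmod z)\<^sup>2) * (\<alpha> / pi) * energy t"
    unfolding energy_def by (intro fock_space_pointwise W_holomorphic W_integrable \<alpha> assms)
  also have "\<dots> \<le> exp (\<alpha> * (cmod z)\<^sup>2) * (\<alpha> / pi) * B"
    using assms \<alpha> by (intro mult_left_mono) auto
  also have "\<dots> = (sqrt (\<alpha> / pi * B) * exp (\<alpha> / 2 * (cmod z)\<^sup>2))\<^sup>2"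
  proof -
    have "0 \<le> \<alpha> / pi * B" using assms energy_nonneg[of t] \<alpha> by simp
    then have "(sqrt (\<alpha> / pi * B))\<^sup>2 = \<alpha> / pi * B" by simp
    moreover have "(exp (\<alpha> / 2 * (cmod z)\<^sup>2))\<^sup>2 = exp (\<alpha> * (cmod z)\<^sup>2)"
      by (simp add: power2_eq_square[of "exp _"] exp_add[symmetric])
    ultimately show ?thesis unfolding power_mult_distrib by simp
  qed
  finally show ?thesis
    by (rule power2_le_imp_le) (use assms energy_nonneg[of t] \<alpha> in simp)
qed

lemma W_continuous:
  assumes "\<And>n. x n \<ge> 0" "x \<longlonglongrightarrow> t" "t \<ge> 0"
  shows "(\<lambda>n. W (x n) z) \<longlonglongrightarrow> W t z"
proof -
  have "(\<lambda>n. (x n, z)) \<longlonglongrightarrow> (t, z)" using assms by (intro tendsto_intros)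
  then have "((\<lambda>(t, z). W t z) \<circ> (\<lambda>n. (x n, z))) \<longlonglongrightarrow> W t z"
    using cont[unfolded continuous_on_sequentially, rule_format, of "(t, z)" "\<lambda>n. (x n, z)"] assms by auto
  then show ?thesis by (simp add: o_def)
qed

text \<open>
  Lower semicontinuity of the energy, by Fatou's lemma.
\<close>

lemma energy_lsc: "closed {t \<in> {0..T}. energy t \<le> N}"
  unfolding closed_sequential_limits
proof (intro allI impI, elim conjE)
  fix x :: "nat \<Rightarrow> real" and t
  assume x: "\<forall>n. x n \<in> {t \<in> {0..T}. energy t \<le> N}" and lim: "x \<longlonglongrightarrow> t"
  have t: "t \<in> {0..T}"
    by (rule closed_sequentially[OF closed_atLeastAtMost _ lim]) (use x in auto)
  have en: "(\<integral>\<^sup>+z. ennreal ((cmod (W r z))\<^sup>2 * exp (- \<alpha> * (cmod z)\<^sup>2)) \<partial>lborel) = ennreal (energy r)" if "r \<ge> 0" for r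
    unfolding energy_def by (intro nn_integral_eq_integral W_integrable that) simp
  have "ennreal (energy t) = (\<integral>\<^sup>+z. liminf (\<lambda>n. ennreal ((cmod (W (x n) z))\<^sup>2 * exp (- \<alpha> * (cmod z)\<^sup>2))) \<partial>lborel)"
  proof (subst en[symmetric])
    show "(\<integral>\<^sup>+z. ennreal ((cmod (W t z))\<^sup>2 * exp (- \<alpha> * (cmod z)\<^sup>2)) \<partial>lborel) =
      (\<integral>\<^sup>+z. liminf (\<lambda>n. ennreal ((cmod (W (x n) z))\<^sup>2 * exp (- \<alpha> * (cmod z)\<^sup>2))) \<partial>lborel)"
    proof (intro nn_integral_cong lim_imp_Liminf[symmetric] tendsto_ennrealI tendsto_intros)
      show "(\<lambda>n. W (x n) z) \<longlonglongrightarrow> W t z" for z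
        using x t lim by (intro W_continuous) auto
    qed simp
  qed (use t in simp)
  also have "\<dots> \<le> liminf (\<lambda>n. \<integral>\<^sup>+z. ennreal ((cmod (W (x n) z))\<^sup>2 * exp (- \<alpha> * (cmod z)\<^sup>2)) \<partial>lborel)"
  proof (rule nn_integral_liminf)
    fix n
    have [measurable]: "W (x n) \<in> borel_measurable borel" using x by (intro W_measurable) auto
    show "(\<lambda>z. ennreal ((cmod (W (x n) z))\<^sup>2 * exp (- \<alpha> * (cmod z)\<^sup>2))) \<in> borel_measurable lborel" by measurable
  qed
  also have "\<dots> = liminf (\<lambda>n. ennreal (energy (x n)))"
  proof -
    have "(\<integral>\<^sup>+z. ennreal ((cmod (W (x n) z))\<^sup>2 * exp (- \<alpha> * (cmod z)\<^sup>2)) \<partial>lborel) = ennreal (energy (x n))" for n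
      by (rule en) (use x in auto)
    then show ?thesis by (simp only:)
  qed
  also have "\<dots> \<le> liminf (\<lambda>n. ennreal N)"
    using x by (intro Liminf_mono always_eventually) (auto intro: ennreal_leI)
  also have "\<dots> = ennreal N" by (simp add: Liminf_const)
  finally have "energy t \<le> N"
    using x[rule_format, of 0] energy_nonneg[of "x 0"] by (subst (asm) ennreal_le_iff) auto
  then show "t \<in> {t \<in> {0..T}. energy t \<le> N}" using t by simp
qed

lemma W_growth:
  assumes "t \<ge> 0"
  shows "growth (\<alpha> / 2) (W t)"
  by (rule growthI[where B = 0]) (use W_pointwise[OF assms order_refl] in simp)

text \<open>
  Two applications of Cauchy's estimate, each of which enlarges the radius by \<open>1\<close>.
\<close>

lemma W_deriv2_bound:
  assumes t: "t \<ge> 0" "energy t \<le> B"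
  shows "cmod (deriv (deriv (W t)) z) \<le> sqrt (\<alpha> / pi * B) * exp (\<alpha> / 2 * (cmod z + 2)\<^sup>2)"
proof (rule norm_deriv_le)
  show "deriv (W t) holomorphic_on UNIV"
    by (intro holomorphic_deriv W_holomorphic t) simp
  fix w assume w: "cmod w \<le> cmod z + 1"
  show "cmod (deriv (W t) w) \<le> sqrt (\<alpha> / pi * B) * exp (\<alpha> / 2 * (cmod z + 2)\<^sup>2)"
  proof (rule norm_deriv_le)
    show "W t holomorphic_on UNIV" by (rule W_holomorphic[OF t(1)])
    fix v assume "cmod v \<le> cmod w + 1"
    then have "(cmod v)\<^sup>2 \<le> (cmod z + 2)\<^sup>2" using w by (intro power_mono) auto
    then have "exp (\<alpha> / 2 * (cmod v)\<^sup>2) \<le> exp (\<alpha> / 2 * (cmod z + 2)\<^sup>2)"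
      using \<alpha> by simp
    moreover have "0 \<le> sqrt (\<alpha> / pi * B)" using \<alpha> t energy_nonneg[of t] by simp
    ultimately have "sqrt (\<alpha> / pi * B) * exp (\<alpha> / 2 * (cmod v)\<^sup>2)
        \<le> sqrt (\<alpha> / pi * B) * exp (\<alpha> / 2 * (cmod z + 2)\<^sup>2)" by (rule mult_left_mono)
    with W_pointwise[OF t, of v]
    show "cmod (W t v) \<le> sqrt (\<alpha> / pi * B) * exp (\<alpha> / 2 * (cmod z + 2)\<^sup>2)" by (rule order_trans)
  qed
qed

text \<open>
  The energy with a stronger weight (\<open>\<beta> > \<alpha>\<close>), and its time derivative.
\<close>

definition damped_energy :: "real \<Rightarrow> real \<Rightarrow> real" where
  "damped_energy \<beta> t = (\<integral>z. (cmod (W t z))\<^sup>2 * exp (- \<beta> * (cmod z)\<^sup>2) \<partial>lborel)"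

definition energy_rate :: "real \<Rightarrow> real \<Rightarrow> real" where
  "energy_rate \<beta> t = 2 * (\<beta>\<^sup>2 - \<alpha>\<^sup>2) * (\<integral>z. Re (z\<^sup>2) * (cmod (W t z))\<^sup>2 * exp (- \<beta> * (cmod z)\<^sup>2) \<partial>lborel)"

lemma norm_sq_integrand:
  assumes "\<And>r. r \<in> {s..t} \<Longrightarrow> energy r \<le> B" "0 \<le> s" "r \<in> {s..t}"
  shows "(cmod (W r z))\<^sup>2 * exp (- \<beta> * (cmod z)\<^sup>2) \<le> \<alpha> / pi * B * exp (- (\<beta> - \<alpha>) * (cmod z)\<^sup>2 + 0 * cmod z)"
proof -
  have r: "r \<ge> 0" "energy r \<le> B" using assms by auto
  have nn: "0 \<le> \<alpha> / pi * B" using \<alpha> r energy_nonneg[of r] by simp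
  have "(cmod (W r z))\<^sup>2 \<le> (sqrt (\<alpha> / pi * B) * exp (\<alpha> / 2 * (cmod z)\<^sup>2))\<^sup>2"
    using W_pointwise[OF r, of z] by (intro power_mono) auto
  also have "\<dots> = \<alpha> / pi * B * exp (\<alpha> * (cmod z)\<^sup>2)"
    unfolding power_mult_distrib real_sqrt_pow2[OF nn]
    by (simp add: power2_eq_square[of "exp _"] exp_add[symmetric])
  finally have "(cmod (W r z))\<^sup>2 * exp (- \<beta> * (cmod z)\<^sup>2)
      \<le> \<alpha> / pi * B * exp (\<alpha> * (cmod z)\<^sup>2) * exp (- \<beta> * (cmod z)\<^sup>2)"
    by (rule mult_right_mono) simp
  then show ?thesis by (simp add: mult.assoc exp_add[symmetric] algebra_simps)
qed

lemma integrable_damped: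
  assumes "\<beta> > \<alpha>" "t \<ge> 0"
  shows "integrable lborel (\<lambda>z. (cmod (W t z))\<^sup>2 * exp (- \<beta> * (cmod z)\<^sup>2))"
proof (rule Bochner_Integration.integrable_bound[OF W_integrable[OF assms(2)]])
  have [measurable]: "W t \<in> borel_measurable borel" by (rule W_measurable[OF assms(2)])
  show "(\<lambda>z. (cmod (W t z))\<^sup>2 * exp (- \<beta> * (cmod z)\<^sup>2)) \<in> borel_measurable lborel" by measurable
  have "- \<beta> * (cmod z)\<^sup>2 \<le> - \<alpha> * (cmod z)\<^sup>2" for z :: complex
    using assms by (intro mult_right_mono) auto
  then show "AE z in lborel. norm ((cmod (W t z))\<^sup>2 * exp (- \<beta> * (cmod z)\<^sup>2))
      \<le> norm ((cmod (W t z))\<^sup>2 * exp (- \<alpha> * (cmod z)\<^sup>2))"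
    by (intro AE_I2) (simp add: abs_mult mult_left_mono)
qed

text \<open>
  Differentiating under the integral gives \<open>2 Re (\<langle>W'', W\<rangle> - \<alpha>\<^sup>2 \<langle>z\<^sup>2 W, W\<rangle>)\<close> in the inner product
  with weight \<open>exp (- \<beta> |z|\<^sup>2)\<close>; two applications of \<open>gaussian_adjoint\<close> replace \<open>\<langle>W'', W\<rangle>\<close> by
  \<open>\<beta>\<^sup>2 \<langle>W, z\<^sup>2 W\<rangle>\<close>.
\<close>

lemma damped_energy_deriv:
  assumes \<beta>: "\<beta> > \<alpha>" and st: "0 \<le> s" and bnd: "\<And>r. r \<in> {s..t} \<Longrightarrow> energy r \<le> B" and r: "r \<in> {s<..<t}"
  shows "(damped_energy \<beta> has_vector_derivative energy_rate \<beta> r) (at r)"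
proof -
  define e where "e = (\<lambda>z::complex. exp (- \<beta> * (cmod z)\<^sup>2))"
  define A where "A = (\<lambda>r z. (deriv (deriv (W r)) z - of_real \<alpha> ^ 2 * z\<^sup>2 * W r z) * cnj (W r z))"
  define M where "M = sqrt (\<alpha> / pi * B)"
  have M: "M \<ge> 0" using \<alpha> bnd[of r] energy_nonneg[of r] r by (simp add: M_def)
  have r0: "r > 0" "r \<ge> 0" using r st by auto
  note hol = W_holomorphic[OF r0(2)]
  have hol1: "deriv (W r) holomorphic_on UNIV" by (intro holomorphic_deriv hol) simp
  have hol2: "deriv (deriv (W r)) holomorphic_on UNIV" by (intro holomorphic_deriv hol1) simp
  have [measurable]: "W r \<in> borel_measurable borel" "deriv (W r) \<in> borel_measurable borel"
    "deriv (deriv (W r)) \<in> borel_measurable borel" using hol hol1 hol2 by (auto intro: entire_measurable)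
  have [measurable]: "cnj \<in> borel_measurable borel"
    by (intro borel_measurable_continuous_onI continuous_intros)
  have gr: "growth (\<alpha> / 2) (W r)" by (rule W_growth[OF r0(2)])
  have gr1: "growth (\<alpha> / 2) (deriv (W r))" using \<alpha> by (intro growth_deriv gr hol) simp
  have gr2: "growth (\<alpha> / 2) (deriv (deriv (W r)))" using \<alpha> by (intro growth_deriv gr1 hol1) simp
  have grz: "growth (\<alpha> / 2) (\<lambda>z. z * W r z)" "growth (\<alpha> / 2) (\<lambda>z. z * (z * W r z))"
    by (intro growth_mult_ident gr)+
  have damped: "damped_energy \<beta> = (\<lambda>r. \<integral>z. (cmod (W r z))\<^sup>2 * e z \<partial>lborel)"
    by (simp add: damped_energy_def e_def fun_eq_iff)
  have "(damped_energy \<beta> has_vector_derivative (\<integral>z. 2 * Re (A r z) * e z \<partial>lborel)) (at r)"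
    unfolding damped
  proof (rule has_vector_derivative_integral[where S = "{s<..<t}" and
        f = "\<lambda>r z. (cmod (W r z))\<^sup>2 * e z" and f' = "\<lambda>r z. 2 * Re (A r z) * e z" and
        g = "\<lambda>z. 2 * M\<^sup>2 * (exp (2 * \<alpha>) + \<alpha>\<^sup>2) * exp (- (\<beta> - \<alpha>) * (cmod z)\<^sup>2 + (2 * \<alpha> + 2) * cmod z)"])
    show "integrable lborel (\<lambda>z::complex. 2 * M\<^sup>2 * (exp (2 * \<alpha>) + \<alpha>\<^sup>2) *
        exp (- (\<beta> - \<alpha>) * (cmod z)\<^sup>2 + (2 * \<alpha> + 2) * cmod z))"
      using \<beta> by (intro integrable_mult_right integrable_exp_quadratic) simp
    show "(\<lambda>z. 2 * Re (A r z) * e z) \<in> borel_measurable lborel"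
      unfolding A_def e_def by measurable
    show "integrable lborel (\<lambda>z. (cmod (W x z))\<^sup>2 * e z)" if "x \<in> {s<..<t}" for x
      unfolding e_def using that st by (intro integrable_damped \<beta>) auto
    fix x :: real and z :: complex assume "x \<in> {s<..<t}"
    then have x: "x > 0" "x \<ge> 0" "energy x \<le> B" using st bnd[of x] by auto
    let ?W' = "deriv (deriv (W x)) z - of_real \<alpha> ^ 2 * z\<^sup>2 * W x z"
    have "((\<lambda>x. W x z * cnj (W x z)) has_vector_derivative W x z * cnj ?W' + ?W' * cnj (W x z)) (at x)"
      by (intro has_vector_derivative_mult has_vector_derivative_cnj eqn x)
    note * = bounded_linear.has_vector_derivative[OF bounded_linear_Re this]
    have "((\<lambda>x. (cmod (W x z))\<^sup>2) has_vector_derivative 2 * Re (A x z)) (at x)"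
    proof -
      have "Re (w * cnj w) = (cmod w)\<^sup>2" "Re (w * cnj d + d * cnj w) = 2 * Re (d * cnj w)" for w d
        unfolding cmod_power2 by (simp_all add: power2_eq_square)
      with * show ?thesis unfolding A_def by (simp only:)
    qed
    then show "((\<lambda>x. (cmod (W x z))\<^sup>2 * e z) has_vector_derivative 2 * Re (A x z) * e z) (at x)"
      by (rule has_vector_derivative_mult_left)
    have "cmod z \<le> exp (cmod z)" using exp_gt_self[of "cmod z"] by simp
    then have "(cmod z)\<^sup>2 \<le> (exp (cmod z))\<^sup>2" by (intro power_mono) auto
    then have z2: "(cmod z)\<^sup>2 \<le> exp (2 * cmod z)"
      by (simp add: power2_eq_square[of "exp _"] exp_add[symmetric])
    have "cmod ?W' \<le> cmod (deriv (deriv (W x)) z) + \<alpha>\<^sup>2 * (cmod z)\<^sup>2 * cmod (W x z)"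
      using norm_triangle_ineq4[of "deriv (deriv (W x)) z" "of_real \<alpha> ^ 2 * z\<^sup>2 * W x z"]
      by (simp add: norm_mult norm_power)
    also have "\<dots> \<le> M * exp (\<alpha> / 2 * (cmod z + 2)\<^sup>2) + \<alpha>\<^sup>2 * exp (2 * cmod z) * (M * exp (\<alpha> / 2 * (cmod z)\<^sup>2))"
      unfolding M_def
      using z2 by (intro add_mono W_deriv2_bound x mult_mono W_pointwise) auto
    also have "\<dots> = M * (exp (2 * \<alpha>) * exp (2 * \<alpha> * cmod z) + \<alpha>\<^sup>2 * exp (2 * cmod z)) * exp (\<alpha> / 2 * (cmod z)\<^sup>2)"
      by (simp add: power2_eq_square[of "cmod z + 2"] power2_eq_square[of "cmod z"] exp_add[symmetric] algebra_simps)
    also have "\<dots> \<le> M * (exp (2 * \<alpha>) * exp ((2 * \<alpha> + 2) * cmod z) + \<alpha>\<^sup>2 * exp ((2 * \<alpha> + 2) * cmod z)) * exp (\<alpha> / 2 * (cmod z)\<^sup>2)"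
      using M \<alpha> by (intro mult_right_mono mult_left_mono add_mono) (auto intro: mult_right_mono)
    finally have W': "cmod ?W' \<le> M * ((exp (2 * \<alpha>) + \<alpha>\<^sup>2) * exp ((2 * \<alpha> + 2) * cmod z)) * exp (\<alpha> / 2 * (cmod z)\<^sup>2)"
      by (simp add: distrib_right)
    have "\<bar>Re (A x z)\<bar> \<le> cmod ?W' * cmod (W x z)"
      using abs_Re_le_cmod[of "A x z"] by (simp add: A_def norm_mult)
    also have "\<dots> \<le> (M * ((exp (2 * \<alpha>) + \<alpha>\<^sup>2) * exp ((2 * \<alpha> + 2) * cmod z)) * exp (\<alpha> / 2 * (cmod z)\<^sup>2))
        * (M * exp (\<alpha> / 2 * (cmod z)\<^sup>2))"
      using W' W_pointwise[OF x(2,3), of z] M unfolding M_def[symmetric] by (intro mult_mono) auto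
    finally have "2 * \<bar>Re (A x z)\<bar> * e z \<le> 2 * ((M * ((exp (2 * \<alpha>) + \<alpha>\<^sup>2) * exp ((2 * \<alpha> + 2) * cmod z)) * exp (\<alpha> / 2 * (cmod z)\<^sup>2))
        * (M * exp (\<alpha> / 2 * (cmod z)\<^sup>2))) * e z"
      by (intro mult_right_mono mult_left_mono) (auto simp: e_def)
    also have "\<dots> = 2 * M\<^sup>2 * (exp (2 * \<alpha>) + \<alpha>\<^sup>2) * (exp ((2 * \<alpha> + 2) * cmod z) * (exp (\<alpha> / 2 * (cmod z)\<^sup>2)
        * (exp (\<alpha> / 2 * (cmod z)\<^sup>2) * exp (- \<beta> * (cmod z)\<^sup>2))))"
      unfolding e_def power2_eq_square[of M] by (simp only: mult_ac)
    also have "\<dots> = 2 * M\<^sup>2 * (exp (2 * \<alpha>) + \<alpha>\<^sup>2) * exp (- (\<beta> - \<alpha>) * (cmod z)\<^sup>2 + (2 * \<alpha> + 2) * cmod z)"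
      by (simp add: exp_add[symmetric] algebra_simps)
    finally show "norm (2 * Re (A x z) * e z) \<le>
        2 * M\<^sup>2 * (exp (2 * \<alpha>) + \<alpha>\<^sup>2) * exp (- (\<beta> - \<alpha>) * (cmod z)\<^sup>2 + (2 * \<alpha> + 2) * cmod z)"
      by (simp add: abs_mult e_def)
  qed (use r in auto)
  moreover have "(\<integral>z. 2 * Re (A r z) * e z \<partial>lborel) = energy_rate \<beta> r"
  proof -
    define X where "X = (\<lambda>z. deriv (deriv (W r)) z * cnj (W r z) * of_real (e z))"
    define Y where "Y = (\<lambda>z. W r z * cnj (z * (z * W r z)) * of_real (e z))"
    define Z where "Z = (\<lambda>z. (z * (z * W r z)) * cnj (W r z) * of_real (e z))"
    define K where "K = (\<integral>z. Re (z\<^sup>2) * (cmod (W r z))\<^sup>2 * e z \<partial>lborel)"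
    have X: "integrable lborel X" unfolding X_def e_def
      using \<beta> by (intro integrable_growth[OF gr2 gr]) simp_all
    have Y: "integrable lborel Y" unfolding Y_def e_def
      using \<beta> by (intro integrable_growth[OF gr grz(2)]) simp_all
    have Z: "integrable lborel Z" unfolding Z_def e_def
      using \<beta> by (intro integrable_growth[OF grz(2) gr]) simp_all
    have "(\<integral>z. X z \<partial>lborel) = of_real \<beta> * (\<integral>z. deriv (W r) z * cnj (z * W r z) * of_real (e z) \<partial>lborel)"
      unfolding X_def e_def using \<alpha> \<beta> by (intro gaussian_adjoint[OF hol1 hol gr1 gr]) auto
    also have "(\<integral>z. deriv (W r) z * cnj (z * W r z) * of_real (e z) \<partial>lborel) = of_real \<beta> * (\<integral>z. Y z \<partial>lborel)"
      unfolding Y_def e_def using \<alpha> \<beta>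
      by (intro gaussian_adjoint[OF hol _ gr grz(1)]) (auto intro!: holomorphic_intros hol)
    finally have X_eq: "(\<integral>z. X z \<partial>lborel) = of_real (\<beta>\<^sup>2) * (\<integral>z. Y z \<partial>lborel)"
      by (simp add: power2_eq_square)
    have sq: "w * cnj w = of_real ((cmod w)\<^sup>2)" for w using complex_norm_square[of w] by simp
    have Yz: "Y z = cnj (z\<^sup>2) * of_real ((cmod (W r z))\<^sup>2 * e z)" for z
      unfolding Y_def of_real_mult[of "(cmod (W r z))\<^sup>2"] sq[symmetric] by (simp add: power2_eq_square)
    have Zz: "Z z = z\<^sup>2 * of_real ((cmod (W r z))\<^sup>2 * e z)" for z
      unfolding Z_def of_real_mult[of "(cmod (W r z))\<^sup>2"] sq[symmetric] by (simp add: power2_eq_square)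
    have Re_mult: "Re (u * of_real v) = Re u * v" for u v by simp
    have "Re (Y z) = Re (z\<^sup>2) * (cmod (W r z))\<^sup>2 * e z" "Re (Z z) = Re (z\<^sup>2) * (cmod (W r z))\<^sup>2 * e z" for z
      unfolding Yz Zz Re_mult by (simp_all add: mult.assoc del: complex_cnj_power)
    then have ReY: "Re (\<integral>z. Y z \<partial>lborel) = K" and ReZ: "Re (\<integral>z. Z z \<partial>lborel) = K"
      using integral_Re[OF Y] integral_Re[OF Z] by (simp_all only: K_def)
    have "2 * Re (A r z) * e z = 2 * Re (X z - of_real (\<alpha>\<^sup>2) * Z z)" for z
    proof -
      have "X z - of_real (\<alpha>\<^sup>2) * Z z = A r z * of_real (e z)"
        by (simp add: X_def Z_def A_def power2_eq_square algebra_simps)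
      then show ?thesis by simp
    qed
    then have "(\<integral>z. 2 * Re (A r z) * e z \<partial>lborel) = (\<integral>z. 2 * Re (X z - of_real (\<alpha>\<^sup>2) * Z z) \<partial>lborel)"
      by (simp only:)
    also have "\<dots> = 2 * Re (\<integral>z. X z - of_real (\<alpha>\<^sup>2) * Z z \<partial>lborel)"
      using X Z by (subst integral_mult_right_zero, subst integral_Re) auto
    also have "(\<integral>z. X z - of_real (\<alpha>\<^sup>2) * Z z \<partial>lborel) = of_real (\<beta>\<^sup>2) * (\<integral>z. Y z \<partial>lborel) - of_real (\<alpha>\<^sup>2) * (\<integral>z. Z z \<partial>lborel)"
      using X Z by (simp add: X_eq)
    also have "2 * Re (of_real (\<beta>\<^sup>2) * (\<integral>z. Y z \<partial>lborel) - of_real (\<alpha>\<^sup>2) * (\<integral>z. Z z \<partial>lborel)) = 2 * (\<beta>\<^sup>2 - \<alpha>\<^sup>2) * K"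
      unfolding minus_complex.sel Re_complex_of_real times_complex.sel Im_complex_of_real ReY ReZ
      by (simp add: algebra_simps)
    finally show ?thesis unfolding energy_rate_def K_def e_def by simp
  qed
  ultimately show ?thesis by simp
qed

text \<open>
  The factor \<open>x exp (- x)\<close> with \<open>x = (\<beta> - \<alpha>) |z|\<^sup>2\<close> is at most \<open>1\<close> and tends to \<open>0\<close> pointwise as
  \<open>\<beta>\<close> tends to \<open>\<alpha>\<close>, which gives dominated convergence both in \<open>z\<close> and in time.
\<close>

lemma norm_energy_rate_le:
  assumes \<beta>: "\<beta> > \<alpha>" and t: "t \<ge> 0"
  shows "\<bar>energy_rate \<beta> t\<bar> \<le> 2 * (\<beta> + \<alpha>) * (\<integral>z. ((\<beta> - \<alpha>) * (cmod z)\<^sup>2 * exp (- ((\<beta> - \<alpha>) * (cmod z)\<^sup>2)))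
      * ((cmod (W t z))\<^sup>2 * exp (- \<alpha> * (cmod z)\<^sup>2)) \<partial>lborel)" (is "_ \<le> _ * ?I")
    and "integrable lborel (\<lambda>z. ((\<beta> - \<alpha>) * (cmod z)\<^sup>2 * exp (- ((\<beta> - \<alpha>) * (cmod z)\<^sup>2)))
      * ((cmod (W t z))\<^sup>2 * exp (- \<alpha> * (cmod z)\<^sup>2)))" (is "integrable _ ?f")
proof -
  have [measurable]: "W t \<in> borel_measurable borel" by (rule W_measurable[OF t])
  have le1: "x * exp (- x) \<le> 1" for x :: real
    using exp_gt_self[of x] by (simp add: exp_minus field_simps)
  show f: "integrable lborel ?f"
  proof (rule Bochner_Integration.integrable_bound[OF W_integrable[OF t]])
    show "AE z in lborel. norm (?f z) \<le> norm ((cmod (W t z))\<^sup>2 * exp (- \<alpha> * (cmod z)\<^sup>2))"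
    proof (rule AE_I2)
      fix z
      have "0 \<le> ?f z" using \<beta> by simp
      moreover have "?f z \<le> 1 * ((cmod (W t z))\<^sup>2 * exp (- \<alpha> * (cmod z)\<^sup>2))"
        by (intro mult_right_mono le1) simp
      ultimately show "norm (?f z) \<le> norm ((cmod (W t z))\<^sup>2 * exp (- \<alpha> * (cmod z)\<^sup>2))" by simp
    qed
  qed measurable
  have fz: "?f z = (\<beta> - \<alpha>) * ((cmod z)\<^sup>2 * (cmod (W t z))\<^sup>2 * exp (- \<beta> * (cmod z)\<^sup>2))" for z
  proof -
    have "exp (- ((\<beta> - \<alpha>) * (cmod z)\<^sup>2)) * exp (- \<alpha> * (cmod z)\<^sup>2) = exp (- \<beta> * (cmod z)\<^sup>2)"
      by (simp add: exp_add[symmetric] algebra_simps)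
    then show ?thesis by (metis (no_types, lifting) mult.assoc mult.left_commute)
  qed
  have If: "?I = (\<beta> - \<alpha>) * (\<integral>z. (cmod z)\<^sup>2 * (cmod (W t z))\<^sup>2 * exp (- \<beta> * (cmod z)\<^sup>2) \<partial>lborel)"
    unfolding fz by simp
  have int: "integrable lborel (\<lambda>z. (cmod z)\<^sup>2 * (cmod (W t z))\<^sup>2 * exp (- \<beta> * (cmod z)\<^sup>2))"
    using f \<beta> unfolding fz by (simp only: integrable_mult_left_iff) auto
  have "\<bar>\<integral>z. Re (z\<^sup>2) * (cmod (W t z))\<^sup>2 * exp (- \<beta> * (cmod z)\<^sup>2) \<partial>lborel\<bar>
      \<le> (\<integral>z. (cmod z)\<^sup>2 * (cmod (W t z))\<^sup>2 * exp (- \<beta> * (cmod z)\<^sup>2) \<partial>lborel)" (is "\<bar>?K\<bar> \<le> ?N")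
  proof -
    have le: "\<bar>Re (z\<^sup>2) * (cmod (W t z))\<^sup>2 * exp (- \<beta> * (cmod z)\<^sup>2)\<bar>
        \<le> (cmod z)\<^sup>2 * (cmod (W t z))\<^sup>2 * exp (- \<beta> * (cmod z)\<^sup>2)" for z
      using abs_Re_le_cmod[of "z\<^sup>2"] unfolding abs_mult norm_power
      by (intro mult_mono) auto
    have "integrable lborel (\<lambda>z. Re (z\<^sup>2) * (cmod (W t z))\<^sup>2 * exp (- \<beta> * (cmod z)\<^sup>2))"
      by (rule Bochner_Integration.integrable_bound[OF int]) (use le in \<open>auto simp: abs_mult\<close>)
    then show ?thesis
      using Bochner_Integration.integral_norm_bound_integral[OF _ int, of "\<lambda>z. Re (z\<^sup>2) * (cmod (W t z))\<^sup>2 * exp (- \<beta> * (cmod z)\<^sup>2)"] le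
      by simp
  qed
  then have "2 * (\<beta> + \<alpha>) * (\<beta> - \<alpha>) * \<bar>?K\<bar> \<le> 2 * (\<beta> + \<alpha>) * (\<beta> - \<alpha>) * ?N"
    using \<beta> \<alpha> by (intro mult_left_mono) auto
  moreover have "\<bar>energy_rate \<beta> t\<bar> = 2 * (\<beta> + \<alpha>) * (\<beta> - \<alpha>) * \<bar>?K\<bar>"
  proof -
    have "2 * (\<beta>\<^sup>2 - \<alpha>\<^sup>2) = 2 * (\<beta> + \<alpha>) * (\<beta> - \<alpha>)" by (simp add: power2_eq_square algebra_simps)
    moreover have "0 \<le> 2 * (\<beta> + \<alpha>) * (\<beta> - \<alpha>)" using \<beta> \<alpha> by simp
    ultimately show ?thesis unfolding energy_rate_def abs_mult[of "2 * (\<beta>\<^sup>2 - \<alpha>\<^sup>2)"] by (simp only: abs_of_nonneg)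
  qed
  ultimately show "\<bar>energy_rate \<beta> t\<bar> \<le> 2 * (\<beta> + \<alpha>) * ?I"
    unfolding If by (simp only: mult.assoc)
qed

lemma energy_constant_if_bounded:
  assumes st: "0 \<le> s" "s \<le> t" and bnd: "\<And>r. r \<in> {s..t} \<Longrightarrow> energy r \<le> B"
  shows "energy s = energy t"
proof -
  define \<beta> where "\<beta> = (\<lambda>k. \<alpha> + inverse (real (Suc k)))"
  have \<beta>: "\<beta> k > \<alpha>" "\<beta> k - \<alpha> = inverse (real (Suc k))" "\<beta> k \<le> \<alpha> + 1" for k
    by (auto simp: \<beta>_def inverse_eq_divide)
  have \<beta>_lim: "\<beta> \<longlonglongrightarrow> \<alpha>"
    unfolding \<beta>_def by (rule tendsto_eq_intros LIMSEQ_inverse_real_of_nat | simp)+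
  \<comment> \<open>Continuity up to the endpoints, where the equation need not hold: \<open>s\<close> may be \<open>0\<close>.\<close>
  have damped_cont: "continuous_on {s..t} (damped_energy (\<beta> k))" for k
    unfolding continuous_on_sequentially
  proof (intro allI ballI impI, elim conjE)
    fix x r assume r: "r \<in> {s..t}" and x: "\<forall>n. x n \<in> {s..t}" and lim: "x \<longlonglongrightarrow> r"
    have x0: "x n \<ge> 0" for n using x st(1) by (auto intro: order_trans)
    have r0: "r \<ge> 0" using r st by simp
    have "(\<lambda>n. damped_energy (\<beta> k) (x n)) \<longlonglongrightarrow> damped_energy (\<beta> k) r"
      unfolding damped_energy_def
    proof (rule integral_dominated_convergence[where
          w = "\<lambda>z. \<alpha> / pi * B * exp (- (\<beta> k - \<alpha>) * (cmod z)\<^sup>2 + 0 * cmod z)"])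
      show "integrable lborel (\<lambda>z::complex. \<alpha> / pi * B * exp (- (\<beta> k - \<alpha>) * (cmod z)\<^sup>2 + 0 * cmod z))"
        using \<beta>(1)[of k] by (intro integrable_mult_right integrable_exp_quadratic) simp
      show "AE z in lborel. (\<lambda>n. (cmod (W (x n) z))\<^sup>2 * exp (- \<beta> k * (cmod z)\<^sup>2))
          \<longlonglongrightarrow> (cmod (W r z))\<^sup>2 * exp (- \<beta> k * (cmod z)\<^sup>2)"
        by (intro AE_I2 tendsto_intros W_continuous x0 r0 lim)
      show "AE z in lborel. norm ((cmod (W (x n) z))\<^sup>2 * exp (- \<beta> k * (cmod z)\<^sup>2))
          \<le> \<alpha> / pi * B * exp (- (\<beta> k - \<alpha>) * (cmod z)\<^sup>2 + 0 * cmod z)" for n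
        using norm_sq_integrand[OF bnd st(1) x[rule_format, of n], of _ "\<beta> k"]
        by (intro AE_I2) (simp only: real_norm_def abs_mult abs_exp_cancel abs_power2)
    qed (use integrable_damped[OF \<beta>(1)] x0 r0 in auto)
    then show "(damped_energy (\<beta> k) \<circ> x) \<longlonglongrightarrow> damped_energy (\<beta> k) r" by (simp add: o_def)
  qed
  have has_int: "(energy_rate (\<beta> k) has_integral (damped_energy (\<beta> k) t - damped_energy (\<beta> k) s)) {s..t}" for k
    by (intro fundamental_theorem_of_calculus_interior st damped_cont damped_energy_deriv[OF \<beta>(1) st(1) bnd])
  have "(\<lambda>k. integral {s..t} (energy_rate (\<beta> k))) \<longlonglongrightarrow> integral {s..t} (\<lambda>_. 0)"
  proof (rule dominated_convergence(2))
    show "energy_rate (\<beta> k) integrable_on {s..t}" for k using has_int by blast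
    show "(\<lambda>_. 2 * (\<alpha> + 1 + \<alpha>) * B) integrable_on {s..t}"
      by (intro integrable_continuous_real continuous_on_const)
    fix r assume r: "r \<in> {s..t}"
    then have r0: "r \<ge> 0" using st by simp
    define D where "D = (\<lambda>k z. ((\<beta> k - \<alpha>) * (cmod z)\<^sup>2 * exp (- ((\<beta> k - \<alpha>) * (cmod z)\<^sup>2)))
      * ((cmod (W r z))\<^sup>2 * exp (- \<alpha> * (cmod z)\<^sup>2)))"
    have rate: "\<bar>energy_rate (\<beta> k) r\<bar> \<le> 2 * (\<alpha> + 1 + \<alpha>) * (\<integral>z. D k z \<partial>lborel)" for k
    proof -
      have "\<bar>energy_rate (\<beta> k) r\<bar> \<le> 2 * (\<beta> k + \<alpha>) * (\<integral>z. D k z \<partial>lborel)"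
        unfolding D_def by (rule norm_energy_rate_le[OF \<beta>(1) r0])
      also have "\<dots> \<le> 2 * (\<alpha> + 1 + \<alpha>) * (\<integral>z. D k z \<partial>lborel)"
        using \<beta>(1,3)[of k] by (intro mult_right_mono mult_left_mono integral_nonneg_AE) (auto simp: D_def)
      finally show ?thesis .
    qed
    have D_le: "norm (D k z) \<le> (cmod (W r z))\<^sup>2 * exp (- \<alpha> * (cmod z)\<^sup>2)" for k z
    proof -
      have "x * exp (- x) \<le> 1" for x :: real
        using exp_gt_self[of x] by (simp add: exp_minus field_simps)
      then have "D k z \<le> 1 * ((cmod (W r z))\<^sup>2 * exp (- \<alpha> * (cmod z)\<^sup>2))"
        unfolding D_def by (intro mult_right_mono) simp_all
      moreover have "0 \<le> D k z" using \<beta>(1)[of k] by (simp add: D_def)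
      ultimately show ?thesis by simp
    qed
    have D_int: "integrable lborel (D k)" for k
      unfolding D_def by (rule norm_energy_rate_le(2)[OF \<beta>(1) r0])
    show "norm (energy_rate (\<beta> k) r) \<le> 2 * (\<alpha> + 1 + \<alpha>) * B" for k
    proof -
      have "(\<integral>z. D k z \<partial>lborel) \<le> energy r"
        unfolding energy_def using D_le
        by (intro integral_mono D_int W_integrable r0) (simp add: abs_le_iff)
      also have "\<dots> \<le> B" by (rule bnd[OF r])
      finally have "2 * (\<alpha> + 1 + \<alpha>) * (\<integral>z. D k z \<partial>lborel) \<le> 2 * (\<alpha> + 1 + \<alpha>) * B"
        using \<alpha> by (intro mult_left_mono) auto
      then show ?thesis using rate[of k] by simp
    qed
    have "(\<lambda>k. \<integral>z. D k z \<partial>lborel) \<longlonglongrightarrow> (\<integral>z. 0 \<partial>(lborel :: complex measure))"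
    proof (rule integral_dominated_convergence[where w = "\<lambda>z. (cmod (W r z))\<^sup>2 * exp (- \<alpha> * (cmod z)\<^sup>2)"])
      show "AE z in lborel. (\<lambda>k. D k z) \<longlonglongrightarrow> 0"
      proof (rule AE_I2)
        fix z
        have "(\<lambda>k. D k z) \<longlonglongrightarrow> ((\<alpha> - \<alpha>) * (cmod z)\<^sup>2 * exp (- ((\<alpha> - \<alpha>) * (cmod z)\<^sup>2)))
            * ((cmod (W r z))\<^sup>2 * exp (- \<alpha> * (cmod z)\<^sup>2))"
          unfolding D_def by (intro tendsto_intros \<beta>_lim)
        then show "(\<lambda>k. D k z) \<longlonglongrightarrow> 0" by simp
      qed
      show "AE z in lborel. norm (D k z) \<le> (cmod (W r z))\<^sup>2 * exp (- \<alpha> * (cmod z)\<^sup>2)" for k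
        using D_le by simp
    qed (use W_integrable[OF r0] D_int in auto)
    then have "(\<lambda>k. 2 * (\<alpha> + 1 + \<alpha>) * (\<integral>z. D k z \<partial>lborel)) \<longlonglongrightarrow> 0"
      using tendsto_mult_right_zero by fastforce
    then show "(\<lambda>k. energy_rate (\<beta> k) r) \<longlonglongrightarrow> 0"
      by (rule Lim_null_comparison[rotated]) (use rate in simp)
  qed
  then have "(\<lambda>k. damped_energy (\<beta> k) t - damped_energy (\<beta> k) s) \<longlonglongrightarrow> 0"
    using integral_unique[OF has_int] by simp
  moreover have "(\<lambda>k. damped_energy (\<beta> k) r) \<longlonglongrightarrow> energy r" if r0: "r \<ge> 0" for r
    unfolding damped_energy_def energy_def
  proof (rule integral_dominated_convergence[where w = "\<lambda>z. (cmod (W r z))\<^sup>2 * exp (- \<alpha> * (cmod z)\<^sup>2)"])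
    show "AE z in lborel. (\<lambda>k. (cmod (W r z))\<^sup>2 * exp (- \<beta> k * (cmod z)\<^sup>2))
        \<longlonglongrightarrow> (cmod (W r z))\<^sup>2 * exp (- \<alpha> * (cmod z)\<^sup>2)"
      by (intro AE_I2 tendsto_intros \<beta>_lim)
    show "AE z in lborel. norm ((cmod (W r z))\<^sup>2 * exp (- \<beta> k * (cmod z)\<^sup>2))
        \<le> (cmod (W r z))\<^sup>2 * exp (- \<alpha> * (cmod z)\<^sup>2)" for k
      using \<beta>(1)[of k] by (intro AE_I2) (simp add: abs_mult mult_left_mono mult_right_mono)
  qed (use W_integrable[OF r0] integrable_damped[OF \<beta>(1) r0] in auto)
  then have "(\<lambda>k. damped_energy (\<beta> k) t - damped_energy (\<beta> k) s) \<longlonglongrightarrow> energy t - energy s"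
    using st by (intro tendsto_diff) auto
  ultimately show ?thesis using LIMSEQ_unique by fastforce
qed

lemma vanishes_if_initially_zero:
  assumes "\<And>z. W 0 z = 0" "t \<ge> 0"
  shows "W t z = 0"
proof -
  have "energy 0 = energy t"
  proof (rule constant_if_constant_where_bounded[OF assms(2) energy_lsc])
    fix s r B assume "0 \<le> s" "s \<le> r" "\<And>x. x \<in> {s..r} \<Longrightarrow> energy x \<le> B"
    then show "energy s = energy r" by (rule energy_constant_if_bounded)
  qed
  moreover have "energy 0 = 0" by (simp add: energy_def assms)
  ultimately show ?thesis using W_pointwise[OF assms(2), of 0 z] by simp
qed

end

lemma fock_space_diff_scale:
  assumes \<alpha>: "\<alpha> > 0" and "f \<in> fock_space \<alpha>" "g \<in> fock_space \<alpha>"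
  shows "(\<lambda>z. c * (f z - g z)) \<in> fock_space \<alpha>"
proof -
  have f: "f holomorphic_on UNIV" "integrable (gaussian_measure \<alpha>) (\<lambda>z. (cmod (f z))\<^sup>2)"
    and g: "g holomorphic_on UNIV" "integrable (gaussian_measure \<alpha>) (\<lambda>z. (cmod (g z))\<^sup>2)"
    using assms by (auto simp: fock_space_def)
  have [measurable]: "f \<in> borel_measurable borel" "g \<in> borel_measurable borel"
    using f g by (auto intro: entire_measurable)
  have "integrable (gaussian_measure \<alpha>) (\<lambda>z. (cmod (c * (f z - g z)))\<^sup>2)"
  proof (rule Bochner_Integration.integrable_bound)
    show "integrable (gaussian_measure \<alpha>) (\<lambda>z. 2 * (cmod c)\<^sup>2 * ((cmod (f z))\<^sup>2 + (cmod (g z))\<^sup>2))"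
      using f g by simp
    have "(cmod (c * (f z - g z)))\<^sup>2 \<le> 2 * (cmod c)\<^sup>2 * ((cmod (f z))\<^sup>2 + (cmod (g z))\<^sup>2)" for z
    proof -
      have "(cmod (f z - g z))\<^sup>2 \<le> (cmod (f z) + cmod (g z))\<^sup>2"
        by (intro power_mono norm_triangle_ineq4) simp
      also have "\<dots> \<le> 2 * ((cmod (f z))\<^sup>2 + (cmod (g z))\<^sup>2)"
        using sum_squares_bound[of "cmod (f z)" "cmod (g z)"] by (simp add: power2_sum)
      finally have "(cmod c)\<^sup>2 * (cmod (f z - g z))\<^sup>2 \<le> (cmod c)\<^sup>2 * (2 * ((cmod (f z))\<^sup>2 + (cmod (g z))\<^sup>2))"
        by (rule mult_left_mono) simp
      then show ?thesis unfolding norm_mult power_mult_distrib by (simp add: algebra_simps)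
    qed
    then show "AE z in gaussian_measure \<alpha>. norm ((cmod (c * (f z - g z)))\<^sup>2)
        \<le> norm (2 * (cmod c)\<^sup>2 * ((cmod (f z))\<^sup>2 + (cmod (g z))\<^sup>2))" by simp
    show "(\<lambda>z. (cmod (c * (f z - g z)))\<^sup>2) \<in> borel_measurable (gaussian_measure \<alpha>)" by measurable
  qed
  then show ?thesis using f g by (auto simp: fock_space_def intro!: holomorphic_intros)
qed

lemma heat_solution_unique:
  assumes a: "a > 0" and V: "heat_solution a V\<^sub>0 V" and U: "heat_solution a V\<^sub>0 U" and t: "t \<ge> 0"
  shows "V t z = U t z"
proof -
  define W where "W = (\<lambda>t z. of_real (exp (a / 2 * t)) * (V t z - U t z))"
  have VF: "V t \<in> fock_space (a / 2)" and UF: "U t \<in> fock_space (a / 2)" if "t \<ge> 0" for t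
    using V U that by (auto simp: heat_solution_def)
  have hol: "V t holomorphic_on UNIV" "U t holomorphic_on UNIV" if "t \<ge> 0" for t
    using VF[OF that] UF[OF that] by (auto simp: fock_space_def)
  interpret energy "a / 2" W
  proof
    show "a / 2 > 0" using a by simp
    show "W t \<in> fock_space (a / 2)" if "t \<ge> 0" for t
      unfolding W_def using a by (intro fock_space_diff_scale VF UF that) simp
    have "continuous_on ({0..} \<times> UNIV) (\<lambda>p. V (fst p) (snd p))"
      "continuous_on ({0..} \<times> UNIV) (\<lambda>p. U (fst p) (snd p))"
      using V U by (auto simp: heat_solution_def case_prod_beta)
    then show "continuous_on ({0..} \<times> UNIV) (\<lambda>(t, z). W t z)"
      unfolding W_def case_prod_beta by (intro continuous_intros)
    fix t :: real and z assume t: "t > 0"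
    have d1: "deriv (W t) = (\<lambda>z. of_real (exp (a / 2 * t)) * (deriv (V t) z - deriv (U t) z))"
      unfolding W_def using t hol[of t]
      by (intro ext DERIV_imp_deriv DERIV_cmult DERIV_diff) (auto intro!: holomorphic_derivI)
    have "deriv (V t) holomorphic_on UNIV" "deriv (U t) holomorphic_on UNIV"
      using t hol[of t] by (auto intro!: holomorphic_deriv)
    then have d2: "deriv (deriv (W t)) z = of_real (exp (a / 2 * t)) * (deriv (deriv (V t)) z - deriv (deriv (U t)) z)"
      unfolding d1
      by (intro DERIV_imp_deriv DERIV_cmult DERIV_diff) (auto intro!: holomorphic_derivI)
    have "((\<lambda>t. exp (a / 2 * t)) has_real_derivative a / 2 * exp (a / 2 * t)) (at t)"
      by (auto intro!: derivative_eq_intros)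
    then have e: "((\<lambda>t. complex_of_real (exp (a / 2 * t))) has_vector_derivative of_real (a / 2 * exp (a / 2 * t))) (at t)"
      by (rule has_vector_derivative_of_real)
    have "((\<lambda>t. V t z - U t z) has_vector_derivative harmonic_op a (V t) z - harmonic_op a (U t) z) (at t)"
      using V U t by (intro has_vector_derivative_diff) (auto simp: heat_solution_def)
    from has_vector_derivative_mult[OF e this]
    have "((\<lambda>s. W s z) has_vector_derivative of_real (exp (a / 2 * t)) * (harmonic_op a (V t) z - harmonic_op a (U t) z)
        + of_real (a / 2 * exp (a / 2 * t)) * (V t z - U t z)) (at t)"
      unfolding W_def .
    moreover have "of_real (exp (a / 2 * t)) * (harmonic_op a (V t) z - harmonic_op a (U t) z)
        + of_real (a / 2 * exp (a / 2 * t)) * (V t z - U t z)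
      = deriv (deriv (W t)) z - of_real (a / 2) ^ 2 * z\<^sup>2 * W t z"
      unfolding d2 unfolding W_def harmonic_op_def by (simp add: field_simps power2_eq_square)
    ultimately show "((\<lambda>s. W s z) has_vector_derivative deriv (deriv (W t)) z - of_real (a / 2) ^ 2 * z\<^sup>2 * W t z) (at t)"
      by simp
  qed
  have "W 0 z = 0" for z using V U by (simp add: W_def heat_solution_def)
  from vanishes_if_initially_zero[OF this t, of z] show ?thesis by (simp add: W_def)
qed

theorem theorem6p1:
  fixes a :: real and V\<^sub>0 :: "complex \<Rightarrow> complex"
  assumes "a > 0" and "V\<^sub>0 \<in> fock_space (a / 2)"
  defines "U \<equiv> \<lambda>t z. of_real (exp (- a * t / 2)) / (2 * \<i>) *
             (\<integral>w. heat_kernel a z w t * V\<^sub>0 w \<partial>gaussian_measure (a / 2))"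
  shows "(\<forall>t\<ge>0. \<forall>z. integrable (gaussian_measure (a / 2)) (\<lambda>w. heat_kernel a z w t * V\<^sub>0 w)) \<and>
         heat_solution a V\<^sub>0 U \<and>
         (\<forall>V. heat_solution a V\<^sub>0 V \<longrightarrow> (\<forall>t\<ge>0. \<forall>z. V t z = U t z))"
proof -
  interpret heat_flow a V\<^sub>0 by unfold_locales (use assms in auto)
  have kernel: "propagator a t z w * V\<^sub>0 w
      = of_real (exp (- a * t / 2)) / (2 * \<i>) * (heat_kernel a z w t * V\<^sub>0 w)" for t z w
    unfolding propagator_eq_heat_kernel by (simp only: mult.assoc)
  have U: "U = flow"
    unfolding U_def flow_def kernel by (intro ext) (rule integral_mult_right_zero[symmetric])
  have "integrable (gaussian_measure (a / 2)) (\<lambda>w. heat_kernel a z w t * V\<^sub>0 w)" if "t \<ge> 0" for t z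
  proof -
    define c where "c = complex_of_real (exp (- a * t / 2)) / (2 * \<i>)"
    have "c \<noteq> 0" by (simp add: c_def)
    moreover have "integrable G (\<lambda>w. inverse c * (c * (heat_kernel a z w t * V\<^sub>0 w)))"
      using integrable_propagator(1)[OF that, of z] unfolding kernel c_def[symmetric]
      by (rule integrable_mult_right)
    ultimately show ?thesis by (simp add: mult.assoc[symmetric])
  qed
  with heat_solution_flow heat_solution_unique[OF \<open>a > 0\<close> _ heat_solution_flow]
  show ?thesis unfolding U by blast
qed

end
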